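(* Let $\Omega\subset\mathbb{R}^n$ be a bounded Lipschitz polyhedron, $m$ a polynomial degree, $\mathbf{b}\in W^1_\infty(\operatorname{div};\Omega)$, $c\in W^1_\infty(\Omega)$ with $|\mathbf{b}|^{-1}\in L_\infty(\Omega)$, and assume that $\mathcal{B}:u\mapsto\mathbf{b}\cdot\nabla u+cu$ is a boundedly invertible operator from $H_{0,\Gamma_-}(\mathbf{b};\Omega)$ onto $L_2(\Omega)$. Consider families $\{\Omega_H:H\in\mathcal{I}\}$ of partitions of $\Omega$ into $n$-simplices, together with, for each $H\in\mathcal{I}$, a refinement $\Omega_h=\Omega_{h(H)}$ of $\Omega_H$ into $n$-simplices, that are uniformly shape regular, i.e., for given constants $\varrho_*, C_*$, $$\varrho:=\sup_{H\in\mathcal{I}}\max_{K'\in\Omega_H}\varrho_{K'}\le\varrho_*<\infty,\qquad \bar\varrho:=\sup_{H\in\mathcal{I}}\max_{K\in\Omega_{h}}\varrho_K\le C_*\,\varrho ,$$ and set $$\sigma:=\sup_{H\in\mathcal{I}}\max_{K'\in\Omega_H}\max\Bigl(\max_{\{K\in\Omega_h:K\subset K'\}}\frac{\operatorname{diam}(K)}{\operatorname{diam}(K')},\ \operatorname{diam}(K')\Bigr).$$ Then there exists a $\sigma_0>0$ such that whenever $0<\sigma\le\sigma_0$, for all $H\in\mathcal{I}$ and all $$(u,w)\in\mathbb{U}^H:=\prod_{K'\in\Omega_H}\mathcal{P}_m(K')\times\Bigl(H_{0,\Gamma_-}(\mathbf{b};\Omega)\cap\prod_{K'\in\Omega_H}\mathcal{P}_m(K')\Bigr),$$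 the piecewise polynomial $\breve t=\breve t(u,w)\in\prod_{K\in\Omega_h}\mathcal{P}_{m+1}(K)$ defined in the context satisfies $$b_h(u,w|_{\partial\Omega_h};\breve t)\ \ge\ \gamma\,\|(u,w)\|_{\mathbb{U}}\,\|\breve t\|_{\mathbb{V}},$$ where $\gamma>0$ depends only on (the dimension $n$ and) upper bounds for $m$, $\varrho$, $\bar\varrho$, $\|\mathbf{b}\|_{W^1_\infty(\operatorname{div};\Omega)}$, $\||\mathbf{b}|^{-1}\|_{L_\infty(\Omega)}$, $\|c\|_{W^1_\infty(\Omega)}$, and $\|\mathcal{B}^{-1}\|_{\mathcal{L}(L_2(\Omega),H_{0,\Gamma_-}(\mathbf{b};\Omega))}$.
   Context: $\mathbf{b}\in W^1_\infty(\operatorname{div};\Omega)$ means $\mathbf{b}\in W^1_\infty(\Omega)^n$ and $\operatorname{div}\mathbf{b}\in W^1_\infty(\Omega)$, with the corresponding norm. $H(\mathbf{b};\Omega):=\{u\in L_2(\Omega):\mathbf{b}\cdot\nabla u\in L_2(\Omega)\}$, $\|u\|_{H(\mathbf{b};\Omega)}^2:=\|u\|^2_{L_2(\Omega)}+\|\mathbf{b}\cdot\nabla u\|_{L_2(\Omega)}^2$. $\Gamma_-:=\{x\in\partial\Omega:\mathbf{b}(x)\cdot\mathbf{n}(x)<0\}$, $\mathbf{n}$ the outward unit normal. $H_{0,\Gamma_-}(\mathbf{b};\Omega)$ is the closure in $H(\mathbf{b};\Omega)$ of $\{u\in H(\mathbf{b};\Omega)\cap C(\bar\Omega):u=0\text{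 on }\Gamma_-\}$. A partition of $\Omega$ is a finite collection of disjoint open sets $K$ with $\bar\Omega=\bigcup\bar K$; $\Omega_h$ is a refinement of $\Omega_H$ if each $K\in\Omega_h$ is contained in some $K'\in\Omega_H$. Shape regularity parameter: $\varrho_K:=\operatorname{diam}(K)/\sup\{\operatorname{diam}(B):B\text{ a ball in }K\}$. $\mathcal{P}_m(K)$: polynomials of degree at most $m$ on $K$. $\mathbb{V}=H(\mathbf{b};\Omega_h):=\{v\in L_2(\Omega):\mathbf{b}\cdot\nabla_hv\in L_2(\Omega)\}$ ($\nabla_h$ the elementwise gradient w.r.t. $\Omega_h$), $\|v\|_{\mathbb{V}}^2:=\|v\|_{L_2(\Omega)}^2+\|\mathbf{b}\cdot\nabla_hv\|_{L_2(\Omega)}^2$. $\|(u,w)\|_{\mathbb{U}}^2:=\|u\|_{L_2(\Omega)}^2+\|w\|_{H(\mathbf{b};\Omega)}^2$. Bilinear form: for $u\in L_2(\Omega)$, $w\in H_{0,\Gamma_-}(\mathbf{b};\Omega)$, $v\in\mathbb{V}$, $$b_h(u,w|_{\partial\Omega_h};v):=\int_\Omega(cv-\mathbf{b}\cdot\nabla_hv-v\operatorname{div}\mathbf{b})u\,d\mathbf{x}+\sum_{K\in\Omega_h}\int_{\partial K}\mathbf{b}\cdot\mathbf{n}_K\,v\,w\,d\mathbf{s}$$ $$=\sum_{K\in\Omega_h}\int_K(c-\operatorname{div}\mathbf{b})vu+(w-u)\,\mathbf{b}\cdot\nabla v+v\,\mathbf{b}\cdot\nabla w+vw\operatorname{div}\mathbf{b}\,d\mathbf{x}.$$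 Local averages: for $K\in\Omega_h$, $\underline{\mathbf{b}}_K:=|K|^{-1}\int_K\mathbf{b}\,d\mathbf{x}$, $\underline{c}_K:=|K|^{-1}\int_K(c-\operatorname{div}\mathbf{b})\,d\mathbf{x}$, $\underline{d}_K:=|K|^{-1}\int_K\operatorname{div}\mathbf{b}\,d\mathbf{x}$. (For $\sigma$ small enough, $\underline{\mathbf{b}}_K\ne0$ for all $K\in\Omega_h$.) Definition of $\breve t$: fix $K\in\Omega_h$ with $\underline{\mathbf{b}}:=\underline{\mathbf{b}}_K\neq0$, $\underline c:=\underline c_K$, $\underline d:=\underline d_K$. Use Cartesian coordinates $(x,\mathbf{y})\in\mathbb{R}\times\mathbb{R}^{n-1}$ whose first basis vector is $\underline{\mathbf{b}}/|\underline{\mathbf{b}}|$. Among the inflow faces of $K$ (faces with outward normal $\mathbf{n}$ satisfying $\underline{\mathbf{b}}\cdot\mathbf{n}<0$), let $F$ be one whose normal direction makes the smallest (unoriented) angle with $\underline{\mathbf{b}}$, i.e., with $|\underline{\mathbf{b}}\cdot\mathbf{n}|$ maximal. Let $\bar x_-$ be the affine function of $\mathbf{y}$ such that $(\bar x_-(\mathbf{y}),\mathbf{y})$ lies in the hyperplane containing $F$. Extending the polynomials $u|_K,w|_K$ to $\mathbb{R}^n$, and writing $\partial_{\underline{\mathbf{b}}}:=\underline{\mathbf{b}}\cdot\nabla$, define $\breve t|_K:=\breve t_K$ by $$|\underline{\mathbf{b}}|\,\breve t_K(x,\mathbf{y}):=\bigl(w(\bar x_-(\mathbf{y}),\mathbf{y})-u(\bar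 x_-(\mathbf{y}),\mathbf{y})\bigr)\bigl(x-\bar x_-(\mathbf{y})\bigr)+|\underline{\mathbf{b}}|\bigl(\partial_{\underline{\mathbf{b}}}w+\underline{c}\,u+\underline{d}\,w\bigr)(\bar x_-(\mathbf{y}),\mathbf{y}).$$ *)

theory Defs
  imports "HOL-Analysis.Analysis" "HOL-Library.FuncSet" "HOL-Probability.Essential_Supremum"
begin

text \<open>
  Conventions.  The space is an arbitrary Euclidean space, so n = DIM('a).  Elements of
  Lebesgue and Sobolev spaces on an open set U are represented by functions on the whole
  space; only their values almost everywhere on U matter.  Weak derivatives are unique up to
  null sets, and the operators below pick an arbitrary representative.
\<close>

section \<open>Function spaces\<close>

definition L2 :: "'a::euclidean_space set \<Rightarrow> ('a \<Rightarrow> real) set" where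
  "L2 U = {u. u \<in> borel_measurable (lebesgue_on U) \<and> integrable (lebesgue_on U) (\<lambda>x. (u x)\<^sup>2)}"

definition L2_norm :: "'a::euclidean_space set \<Rightarrow> ('a \<Rightarrow> real) \<Rightarrow> real" where
  "L2_norm U u = sqrt (LINT x|lebesgue_on U. (u x)\<^sup>2)"

definition Linf_norm :: "'a::euclidean_space set \<Rightarrow> ('a \<Rightarrow> real) \<Rightarrow> ereal" where
  "Linf_norm U f = esssup (lebesgue_on U) (\<lambda>x. ereal \<bar>f x\<bar>)"

definition Linf :: "'a::euclidean_space set \<Rightarrow> ('a \<Rightarrow> real) set" where
  "Linf U = {f. f \<in> borel_measurable (lebesgue_on U) \<and> Linf_norm U f < \<infinity>}"

primrec C_k :: "nat \<Rightarrow> ('a::euclidean_space \<Rightarrow> real) \<Rightarrow> bool" where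
  "C_k 0 f \<longleftrightarrow> continuous_on UNIV f"
| "C_k (Suc k) f \<longleftrightarrow>
     f differentiable_on UNIV \<and> (\<forall>v. C_k k (\<lambda>x. frechet_derivative f (at x) v))"

definition test_functions :: "'a::euclidean_space set \<Rightarrow> ('a \<Rightarrow> real) set" where
  "test_functions U = {\<phi>. (\<forall>k. C_k k \<phi>) \<and>
     compact (closure {x. \<phi> x \<noteq> 0}) \<and> closure {x. \<phi> x \<noteq> 0} \<subseteq> U}"

definition is_weak_partial ::
  "'a::euclidean_space set \<Rightarrow> 'a \<Rightarrow> ('a \<Rightarrow> real) \<Rightarrow> ('a \<Rightarrow> real) \<Rightarrow> bool" where
  "is_weak_partial U i f g \<longleftrightarrow> (\<forall>\<phi>\<in>test_functions U.
     (LINT x|lebesgue_on U. g x * \<phi> x)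
       = - (LINT x|lebesgue_on U. f x * frechet_derivative \<phi> (at x) i))"

definition W1inf :: "'a::euclidean_space set \<Rightarrow> ('a \<Rightarrow> real) set" where
  "W1inf U = {f\<in>Linf U. \<forall>i\<in>Basis. \<exists>g\<in>Linf U. is_weak_partial U i f g}"

definition weak_partial :: "'a::euclidean_space set \<Rightarrow> 'a \<Rightarrow> ('a \<Rightarrow> real) \<Rightarrow> 'a \<Rightarrow> real" where
  "weak_partial U i f = (SOME g. g \<in> Linf U \<and> is_weak_partial U i f g)"

definition W1inf_norm :: "'a::euclidean_space set \<Rightarrow> ('a \<Rightarrow> real) \<Rightarrow> ereal" where
  "W1inf_norm U f = max (Linf_norm U f) (SUP i\<in>Basis. Linf_norm U (weak_partial U i f))"

definition weak_div :: "'a::euclidean_space set \<Rightarrow> ('a \<Rightarrow> 'a) \<Rightarrow> 'a \<Rightarrow> real" where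
  "weak_div U b = (\<lambda>x. \<Sum>i\<in>Basis. weak_partial U i (\<lambda>y. b y \<bullet> i) x)"

definition W1inf_div :: "'a::euclidean_space set \<Rightarrow> ('a \<Rightarrow> 'a) set" where
  "W1inf_div U = {b. (\<forall>j\<in>Basis. (\<lambda>x. b x \<bullet> j) \<in> W1inf U) \<and> weak_div U b \<in> W1inf U}"

definition W1inf_div_norm :: "'a::euclidean_space set \<Rightarrow> ('a \<Rightarrow> 'a) \<Rightarrow> ereal" where
  "W1inf_div_norm U b =
     max (SUP j\<in>Basis. W1inf_norm U (\<lambda>x. b x \<bullet> j)) (W1inf_norm U (weak_div U b))"

text \<open>
  The essential supremum of \<open>1/|b|\<close>.  The inverse is taken in \<^typ>\<open>ereal\<close>, where
  \<open>inverse 0 = \<infinity>\<close>, so that finiteness forces \<open>b \<noteq> 0\<close> almost everywhere.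
\<close>
definition inv_abs_norm :: "'a::euclidean_space set \<Rightarrow> ('a \<Rightarrow> 'a) \<Rightarrow> ereal" where
  "inv_abs_norm U b = esssup (lebesgue_on U) (\<lambda>x. inverse (ereal (norm (b x))))"

text \<open>
  \<open>g = b \<cdot> \<nabla>u\<close> in the sense of distributions, for u in L2 and b in \<open>W1inf_div\<close>:
  the pairing with a test function \<open>\<phi>\<close> is minus the integral of
  \<open>u div (\<phi> b) = u (b \<cdot> \<nabla>\<phi> + \<phi> div b)\<close>.
\<close>
definition is_adv ::
  "'a::euclidean_space set \<Rightarrow> ('a \<Rightarrow> 'a) \<Rightarrow> ('a \<Rightarrow> real) \<Rightarrow> ('a \<Rightarrow> real) \<Rightarrow> bool" where
  "is_adv U b u g \<longleftrightarrow> (\<forall>\<phi>\<in>test_functions U.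
     (LINT x|lebesgue_on U. g x * \<phi> x)
       = - (LINT x|lebesgue_on U.
              u x * (frechet_derivative \<phi> (at x) (b x) + \<phi> x * weak_div U b x)))"

definition adv :: "'a::euclidean_space set \<Rightarrow> ('a \<Rightarrow> 'a) \<Rightarrow> ('a \<Rightarrow> real) \<Rightarrow> 'a \<Rightarrow> real" where
  "adv U b u = (SOME g. g \<in> L2 U \<and> is_adv U b u g)"

definition H_adv :: "'a::euclidean_space set \<Rightarrow> ('a \<Rightarrow> 'a) \<Rightarrow> ('a \<Rightarrow> real) set" where
  "H_adv U b = {u\<in>L2 U. \<exists>g\<in>L2 U. is_adv U b u g}"

definition H_norm :: "'a::euclidean_space set \<Rightarrow> ('a \<Rightarrow> 'a) \<Rightarrow> ('a \<Rightarrow> real) \<Rightarrow> real" where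
  "H_norm U b u = sqrt ((L2_norm U u)\<^sup>2 + (L2_norm U (adv U b u))\<^sup>2)"

section \<open>The domain and the inflow boundary\<close>

definition lipschitz_domain :: "'a::euclidean_space set \<Rightarrow> bool" where
  "lipschitz_domain U \<longleftrightarrow> open U \<and> (\<forall>x\<in>frontier U. \<exists>r>0. \<exists>e g L. norm e = 1 \<and>
     L-lipschitz_on {z. z \<bullet> e = 0} g \<and>
     U \<inter> ball x r = {y\<in>ball x r. y \<bullet> e < g (y - (y \<bullet> e) *\<^sub>R e)})"

definition lipschitz_polyhedron :: "'a::euclidean_space set \<Rightarrow> bool" where
  "lipschitz_polyhedron U \<longleftrightarrow> lipschitz_domain U \<and> U \<noteq> {} \<and>
     (\<exists>\<P>. finite \<P> \<and> (\<forall>P\<in>\<P>. polytope P) \<and> closure U = \<Union>\<P>)"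

text \<open>
  On a polyhedron the outward unit normal exists exactly at the points near which the domain
  is a half-space; this leaves out only the lower-dimensional faces.
\<close>
definition is_outward_normal :: "'a::euclidean_space set \<Rightarrow> 'a \<Rightarrow> 'a \<Rightarrow> bool" where
  "is_outward_normal U x \<nu> \<longleftrightarrow> norm \<nu> = 1 \<and>
     (\<exists>r>0. U \<inter> ball x r = {y\<in>ball x r. (y - x) \<bullet> \<nu> < 0})"

text \<open>The boundary values of b are those of its continuous representative on the closure.\<close>
definition inflow_boundary :: "'a::euclidean_space set \<Rightarrow> ('a \<Rightarrow> 'a) \<Rightarrow> 'a set" where
  "inflow_boundary U b = {x\<in>frontier U. \<exists>\<beta> \<nu>.
     continuous_on (closure U) \<beta> \<and> (AE y in lebesgue_on U. \<beta> y = b y) \<and>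
     is_outward_normal U x \<nu> \<and> \<beta> x \<bullet> \<nu> < 0}"

definition H_adv_0 :: "'a::euclidean_space set \<Rightarrow> ('a \<Rightarrow> 'a) \<Rightarrow> ('a \<Rightarrow> real) set" where
  "H_adv_0 U b = {u\<in>H_adv U b. \<forall>\<epsilon>>0. \<exists>v\<in>H_adv U b.
     continuous_on (closure U) v \<and> (\<forall>x\<in>inflow_boundary U b. v x = 0) \<and>
     H_norm U b (\<lambda>x. u x - v x) < \<epsilon>}"

section \<open>The transport operator\<close>

definition transport_op ::
  "'a::euclidean_space set \<Rightarrow> ('a \<Rightarrow> 'a) \<Rightarrow> ('a \<Rightarrow> real) \<Rightarrow> ('a \<Rightarrow> real) \<Rightarrow> 'a \<Rightarrow> real" where
  "transport_op U b c u = (\<lambda>x. adv U b u x + c x * u x)"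

definition transport_inv ::
  "'a::euclidean_space set \<Rightarrow> ('a \<Rightarrow> 'a) \<Rightarrow> ('a \<Rightarrow> real) \<Rightarrow> ('a \<Rightarrow> real) \<Rightarrow> 'a \<Rightarrow> real" where
  "transport_inv U b c f =
     (SOME u. u \<in> H_adv_0 U b \<and> (AE x in lebesgue_on U. transport_op U b c u x = f x))"

definition transport_inv_norm ::
  "'a::euclidean_space set \<Rightarrow> ('a \<Rightarrow> 'a) \<Rightarrow> ('a \<Rightarrow> real) \<Rightarrow> ereal" where
  "transport_inv_norm U b c =
     (SUP f\<in>{f\<in>L2 U. L2_norm U f \<noteq> 0}. ereal (H_norm U b (transport_inv U b c f) / L2_norm U f))"

definition transport_boundedly_invertible ::
  "'a::euclidean_space set \<Rightarrow> ('a \<Rightarrow> 'a) \<Rightarrow> ('a \<Rightarrow> real) \<Rightarrow> bool" where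
  "transport_boundedly_invertible U b c \<longleftrightarrow>
     (\<forall>f\<in>L2 U. \<exists>u\<in>H_adv_0 U b. AE x in lebesgue_on U. transport_op U b c u x = f x) \<and>
     (\<forall>u\<in>H_adv_0 U b. \<forall>v\<in>H_adv_0 U b.
        (AE x in lebesgue_on U. transport_op U b c u x = transport_op U b c v x) \<longrightarrow>
        (AE x in lebesgue_on U. u x = v x)) \<and>
     transport_inv_norm U b c < \<infinity>"

section \<open>Partitions\<close>

definition is_partition :: "'a::euclidean_space set \<Rightarrow> 'a set set \<Rightarrow> bool" where
  "is_partition U P \<longleftrightarrow>
     finite P \<and> (\<forall>K\<in>P. open K) \<and> disjoint P \<and> closure U = (\<Union>K\<in>P. closure K)"

definition open_simplex :: "'a::euclidean_space set \<Rightarrow> bool" where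
  "open_simplex K \<longleftrightarrow> (\<exists>S. int DIM('a) simplex S \<and> K = interior S)"

definition simplicial_partition :: "'a::euclidean_space set \<Rightarrow> 'a set set \<Rightarrow> bool" where
  "simplicial_partition U P \<longleftrightarrow> is_partition U P \<and> (\<forall>K\<in>P. open_simplex K)"

definition is_refinement :: "'a set set \<Rightarrow> 'a set set \<Rightarrow> bool" where
  "is_refinement Q P \<longleftrightarrow> (\<forall>K\<in>Q. \<exists>K'\<in>P. K \<subseteq> K')"

definition shape_param :: "'a::euclidean_space set \<Rightarrow> real" where
  "shape_param K = diameter K / Sup {diameter (ball x r) |x r. ball x r \<subseteq> K}"

text \<open>
  A family of pairs of partitions \<open>(\<Omega>\<^sub>H, \<Omega>\<^sub>h)\<close> is given by the set T of its members: the
  pairs themselves serve as indices H.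
\<close>
definition coarse_shape :: "('a::euclidean_space set set \<times> 'a set set) set \<Rightarrow> ereal" where
  "coarse_shape T = (SUP (P, Q)\<in>T. SUP K'\<in>P. ereal (shape_param K'))"

definition fine_shape :: "('a::euclidean_space set set \<times> 'a set set) set \<Rightarrow> ereal" where
  "fine_shape T = (SUP (P, Q)\<in>T. SUP K\<in>Q. ereal (shape_param K))"

definition mesh_sigma :: "('a::euclidean_space set set \<times> 'a set set) set \<Rightarrow> ereal" where
  "mesh_sigma T = (SUP (P, Q)\<in>T. SUP K'\<in>P.
     max (SUP K\<in>{K\<in>Q. K \<subseteq> K'}. ereal (diameter K / diameter K')) (ereal (diameter K')))"

section \<open>Piecewise polynomials\<close>

definition multi_indices :: "nat \<Rightarrow> ('a::euclidean_space \<Rightarrow> nat) set" where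
  "multi_indices m = {\<alpha> \<in> Basis \<rightarrow>\<^sub>E UNIV. (\<Sum>i\<in>Basis. \<alpha> i) \<le> m}"

definition polys :: "nat \<Rightarrow> ('a::euclidean_space \<Rightarrow> real) set" where
  "polys m = {p. \<exists>a. \<forall>x. p x = (\<Sum>\<alpha>\<in>multi_indices m. a \<alpha> * (\<Prod>i\<in>Basis. (x \<bullet> i) ^ \<alpha> i))}"

definition pw_polys :: "nat \<Rightarrow> 'a::euclidean_space set set \<Rightarrow> ('a \<Rightarrow> real) set" where
  "pw_polys m P = {u. \<forall>K\<in>P. \<exists>p\<in>polys m. \<forall>x\<in>K. u x = p x}"

text \<open>The extension to the whole space of the polynomial that u coincides with on K.\<close>
definition poly_ext :: "nat \<Rightarrow> 'a::euclidean_space set \<Rightarrow> ('a \<Rightarrow> real) \<Rightarrow> 'a \<Rightarrow> real" where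
  "poly_ext m K u = (SOME p. p \<in> polys m \<and> (\<forall>x\<in>K. u x = p x))"

section \<open>Bilinear form and norms\<close>

text \<open>
  The elementwise volume form of \<open>b\<^sub>h(u, w|\<^sub>\<partial>\<^sub>\<Omega>\<^sub>h; v)\<close>, which also gives the meaning of the
  boundary integrals of \<open>b \<cdot> n v w\<close> when v and w have no separate traces.
\<close>
definition b_h :: "'a::euclidean_space set \<Rightarrow> ('a \<Rightarrow> 'a) \<Rightarrow> ('a \<Rightarrow> real) \<Rightarrow> 'a set set \<Rightarrow>
    ('a \<Rightarrow> real) \<Rightarrow> ('a \<Rightarrow> real) \<Rightarrow> ('a \<Rightarrow> real) \<Rightarrow> real" where
  "b_h U b c Q u w v = (\<Sum>K\<in>Q. LINT x|lebesgue_on K.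
     (c x - weak_div U b x) * v x * u x + (w x - u x) * adv K b v x
       + v x * adv U b w x + v x * w x * weak_div U b x)"

definition U_norm ::
  "'a::euclidean_space set \<Rightarrow> ('a \<Rightarrow> 'a) \<Rightarrow> ('a \<Rightarrow> real) \<Rightarrow> ('a \<Rightarrow> real) \<Rightarrow> real" where
  "U_norm U b u w = sqrt ((L2_norm U u)\<^sup>2 + (H_norm U b w)\<^sup>2)"

definition V_norm :: "'a::euclidean_space set \<Rightarrow> ('a \<Rightarrow> 'a) \<Rightarrow> 'a set set \<Rightarrow> ('a \<Rightarrow> real) \<Rightarrow> real" where
  "V_norm U b Q v = sqrt ((L2_norm U v)\<^sup>2 + (\<Sum>K\<in>Q. (L2_norm K (adv K b v))\<^sup>2))"

section \<open>The test function\<close>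

definition average :: "'a::euclidean_space set \<Rightarrow> ('a \<Rightarrow> 'b::{banach, second_countable_topology}) \<Rightarrow> 'b"
  where "average K f = (1 / measure lebesgue K) *\<^sub>R (LINT x|lebesgue_on K. f x)"

definition is_face_normal :: "'a::euclidean_space set \<Rightarrow> 'a set \<Rightarrow> 'a \<Rightarrow> bool" where
  "is_face_normal K F \<nu> \<longleftrightarrow> norm \<nu> = 1 \<and>
     (\<exists>a. (\<forall>x\<in>closure K. x \<bullet> \<nu> \<le> a) \<and> (\<forall>x\<in>F. x \<bullet> \<nu> = a))"

definition face_normal :: "'a::euclidean_space set \<Rightarrow> 'a set \<Rightarrow> 'a" where
  "face_normal K F = (THE \<nu>. is_face_normal K F \<nu>)"

definition inflow_faces :: "'a::euclidean_space set \<Rightarrow> 'a \<Rightarrow> 'a set set" where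
  "inflow_faces K \<beta> = {F. F facet_of closure K \<and> \<beta> \<bullet> face_normal K F < 0}"

definition steepest_inflow_face :: "'a::euclidean_space set \<Rightarrow> 'a \<Rightarrow> 'a set \<Rightarrow> bool" where
  "steepest_inflow_face K \<beta> F \<longleftrightarrow> F \<in> inflow_faces K \<beta> \<and>
     (\<forall>G\<in>inflow_faces K \<beta>. \<bar>\<beta> \<bullet> face_normal K G\<bar> \<le> \<bar>\<beta> \<bullet> face_normal K F\<bar>)"

text \<open>
  With e the first vector of the Cartesian coordinate system and \<open>z = (x, y)\<close> in these
  coordinates, this is the point \<open>(x\<^sub>-(y), y)\<close>: the point of the hyperplane through F that
  differs from z only in the first coordinate.
\<close>
definition upwind_point :: "'a::euclidean_space set \<Rightarrow> 'a \<Rightarrow> 'a \<Rightarrow> 'a" where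
  "upwind_point F e z = (THE p. p \<in> affine hull F \<and> (\<exists>s. p = z + s *\<^sub>R e))"

definition breve_t_elem ::
  "'a::euclidean_space set \<Rightarrow> ('a \<Rightarrow> 'a) \<Rightarrow> ('a \<Rightarrow> real) \<Rightarrow> nat \<Rightarrow> 'a set \<Rightarrow> 'a set \<Rightarrow>
    ('a \<Rightarrow> real) \<Rightarrow> ('a \<Rightarrow> real) \<Rightarrow> 'a \<Rightarrow> real" where
  "breve_t_elem U b c m K F u w z =
    (let \<beta> = average K b;
         c\<^sub>K = average K (\<lambda>x. c x - weak_div U b x);
         d\<^sub>K = average K (weak_div U b);
         e = (1 / norm \<beta>) *\<^sub>R \<beta>;
         p = upwind_point F e z;
         u\<^sub>K = poly_ext m K u;
         w\<^sub>K = poly_ext m K w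
     in ((w\<^sub>K p - u\<^sub>K p) * ((z - p) \<bullet> e)
         + norm \<beta> * (frechet_derivative w\<^sub>K (at p) \<beta> + c\<^sub>K * u\<^sub>K p + d\<^sub>K * w\<^sub>K p)) / norm \<beta>)"

text \<open>Here F selects a face of each element; at most one summand is nonzero at any point.\<close>
definition breve_t ::
  "'a::euclidean_space set \<Rightarrow> ('a \<Rightarrow> 'a) \<Rightarrow> ('a \<Rightarrow> real) \<Rightarrow> nat \<Rightarrow> 'a set set \<Rightarrow> ('a set \<Rightarrow> 'a set) \<Rightarrow>
    ('a \<Rightarrow> real) \<Rightarrow> ('a \<Rightarrow> real) \<Rightarrow> 'a \<Rightarrow> real" where
  "breve_t U b c m Q F u w z =
     (\<Sum>K\<in>Q. if z \<in> K then breve_t_elem U b c m K (F K) u w z else 0)"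

end

theory Submission
  imports Defs
begin

text \<open>
  Put \<open>X = (w - u, g)\<close> with \<open>g = b \<cdot> \<nabla>w + (c - div b) u + w div b\<close> and
  \<open>Y = (b \<cdot> \<nabla>\<^sub>h t, t)\<close>.  Then \<open>b\<^sub>h(u, w; t)\<close> is the \<open>L\<^sub>2\<close> inner product of X and Y, and the
  norm of t in \<open>\<bbbV>\<close> is the norm of Y, so by polarization it suffices that \<open>X - Y\<close> is small relative
  to X.  The function \<open>t\<close> solves the frozen-coefficient version of \<open>Y = X\<close> up to evaluating
  polynomials at an upwind point at distance \<open>O(diam K)\<close>; since they are polynomials on the much
  larger coarse element, the inverse estimate there turns this and the variation of the
  coefficients into an error \<open>O(\<sigma>)\<close> times the norm of \<open>(u, w)\<close>.  Finally
  \<open>b \<cdot> \<nabla>w + c w = g + (c - div b) (w - u)\<close>, so bounded invertibility of the transport operator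
  bounds \<open>(u, w)\<close> by X.  As \<open>\<sigma>\<^sub>0\<close> may depend on all the data, only the constant in this last bound
  enters \<open>\<gamma>\<close>.
\<close>

section \<open>Polynomials\<close>

text \<open>The obstacle is that the norm of (u, w) contains only the derivative of w along b, not
  its gradient. The test function involves the derivative V of w along the averaged velocity
  \<beta>; bounding V by w through the inverse estimate would cost a factor 1 / r, r being the size
  of the coarse element. Instead V is compared with the derivative along b on a coarse ball: the
  difference applies the gradient of w to b - \<beta>, and |b - \<beta>| = O(r) compensates that
  factor. As V is a polynomial too, the inverse estimate is then applied to u, w and V separately.
  In the derivative of t along b, the direction \<beta> is harmless because t is affine along it.
  The rest pairs the gradient of t, of size 1 / r, with |b - \<beta>| = O(diam K), and diam K / r =
  O(\<sigma>). Choosing the steepest inflow face keeps the upwind projection uniformly transversal.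
  All weak derivatives are arbitrary representatives, so they must first be identified almost
  everywhere with classical ones on each element, and bounded weak partials must be turned into
  Lipschitz bounds off a null set.\<close>

inductive poly_le :: "nat \<Rightarrow> ('a::euclidean_space \<Rightarrow> real) \<Rightarrow> bool" where
  const: "poly_le m (\<lambda>x. c)"
| add: "poly_le m p \<Longrightarrow> poly_le m q \<Longrightarrow> poly_le m (\<lambda>x. p x + q x)"
| mult: "poly_le m p \<Longrightarrow> i \<in> Basis \<Longrightarrow> poly_le (Suc m) (\<lambda>x. (x \<bullet> i) * p x)"

lemma poly_le_mono: "poly_le m p \<Longrightarrow> m \<le> k \<Longrightarrow> poly_le k p"
proof (induction arbitrary: k rule: poly_le.induct)
  case (mult m p i)
  then obtain k' where "k = Suc k'" "m \<le> k'" by (metis Suc_le_D Suc_le_mono)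
  then show ?case using mult by (auto intro: poly_le.mult)
qed (auto intro: poly_le.const poly_le.add)

lemma poly_le_cmult: "poly_le m p \<Longrightarrow> poly_le m (\<lambda>x. c * p x)"
proof (induction rule: poly_le.induct)
  case (mult m p i)
  have "(\<lambda>x. c * (x \<bullet> i * p x)) = (\<lambda>x. x \<bullet> i * (c * p x))" by (auto simp: algebra_simps)
  then show ?case using mult by (metis poly_le.mult)
qed (auto intro: poly_le.const poly_le.add simp: distrib_left)

lemma poly_le_diff: "poly_le m p \<Longrightarrow> poly_le m q \<Longrightarrow> poly_le m (\<lambda>x. p x - q x)"
  using poly_le.add[of m p "\<lambda>x. (-1) * q x"] poly_le_cmult[of m q "-1"] by simp

lemma poly_le_sum: "finite A \<Longrightarrow> (\<And>i. i \<in> A \<Longrightarrow> poly_le m (f i)) \<Longrightarrow> poly_le m (\<lambda>x. \<Sum>i\<in>A. f i x)"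
  by (induction A rule: finite_induct) (auto intro: poly_le.const poly_le.add)

text \<open>The test function carries the signed distance to the hyperplane of a face as a factor,
  which is an affine function rather than a coordinate.\<close>

lemma poly_le_affine_mult:
  fixes v :: "'a::euclidean_space"
  assumes "poly_le m p"
  shows "poly_le (Suc m) (\<lambda>x. (x \<bullet> v + c) * p x)"
proof -
  have "poly_le (Suc m) (\<lambda>x. \<Sum>i\<in>Basis. (v \<bullet> i) * ((x \<bullet> i) * p x))"
    by (intro poly_le_sum poly_le_cmult poly_le.mult assms) auto
  moreover have "poly_le (Suc m) (\<lambda>x. c * p x)"
    by (intro poly_le_cmult poly_le_mono[OF assms]) auto
  ultimately have "poly_le (Suc m) (\<lambda>x. (\<Sum>i\<in>Basis. (v \<bullet> i) * ((x \<bullet> i) * p x)) + c * p x)"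
    by (rule poly_le.add)
  moreover have "(\<Sum>i\<in>Basis. (v \<bullet> i) * ((x \<bullet> i) * p x)) = (x \<bullet> v) * p x" for x
    by (simp add: euclidean_inner[of x v] sum_distrib_right sum_distrib_left mult_ac)
  ultimately show ?thesis by (simp add: algebra_simps)
qed

lemma poly_le_compose_affine:
  fixes A :: "'b::euclidean_space \<Rightarrow> 'a::euclidean_space"
  assumes "poly_le m p" "\<And>x i. i \<in> Basis \<Longrightarrow> A x \<bullet> i = x \<bullet> v i + c i"
  shows "poly_le m (\<lambda>x. p (A x))"
  using assms(1)
proof (induction rule: poly_le.induct)
  case (mult m p i)
  have "(\<lambda>x. A x \<bullet> i * p (A x)) = (\<lambda>x. (x \<bullet> v i + c i) * p (A x))"
    using assms(2)[OF mult(2)] by simp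
  then show ?case using poly_le_affine_mult[OF mult.IH, of "v i" "c i"] by simp
qed (auto intro: poly_le.const poly_le.add)

lemma poly_le_prod: "poly_le m p \<Longrightarrow> poly_le k q \<Longrightarrow> poly_le (m + k) (\<lambda>x. p x * q x)"
proof (induction rule: poly_le.induct)
  case (const m c)
  then show ?case by (auto intro: poly_le_cmult poly_le_mono)
next
  case (add m p p')
  then show ?case by (auto simp: distrib_right intro: poly_le.add)
next
  case (mult m p i)
  then show ?case using poly_le.mult[of "m + k" "\<lambda>x. p x * q x" i] by (simp add: mult.assoc)
qed

text \<open>The degree bound is kept at m rather than lowered to m - 1, so that a directional
  derivative of w lies in the same class as u and w and one inverse estimate serves all
  three.\<close>

lemma poly_le_has_derivative:
  assumes "poly_le m p"
  shows "\<exists>p'. (\<forall>x. (p has_derivative p' x) (at x)) \<and> (\<forall>v. poly_le m (\<lambda>x. p' x v))"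
  using assms
proof (induction rule: poly_le.induct)
  case (const m c)
  show ?case by (rule exI[of _ "\<lambda>x v. 0"]) (auto intro: poly_le.const)
next
  case (add m p q)
  then obtain p' q' where "\<forall>x. (p has_derivative p' x) (at x)" "\<forall>v. poly_le m (\<lambda>x. p' x v)"
    "\<forall>x. (q has_derivative q' x) (at x)" "\<forall>v. poly_le m (\<lambda>x. q' x v)" by blast
  then show ?case
    by (intro exI[of _ "\<lambda>x v. p' x v + q' x v"]) (auto intro: poly_le.add has_derivative_add)
next
  case (mult m p i)
  then obtain p' where p': "\<forall>x. (p has_derivative p' x) (at x)" "\<forall>v. poly_le m (\<lambda>x. p' x v)" by blast
  show ?case
  proof (intro exI[of _ "\<lambda>x v. (x \<bullet> i) * p' x v + (v \<bullet> i) * p x"] conjI allI)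
    fix x
    show "((\<lambda>x. x \<bullet> i * p x) has_derivative (\<lambda>v. x \<bullet> i * p' x v + v \<bullet> i * p x)) (at x)"
      using p' by (auto intro!: derivative_eq_intros)
  next
    fix v
    show "poly_le (Suc m) (\<lambda>x. x \<bullet> i * p' x v + v \<bullet> i * p x)"
      using mult p' by (intro poly_le.add poly_le.mult poly_le_cmult poly_le_mono[OF mult(1)]) auto
  qed
qed

lemma poly_le_differentiable: "poly_le m p \<Longrightarrow> p differentiable (at x)"
  using poly_le_has_derivative unfolding differentiable_def by blast

lemma poly_le_frechet_derivative:
  assumes "poly_le m p"
  shows "poly_le m (\<lambda>x. frechet_derivative p (at x) v)"
proof -
  obtain p' where p': "\<forall>x. (p has_derivative p' x) (at x)" "\<forall>v. poly_le m (\<lambda>x. p' x v)"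
    using poly_le_has_derivative[OF assms] by blast
  then have "frechet_derivative p (at x) = p' x" for x
    by (metis frechet_derivative_at)
  then show ?thesis using p' by simp
qed

lemma poly_le_continuous_on: "poly_le m p \<Longrightarrow> continuous_on S p"
  by (induction rule: poly_le.induct) (auto intro!: continuous_intros)

lemma poly_le_C_k: "poly_le m p \<Longrightarrow> C_k k p"
proof (induction k arbitrary: p)
  case 0 then show ?case by (simp add: poly_le_continuous_on)
next
  case (Suc k)
  have "C_k k (\<lambda>x. frechet_derivative p (at x) v)" for v
    by (rule Suc.IH[OF poly_le_frechet_derivative[OF Suc.prems]])
  then show ?case
    using poly_le_differentiable[OF Suc.prems] by (auto simp: differentiable_on_def)
qed

lemma poly_le_bounded_lipschitz:
  assumes "poly_le m p"
  shows "\<exists>B\<ge>0. \<forall>x\<in>cball 0 R. \<forall>y\<in>cball 0 R. \<bar>p x\<bar> \<le> B \<and> \<bar>p x - p y\<bar> \<le> B * norm (x - y)"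
  using assms
proof (induction rule: poly_le.induct)
  case (const m c)
  show ?case by (rule exI[of _ "\<bar>c\<bar>"]) auto
next
  case (add m p q)
  then obtain B C where B: "B \<ge> 0" "\<forall>x\<in>cball 0 R. \<forall>y\<in>cball 0 R. \<bar>p x\<bar> \<le> B \<and> \<bar>p x - p y\<bar> \<le> B * norm (x - y)"
    and C: "C \<ge> 0" "\<forall>x\<in>cball 0 R. \<forall>y\<in>cball 0 R. \<bar>q x\<bar> \<le> C \<and> \<bar>q x - q y\<bar> \<le> C * norm (x - y)"
    by blast
  show ?case
  proof (intro exI[of _ "B + C"] conjI ballI)
    fix x y :: 'a assume xy: "x \<in> cball 0 R" "y \<in> cball 0 R"
    have "\<bar>p x\<bar> \<le> B" "\<bar>q x\<bar> \<le> C" "\<bar>p x - p y\<bar> \<le> B * norm (x - y)" "\<bar>q x - q y\<bar> \<le> C * norm (x - y)"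
      using B C xy by blast+
    then show "\<bar>p x + q x\<bar> \<le> B + C" "\<bar>p x + q x - (p y + q y)\<bar> \<le> (B + C) * norm (x - y)"
      by (auto simp: distrib_right)
  qed (use B C in auto)
next
  case (mult m p i)
  then obtain B where B: "B \<ge> 0" "\<forall>x\<in>cball 0 R. \<forall>y\<in>cball 0 R. \<bar>p x\<bar> \<le> B \<and> \<bar>p x - p y\<bar> \<le> B * norm (x - y)"
    by blast
  \<comment> \<open>In the witness, \<bar>R\<bar> B bounds the coordinate times the difference of p,
    and the extra B bounds the difference of the coordinates times p. The absolute value covers a
    negative R, where the ball is empty.\<close>
  show ?case
  proof (intro exI[of _ "\<bar>R\<bar> * B + B"] conjI ballI)
    fix x y :: 'a assume xy: "x \<in> cball 0 R" "y \<in> cball 0 R"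
    have p: "\<bar>p x\<bar> \<le> B" "\<bar>p y\<bar> \<le> B" "\<bar>p x - p y\<bar> \<le> B * norm (x - y)"
      using B xy by blast+
    have xi: "\<bar>x \<bullet> i\<bar> \<le> \<bar>R\<bar>"
      using Basis_le_norm[OF mult(2), of x] xy by auto
    have xyi: "\<bar>(x - y) \<bullet> i\<bar> \<le> norm (x - y)"
      using Basis_le_norm[OF mult(2), of "x - y"] by auto
    have "\<bar>x \<bullet> i * p x\<bar> \<le> \<bar>R\<bar> * B"
      using p xi by (auto simp: abs_mult intro!: mult_mono)
    then show "\<bar>x \<bullet> i * p x\<bar> \<le> \<bar>R\<bar> * B + B" using B by linarith
    have "x \<bullet> i * p x - y \<bullet> i * p y = (x \<bullet> i) * (p x - p y) + ((x - y) \<bullet> i) * p y"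
      by (simp add: algebra_simps)
    also have "\<bar>\<dots>\<bar> \<le> \<bar>x \<bullet> i\<bar> * \<bar>p x - p y\<bar> + \<bar>(x - y) \<bullet> i\<bar> * \<bar>p y\<bar>"
      by (metis abs_mult abs_triangle_ineq)
    also have "\<dots> \<le> \<bar>R\<bar> * (B * norm (x - y)) + norm (x - y) * B"
      using p xi xyi by (intro add_mono mult_mono) auto
    finally show "\<bar>x \<bullet> i * p x - y \<bullet> i * p y\<bar> \<le> (\<bar>R\<bar> * B + B) * norm (x - y)"
      by (simp add: algebra_simps)
  qed (use B in auto)
qed

section \<open>Restriction to lines and the identity theorem\<close>

lemma poly_le_line:
  fixes x v :: "'a::euclidean_space"
  assumes "poly_le m p"
  shows "\<exists>q::real poly. \<forall>t. p (x + t *\<^sub>R v) = poly q t"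
  using assms
proof (induction rule: poly_le.induct)
  case (const m c)
  show ?case by (rule exI[of _ "[:c:]"]) auto
next
  case (add m p q)
  then show ?case by (metis poly_add)
next
  case (mult m p i)
  then obtain q where "\<forall>t. p (x + t *\<^sub>R v) = poly q t" by blast
  then show ?case
    by (intro exI[of _ "[:x \<bullet> i, v \<bullet> i:] * q"]) (auto simp: inner_add_left algebra_simps)
qed

text \<open>On the line from a to y the polynomial becomes univariate, and it has infinitely many
  zeros near a.\<close>

lemma poly_le_zero_on_open:
  fixes p :: "'a::euclidean_space \<Rightarrow> real"
  assumes p: "poly_le m p" and K: "open K" "a \<in> K" and z: "\<And>x. x \<in> K \<Longrightarrow> p x = 0"
  shows "p y = 0"
proof -
  obtain q :: "real poly" where q: "\<And>t. p (a + t *\<^sub>R (y - a)) = poly q t"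
    using poly_le_line[OF p] by blast
  obtain e where e: "e > 0" "ball a e \<subseteq> K" using K open_contains_ball by blast
  \<comment> \<open>The summand 1 keeps the denominator positive when y = a.\<close>
  define \<delta> where "\<delta> = e / (norm (y - a) + 1)"
  have \<delta>: "\<delta> > 0" using e by (auto simp: \<delta>_def intro!: divide_pos_pos add_nonneg_pos)
  have "poly q t = 0" if "t \<in> {0<..<\<delta>}" for t
  proof -
    have "norm (t *\<^sub>R (y - a)) = t * norm (y - a)" using that by simp
    also have "\<dots> \<le> \<delta> * norm (y - a)" using that by (intro mult_right_mono) auto
    also have "\<dots> < \<delta> * (norm (y - a) + 1)" using \<delta> by (simp add: algebra_simps)
    also have "\<dots> = e" unfolding \<delta>_def using norm_ge_zero[of "y - a"] by (simp add: field_simps add_nonneg_eq_0_iff)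
    finally have "a + t *\<^sub>R (y - a) \<in> ball a e" by (simp add: dist_norm)
    then show ?thesis using e z q by (metis subsetD)
  qed
  then have "{0<..<\<delta>} \<subseteq> {t. poly q t = 0}" by blast
  then have "infinite {t. poly q t = 0}"
    using infinite_Ioo[OF \<delta>] finite_subset by blast
  then have "q = 0" using poly_roots_finite by blast
  then show ?thesis using q[of 1] by simp
qed

section \<open>Equivalence with sums of monomials\<close>

lemma poly_le_monomial:
  "\<alpha> \<in> multi_indices m \<Longrightarrow> poly_le m (\<lambda>x::'a::euclidean_space. \<Prod>i\<in>Basis. (x \<bullet> i) ^ \<alpha> i)"
proof (induction m arbitrary: \<alpha>)
  case 0
  then have "\<forall>i\<in>Basis. \<alpha> i = 0" by (auto simp: multi_indices_def)
  then show ?case by (auto intro: poly_le.const)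
next
  case (Suc m)
  show ?case
  proof (cases "\<forall>i\<in>Basis. \<alpha> i = 0")
    case True
    then show ?thesis by (auto intro: poly_le.const)
  next
    case False
    then obtain i where i: "i \<in> Basis" "\<alpha> i > 0" by auto
    define \<beta> where "\<beta> = \<alpha>(i := \<alpha> i - 1)"
    have s: "(\<Sum>j\<in>Basis. \<alpha> j) = \<alpha> i + (\<Sum>j\<in>Basis - {i}. \<alpha> j)"
      "(\<Sum>j\<in>Basis. \<beta> j) = \<beta> i + (\<Sum>j\<in>Basis - {i}. \<alpha> j)"
      using i by (auto simp: sum.remove \<beta>_def intro!: sum.cong)
    have "\<beta> \<in> multi_indices m"
      using Suc.prems i s by (auto simp: multi_indices_def \<beta>_def PiE_def extensional_def)
    then have "poly_le m (\<lambda>x. \<Prod>i\<in>Basis. (x \<bullet> i) ^ \<beta> i)" by (rule Suc.IH)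
    then have "poly_le (Suc m) (\<lambda>x. (x \<bullet> i) * (\<Prod>i\<in>Basis. (x \<bullet> i) ^ \<beta> i))"
      using i by (rule_tac poly_le.mult)
    moreover have "(x \<bullet> i) * (\<Prod>i\<in>Basis. (x \<bullet> i) ^ \<beta> i) = (\<Prod>i\<in>Basis. (x \<bullet> i) ^ \<alpha> i)" for x :: 'a
    proof -
      have "(\<Prod>j\<in>Basis. (x \<bullet> j) ^ \<beta> j) = (x \<bullet> i) ^ (\<alpha> i - 1) * (\<Prod>j\<in>Basis - {i}. (x \<bullet> j) ^ \<alpha> j)"
        using i by (subst prod.remove[of _ i]) (auto simp: \<beta>_def intro!: prod.cong)
      moreover have "(\<Prod>j\<in>Basis. (x \<bullet> j) ^ \<alpha> j) = (x \<bullet> i) ^ \<alpha> i * (\<Prod>j\<in>Basis - {i}. (x \<bullet> j) ^ \<alpha> j)"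
        using i by (subst prod.remove[of _ i]) auto
      moreover have "(x \<bullet> i) ^ \<alpha> i = (x \<bullet> i) * (x \<bullet> i) ^ (\<alpha> i - 1)"
        using i by (metis power_minus_mult mult.commute)
      ultimately show ?thesis by simp
    qed
    ultimately show ?thesis by simp
  qed
qed

lemma finite_multi_indices: "finite (multi_indices m :: ('a::euclidean_space \<Rightarrow> nat) set)"
proof (rule finite_subset)
  show "(multi_indices m :: ('a \<Rightarrow> nat) set) \<subseteq> Basis \<rightarrow>\<^sub>E {..m}"
  proof
    fix \<alpha> :: "'a \<Rightarrow> nat" assume a: "\<alpha> \<in> multi_indices m"
    have "\<alpha> i \<le> m" if "i \<in> Basis" for i
    proof -
      have "\<alpha> i \<le> (\<Sum>i\<in>Basis. \<alpha> i)" using that by (intro member_le_sum) auto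
      then show ?thesis using a by (auto simp: multi_indices_def)
    qed
    then show "\<alpha> \<in> Basis \<rightarrow>\<^sub>E {..m}" using a by (auto simp: multi_indices_def PiE_def)
  qed
qed (auto intro: finite_PiE)

lemma poly_le_in_polys: "poly_le m p \<Longrightarrow> p \<in> polys m"
proof (induction rule: poly_le.induct)
  case (const m c)
  \<comment> \<open>Multi-indices are extensional functions, so the zero exponent is the zero
    function restricted to \<open>Basis\<close>.\<close>
  define z where "z = (\<lambda>i\<in>(Basis :: 'a set). 0 :: nat)"
  have z: "z \<in> multi_indices m" by (auto simp: z_def multi_indices_def)
  have "(\<Sum>\<alpha>\<in>multi_indices m. (if \<alpha> = z then c else 0) * (\<Prod>i\<in>Basis. (x \<bullet> i) ^ \<alpha> i))
      = (\<Sum>\<alpha>\<in>{z}. (if \<alpha> = z then c else 0) * (\<Prod>i\<in>Basis. (x \<bullet> i) ^ \<alpha> i))" for x :: 'a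
    using z by (intro sum.mono_neutral_right finite_multi_indices) auto
  then have "\<forall>x::'a. c = (\<Sum>\<alpha>\<in>multi_indices m. (if \<alpha> = z then c else 0) * (\<Prod>i\<in>Basis. (x \<bullet> i) ^ \<alpha> i))"
    by (simp add: z_def)
  then show ?case unfolding polys_def by (intro CollectI exI)
next
  case (add m p q)
  then obtain a b where "\<forall>x. p x = (\<Sum>\<alpha>\<in>multi_indices m. a \<alpha> * (\<Prod>i\<in>Basis. (x \<bullet> i) ^ \<alpha> i))"
    "\<forall>x. q x = (\<Sum>\<alpha>\<in>multi_indices m. b \<alpha> * (\<Prod>i\<in>Basis. (x \<bullet> i) ^ \<alpha> i))"
    unfolding polys_def by blast
  then show ?case unfolding polys_def
    by (intro CollectI exI[of _ "\<lambda>\<alpha>. a \<alpha> + b \<alpha>"]) (simp add: distrib_right sum.distrib)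
next
  case (mult m p i)
  then obtain a where a: "\<forall>x. p x = (\<Sum>\<alpha>\<in>multi_indices m. a \<alpha> * (\<Prod>i\<in>Basis. (x \<bullet> i) ^ \<alpha> i))"
    unfolding polys_def by blast
  \<comment> \<open>Multiplying by the coordinate i shifts exponents by \<open>\<tau>\<close>, which
    has the left inverse \<open>\<tau>'\<close>. The coefficients are carried along this injection
    and set to 0 off its image.\<close>
  define \<tau> where "\<tau> = (\<lambda>\<alpha>::'a \<Rightarrow> nat. \<alpha>(i := Suc (\<alpha> i)))"
  define \<tau>' where "\<tau>' = (\<lambda>\<alpha>::'a \<Rightarrow> nat. \<alpha>(i := \<alpha> i - 1))"
  have inv: "\<tau>' (\<tau> \<alpha>) = \<alpha>" for \<alpha> by (auto simp: \<tau>_def \<tau>'_def)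
  have inj: "inj_on \<tau> (multi_indices m)" by (rule inj_on_inverseI[of _ \<tau>']) (rule inv)
  have sub: "\<tau> ` multi_indices m \<subseteq> multi_indices (Suc m)"
  proof (rule image_subsetI)
    fix \<alpha> :: "'a \<Rightarrow> nat" assume \<alpha>: "\<alpha> \<in> multi_indices m"
    have "(\<Sum>j\<in>Basis. \<tau> \<alpha> j) = Suc (\<Sum>j\<in>Basis. \<alpha> j)"
      using mult(2) by (auto simp: \<tau>_def sum.remove[of _ i] intro!: sum.cong)
    then show "\<tau> \<alpha> \<in> multi_indices (Suc m)"
      using \<alpha> mult(2) by (auto simp: multi_indices_def \<tau>_def PiE_def extensional_def)
  qed
  define b where "b = (\<lambda>\<alpha>. if \<alpha> \<in> \<tau> ` multi_indices m then a (\<tau>' \<alpha>) else 0)"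
  have "x \<bullet> i * p x = (\<Sum>\<alpha>\<in>multi_indices (Suc m). b \<alpha> * (\<Prod>i\<in>Basis. (x \<bullet> i) ^ \<alpha> i))" for x
  proof -
    have t: "(\<Prod>j\<in>Basis. (x \<bullet> j) ^ \<tau> \<alpha> j) = (x \<bullet> i) * (\<Prod>j\<in>Basis. (x \<bullet> j) ^ \<alpha> j)" for \<alpha>
    proof -
      have "(\<Prod>j\<in>Basis. (x \<bullet> j) ^ \<tau> \<alpha> j) = (x \<bullet> i) ^ Suc (\<alpha> i) * (\<Prod>j\<in>Basis - {i}. (x \<bullet> j) ^ \<alpha> j)"
        using mult(2) by (subst prod.remove[of _ i]) (auto simp: \<tau>_def intro!: prod.cong)
      moreover have "(\<Prod>j\<in>Basis. (x \<bullet> j) ^ \<alpha> j) = (x \<bullet> i) ^ \<alpha> i * (\<Prod>j\<in>Basis - {i}. (x \<bullet> j) ^ \<alpha> j)"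
        using mult(2) by (subst prod.remove[of _ i]) auto
      ultimately show ?thesis by simp
    qed
    have "(\<Sum>\<alpha>\<in>multi_indices (Suc m). b \<alpha> * (\<Prod>i\<in>Basis. (x \<bullet> i) ^ \<alpha> i))
      = (\<Sum>\<alpha>\<in>\<tau> ` multi_indices m. b \<alpha> * (\<Prod>i\<in>Basis. (x \<bullet> i) ^ \<alpha> i))"
      using sub by (intro sum.mono_neutral_right finite_multi_indices) (auto simp: b_def)
    also have "\<dots> = (\<Sum>\<alpha>\<in>multi_indices m. b (\<tau> \<alpha>) * (\<Prod>i\<in>Basis. (x \<bullet> i) ^ \<tau> \<alpha> i))"
      using inj by (simp add: sum.reindex)
    also have "\<dots> = (\<Sum>\<alpha>\<in>multi_indices m. a \<alpha> * ((x \<bullet> i) * (\<Prod>i\<in>Basis. (x \<bullet> i) ^ \<alpha> i)))"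
      by (intro sum.cong refl) (auto simp: b_def inv t)
    finally show ?thesis using a by (simp add: sum_distrib_left algebra_simps)
  qed
  then show ?case unfolding polys_def by blast
qed

text \<open>Closure under products, derivatives and affine substitution is a rule induction for
  \<open>poly_le\<close> but laborious for coefficient sums. This equivalence lets everything else
  work with \<open>poly_le\<close>.\<close>

lemma polys_iff_poly_le: "p \<in> polys m \<longleftrightarrow> poly_le m p"
proof
  assume "p \<in> polys m"
  then obtain a where "p = (\<lambda>x. \<Sum>\<alpha>\<in>multi_indices m. a \<alpha> * (\<Prod>i\<in>Basis. (x \<bullet> i) ^ \<alpha> i))"
    unfolding polys_def by blast
  then show "poly_le m p"
    by (auto intro!: poly_le_sum poly_le_cmult poly_le_monomial finite_multi_indices)
qed (rule poly_le_in_polys)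

section \<open>Inverse estimates for polynomials\<close>

lemma poly_le_measurable: "poly_le m p \<Longrightarrow> p \<in> borel_measurable borel"
  by (simp add: borel_measurable_continuous_onI poly_le_continuous_on)

lemma bounded_integrable_lebesgue_on:
  fixes f :: "'a::euclidean_space \<Rightarrow> real"
  assumes "S \<in> lmeasurable" "f \<in> borel_measurable (lebesgue_on S)" "AE x in lebesgue_on S. \<bar>f x\<bar> \<le> B"
  shows "integrable (lebesgue_on S) f"
proof -
  interpret finite_measure "lebesgue_on S" by (rule finite_measure_lebesgue_on[OF assms(1)])
  show ?thesis using assms by (intro integrable_const_bound[of _ B]) auto
qed

lemma borel_measurable_lebesgue_on:
  "f \<in> borel_measurable borel \<Longrightarrow> f \<in> borel_measurable (lebesgue_on S)"
  by (intro measurable_restrict_space1) (simp add: measurable_completion)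

lemma poly_le_integrable:
  fixes p :: "'a::euclidean_space \<Rightarrow> real"
  assumes "poly_le m p" "bounded S" "S \<in> sets lebesgue"
  shows "integrable (lebesgue_on S) p"
proof -
  obtain R where "\<forall>x\<in>S. norm x \<le> R" using assms(2) bounded_iff by blast
  then have R: "S \<subseteq> cball 0 R" by auto
  obtain B where "\<forall>x\<in>cball 0 R. \<forall>y\<in>cball 0 R. \<bar>p x\<bar> \<le> B \<and> \<bar>p x - p y\<bar> \<le> B * norm (x - y)"
    using poly_le_bounded_lipschitz[OF assms(1), of R] by blast
  then have "\<forall>x\<in>S. \<bar>p x\<bar> \<le> B" using R by (meson subsetD)
  then show ?thesis
    using assms by (intro bounded_integrable_lebesgue_on[of S _ B] borel_measurable_lebesgue_on poly_le_measurable)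
      (auto simp: bounded_set_imp_lmeasurable intro!: AE_I2)
qed

section \<open>Orthonormal polynomials on the unit ball\<close>

definition ball_ip :: "('a::euclidean_space \<Rightarrow> real) \<Rightarrow> ('a \<Rightarrow> real) \<Rightarrow> real" where
  "ball_ip p q = (LINT x|lebesgue_on (ball 0 1). p x * q x)"

lemma poly_le_integrable_ball:
  fixes p q :: "'a::euclidean_space \<Rightarrow> real"
  assumes "poly_le m p" "poly_le k q"
  shows "integrable (lebesgue_on (ball 0 1)) (\<lambda>x. p x * q x)"
  by (rule poly_le_integrable[OF poly_le_prod[OF assms]]) auto

lemma ball_ip_commute: "ball_ip p q = ball_ip q p"
  by (simp add: ball_ip_def mult.commute)

lemma ball_ip_add:
  "poly_le m p \<Longrightarrow> poly_le m q \<Longrightarrow> poly_le k r \<Longrightarrow> ball_ip (\<lambda>x. p x + q x) r = ball_ip p r + ball_ip q r"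
  unfolding ball_ip_def distrib_right
  by (rule Bochner_Integration.integral_add) (rule poly_le_integrable_ball; assumption)+

lemma ball_ip_cmult: "ball_ip (\<lambda>x. c * p x) r = c * ball_ip p r"
  by (simp add: ball_ip_def mult.assoc)

lemma ball_ip_sum:
  assumes "finite A" "\<And>i. i \<in> A \<Longrightarrow> poly_le m (f i)" "poly_le k r"
  shows "ball_ip (\<lambda>x. \<Sum>i\<in>A. f i x) r = (\<Sum>i\<in>A. ball_ip (f i) r)"
  unfolding ball_ip_def sum_distrib_right
  using assms by (intro Bochner_Integration.integral_sum) (auto intro: poly_le_integrable_ball)

lemma ball_ip_nonneg: "ball_ip p p \<ge> 0"
  by (simp add: ball_ip_def)

text \<open>The points of the ball where p is nonzero form a set that is open and negligible, hence
  empty. The identity theorem then covers the points outside the ball.\<close>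

lemma ball_ip_eq_0:
  fixes p :: "'a::euclidean_space \<Rightarrow> real"
  assumes p: "poly_le m p" and 0: "ball_ip p p = 0"
  shows "p x = 0"
proof (rule poly_le_zero_on_open[OF p open_ball, of 0])
  have ae: "AE x in lebesgue_on (ball 0 1). p x * p x = 0"
    using 0 integral_nonneg_eq_0_iff_AE[OF poly_le_integrable_ball[OF p p]] by (simp add: ball_ip_def)
  then have "AE x in lebesgue. x \<in> ball 0 1 \<longrightarrow> p x = 0"
    by (subst (asm) AE_restrict_space_iff) (auto elim: eventually_mono)
  then have "negligible {x \<in> ball 0 1. p x \<noteq> 0}"
    by (simp add: negligible_iff_null_sets completion.AE_iff_null_sets)
  moreover have "open {x \<in> ball 0 1. p x \<noteq> 0}"
    using open_Collect_neq[of p "\<lambda>x. 0"] poly_le_continuous_on[OF p, of UNIV]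
    by (auto simp: Collect_conj_eq simp del: mem_ball mem_ball_0 intro!: open_Int)
  ultimately show "p y = 0" if "y \<in> ball 0 1" for y
    using open_not_negligible that by blast
qed (auto simp: )

text \<open>Gram-Schmidt, one function at a time. The set may be linearly dependent: a new function
  whose residual \<open>h\<close> has norm zero already lies in the span, and the family stays as it
  is.\<close>

lemma poly_orthonormal_span:
  fixes F :: "('a::euclidean_space \<Rightarrow> real) set"
  assumes "finite F" "\<And>f. f \<in> F \<Longrightarrow> poly_le m f"
  shows "\<exists>(k::nat) g. (\<forall>i<k. poly_le m (g i)) \<and>
    (\<forall>i<k. \<forall>j<k. ball_ip (g i) (g j) = (if i = j then 1 else 0)) \<and>
    (\<forall>f\<in>F. \<forall>x. f x = (\<Sum>i<k. ball_ip f (g i) * g i x))"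
  using assms
proof (induction F rule: finite_induct)
  case empty
  show ?case by (rule exI[of _ 0]) auto
next
  case (insert f F)
  then obtain k :: nat and g where g: "\<And>i. i < k \<Longrightarrow> poly_le m (g i)"
    "\<And>i j. i < k \<Longrightarrow> j < k \<Longrightarrow> ball_ip (g i) (g j) = (if i = j then 1 else 0)"
    "\<And>h x. h \<in> F \<Longrightarrow> h x = (\<Sum>i<k. ball_ip h (g i) * g i x)" by (metis insertCI)
  have f: "poly_le m f" and F: "\<And>h. h \<in> F \<Longrightarrow> poly_le m h" using insert by auto
  define s where "s = (\<lambda>x. \<Sum>i<k. ball_ip f (g i) * g i x)"
  have s: "poly_le m s" unfolding s_def by (intro poly_le_sum poly_le_cmult g) auto
  \<comment> \<open>The difference is written as a sum with the factor -1 so that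
    \<open>ball_ip_add\<close> and \<open>ball_ip_cmult\<close> apply to it literally.\<close>
  define h where "h = (\<lambda>x. f x + (-1) * s x)"
  have s': "poly_le m (\<lambda>x. (-1) * s x)" by (rule poly_le_cmult[OF s])
  have h: "poly_le m h" unfolding h_def by (intro poly_le.add f s')
  have sg: "ball_ip s (g j) = ball_ip f (g j)" if "j < k" for j
  proof -
    have "ball_ip s (g j) = (\<Sum>i<k. ball_ip (\<lambda>x. ball_ip f (g i) * g i x) (g j))"
      unfolding s_def by (rule ball_ip_sum[of _ m _ m]) (auto intro: poly_le_cmult g that)
    also have "\<dots> = (\<Sum>i<k. ball_ip f (g i) * (if i = j then 1 else 0))"
      using that by (intro sum.cong) (auto simp: ball_ip_cmult g)
    also have "\<dots> = ball_ip f (g j)" using that by (simp add: if_distrib[where f="\<lambda>t. _ * t"] cong: if_cong)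
    finally show ?thesis .
  qed
  have hg: "ball_ip h (g j) = 0" if "j < k" for j
    unfolding h_def ball_ip_add[OF f s' g(1)[OF that]] ball_ip_cmult sg[OF that] by simp
  show ?case
  proof (cases "ball_ip h h = 0")
    case True
    have "f x = s x" for x using ball_ip_eq_0[OF h True, of x] by (simp add: h_def)
    then show ?thesis
      using g by (intro exI[of _ k] exI[of _ g]) (auto simp: s_def)
  next
    case False
    define c where "c = sqrt (ball_ip h h)"
    have c: "c > 0" "c * c = ball_ip h h" using False ball_ip_nonneg[of h] by (auto simp: c_def)
    define e where "e = (\<lambda>x. (1/c) * h x)"
    have e: "poly_le m e" unfolding e_def by (rule poly_le_cmult[OF h])
    have ee: "ball_ip e e = 1"
    proof -
      have "ball_ip e e = (1/c) * ball_ip h e" by (simp only: e_def ball_ip_cmult)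
      also have "\<dots> = (1/c) * ((1/c) * ball_ip h h)"
        by (subst ball_ip_commute) (simp only: e_def ball_ip_cmult)
      finally show ?thesis using c(1) by (simp flip: c(2))
    qed
    have eg: "ball_ip e (g j) = 0" if "j < k" for j
      using hg[OF that] by (simp only: e_def ball_ip_cmult)
    have eg': "ball_ip (g j) e = 0" if "j < k" for j
      using eg[OF that] by (simp add: ball_ip_commute)
    define g' where "g' = g(k := e)"
    have g'k: "(\<Sum>i<Suc k. ball_ip q (g' i) * g' i x) = (\<Sum>i<k. ball_ip q (g i) * g i x) + ball_ip q e * e x" for q x
      by (simp add: g'_def)
    have 1: "q x = (\<Sum>i<Suc k. ball_ip q (g' i) * g' i x)" if "q \<in> F" for q x
    proof -
      have "ball_ip q e = ball_ip (\<lambda>x. \<Sum>i<k. ball_ip q (g i) * g i x) e"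
        by (rule arg_cong[where f="\<lambda>p. ball_ip p e"]) (rule ext, rule g(3)[OF that])
      also have "\<dots> = (\<Sum>i<k. ball_ip (\<lambda>x. ball_ip q (g i) * g i x) e)"
        by (rule ball_ip_sum[of _ m _ m]) (auto intro: poly_le_cmult g e)
      also have "\<dots> = 0"
        by (intro sum.neutral) (auto simp: ball_ip_cmult ball_ip_commute[of _ e] eg)
      finally show ?thesis unfolding g'k using g(3)[OF that] by simp
    qed
    have 2: "f x = (\<Sum>i<Suc k. ball_ip f (g' i) * g' i x)" for x
    proof -
      have "ball_ip s e = (\<Sum>i<k. ball_ip (\<lambda>x. ball_ip f (g i) * g i x) e)"
        unfolding s_def by (rule ball_ip_sum[of _ m _ m]) (auto intro: poly_le_cmult g e)
      also have "\<dots> = 0"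
        by (intro sum.neutral) (auto simp: ball_ip_cmult ball_ip_commute[of _ e] eg)
      finally have "ball_ip h e = ball_ip f e"
        unfolding h_def ball_ip_add[OF f s' e] ball_ip_cmult by simp
      moreover have "ball_ip h e = c"
      proof -
        have "ball_ip h e = (1/c) * ball_ip h h"
          by (subst ball_ip_commute) (simp only: e_def ball_ip_cmult)
        then show ?thesis using c(1) by (simp flip: c(2))
      qed
      ultimately have "ball_ip f e * e x = h x" using c by (simp add: e_def)
      then show ?thesis unfolding g'k by (simp add: h_def s_def)
    qed
    show ?thesis
    proof (intro exI[of _ "Suc k"] exI[of _ g'] conjI allI impI ballI)
      fix i j assume "i < Suc k" "j < Suc k"
      then show "ball_ip (g' i) (g' j) = (if i = j then 1 else 0)"
        using g(2) ee eg eg' by (auto simp: g'_def less_Suc_eq)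
    qed (use g e 1 2 in \<open>auto simp: g'_def less_Suc_eq\<close>)
  qed
qed

text \<open>Gram-Schmidt for the monomials. The expansion passes to all polynomials by linearity,
  and pairing it with q gives Parseval's identity, hence the bound on each coefficient.\<close>

lemma poly_orthonormal_basis:
  "\<exists>(k::nat) g. (\<forall>i<k. poly_le m (g i)) \<and>
    (\<forall>q::'a::euclidean_space \<Rightarrow> real. poly_le m q \<longrightarrow> (\<forall>x. q x = (\<Sum>i<k. ball_ip q (g i) * g i x)) \<and>
      (\<forall>i<k. (ball_ip q (g i))\<^sup>2 \<le> ball_ip q q))"
proof -
  define F where "F = (\<lambda>\<alpha> x::'a. \<Prod>i\<in>Basis. (x \<bullet> i) ^ \<alpha> i) ` multi_indices m"
  have F: "finite F" "\<And>f. f \<in> F \<Longrightarrow> poly_le m f"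
    by (auto simp: F_def finite_multi_indices intro: poly_le_monomial)
  obtain k :: nat and g where g: "\<And>i. i < k \<Longrightarrow> poly_le m (g i)"
    "\<And>i j. i < k \<Longrightarrow> j < k \<Longrightarrow> ball_ip (g i) (g j) = (if i = j then 1 else 0)"
    "\<And>h x. h \<in> F \<Longrightarrow> h x = (\<Sum>i<k. ball_ip h (g i) * g i x)"
    using poly_orthonormal_span[OF F] by metis
  have *: "q x = (\<Sum>i<k. ball_ip q (g i) * g i x)" if q: "poly_le m q" for q x
  proof -
    obtain a where a: "q = (\<lambda>x. \<Sum>\<alpha>\<in>multi_indices m. a \<alpha> * (\<Prod>i\<in>Basis. (x \<bullet> i) ^ \<alpha> i))"
      using q unfolding polys_iff_poly_le[symmetric] polys_def by blast
    have "ball_ip q (g i) = (\<Sum>\<alpha>\<in>multi_indices m. a \<alpha> * ball_ip (\<lambda>x. \<Prod>i\<in>Basis. (x \<bullet> i) ^ \<alpha> i) (g i))"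
      if "i < k" for i
    proof -
      have "ball_ip q (g i) = (\<Sum>\<alpha>\<in>multi_indices m. ball_ip (\<lambda>x. a \<alpha> * (\<Prod>i\<in>Basis. (x \<bullet> i) ^ \<alpha> i)) (g i))"
        unfolding a
        by (rule ball_ip_sum[OF finite_multi_indices poly_le_cmult[OF poly_le_monomial] g(1)[OF that]])
      then show ?thesis by (simp only: ball_ip_cmult)
    qed
    then have "(\<Sum>i<k. ball_ip q (g i) * g i x)
      = (\<Sum>i<k. \<Sum>\<alpha>\<in>multi_indices m. a \<alpha> * (ball_ip (\<lambda>x. \<Prod>i\<in>Basis. (x \<bullet> i) ^ \<alpha> i) (g i) * g i x))"
      by (intro sum.cong) (auto simp: sum_distrib_right mult.assoc)
    also have "\<dots> = (\<Sum>\<alpha>\<in>multi_indices m. a \<alpha> * (\<Sum>i<k. ball_ip (\<lambda>x. \<Prod>i\<in>Basis. (x \<bullet> i) ^ \<alpha> i) (g i) * g i x))"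
      by (subst sum.swap) (simp add: sum_distrib_left)
    also have "\<dots> = (\<Sum>\<alpha>\<in>multi_indices m. a \<alpha> * (\<Prod>i\<in>Basis. (x \<bullet> i) ^ \<alpha> i))"
      by (intro sum.cong refl arg_cong2[where f="(*)"] g(3)[symmetric]) (auto simp: F_def)
    finally show ?thesis by (simp add: a)
  qed
  have "(ball_ip q (g j))\<^sup>2 \<le> ball_ip q q" if q: "poly_le m q" and j: "j < k" for q j
  proof -
    have "ball_ip q q = ball_ip (\<lambda>x. \<Sum>i<k. ball_ip q (g i) * g i x) q"
      by (rule arg_cong[where f="\<lambda>p. ball_ip p q"]) (rule ext, rule *[OF q])
    also have "\<dots> = (\<Sum>i<k. ball_ip (\<lambda>x. ball_ip q (g i) * g i x) q)"
      by (rule ball_ip_sum[of _ m _ m]) (auto intro: poly_le_cmult g q)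
    also have "\<dots> = (\<Sum>i<k. (ball_ip q (g i))\<^sup>2)"
      by (intro sum.cong) (auto simp: ball_ip_cmult ball_ip_commute[of _ q] power2_eq_square)
    finally have "ball_ip q q = (\<Sum>i<k. (ball_ip q (g i))\<^sup>2)" .
    then show ?thesis
      using j member_le_sum[of j "{..<k}" "\<lambda>i. (ball_ip q (g i))\<^sup>2"] by auto
  qed
  then show ?thesis using g * by blast
qed

text \<open>The coefficients of q in an orthonormal basis are at most its norm, and the finitely
  many basis functions are bounded and Lipschitz on the ball of radius R; no compactness argument is
  needed. The radius R is free because q will be evaluated at upwind points outside the ball over
  which its norm is taken.\<close>

lemma inverse_estimate_unit:
  "\<exists>C\<ge>0. \<forall>q::'a::euclidean_space \<Rightarrow> real. poly_le m q \<longrightarrow> (\<forall>x\<in>cball 0 R. \<forall>y\<in>cball 0 R.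
     \<bar>q x\<bar> \<le> C * sqrt (ball_ip q q) \<and> \<bar>q x - q y\<bar> \<le> C * norm (x - y) * sqrt (ball_ip q q))"
proof -
  obtain k :: nat and g where kg: "\<forall>i<k. poly_le m (g i)"
    "\<forall>q::'a \<Rightarrow> real. poly_le m q \<longrightarrow> (\<forall>x. q x = (\<Sum>i<k. ball_ip q (g i) * g i x)) \<and>
      (\<forall>i<k. (ball_ip q (g i))\<^sup>2 \<le> ball_ip q q)"
    using poly_orthonormal_basis[of m, where 'a='a] by (elim exE conjE) blast
  have g: "\<And>i. i < k \<Longrightarrow> poly_le m (g i)" using kg(1) by blast
  have q: "q x = (\<Sum>i<k. ball_ip q (g i) * g i x)" if "poly_le m q" for q :: "'a \<Rightarrow> real" and x
    using kg(2) that by blast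
  have i: "(ball_ip q (g i))\<^sup>2 \<le> ball_ip q q" if "poly_le m q" "i < k" for q :: "'a \<Rightarrow> real" and i
    using kg(2) that by blast
  have "\<exists>B. i < k \<longrightarrow> B\<ge>0 \<and> (\<forall>x\<in>cball 0 R. \<forall>y\<in>cball 0 R. \<bar>g i x\<bar> \<le> B \<and> \<bar>g i x - g i y\<bar> \<le> B * norm (x - y))" for i
    using poly_le_bounded_lipschitz[OF g] by blast
  then obtain B where B: "\<And>i. i < k \<Longrightarrow> B i \<ge> 0"
    "\<And>i x. i < k \<Longrightarrow> x\<in>cball 0 R \<Longrightarrow> \<bar>g i x\<bar> \<le> B i"
    "\<And>i x y. i < k \<Longrightarrow> x\<in>cball 0 R \<Longrightarrow> y\<in>cball 0 R \<Longrightarrow> \<bar>g i x - g i y\<bar> \<le> B i * norm (x - y)"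
    by metis
  show ?thesis
  proof (intro exI[of _ "\<Sum>i<k. B i"] conjI allI impI ballI)
    fix p :: "'a \<Rightarrow> real" and x y :: 'a assume p: "poly_le m p" and xy: "x \<in> cball 0 R" "y \<in> cball 0 R"
    have j: "\<bar>ball_ip p (g i)\<bar> \<le> sqrt (ball_ip p p)" if "i < k" for i
      using i[OF p that] by (metis real_sqrt_abs real_sqrt_le_mono)
    have "\<bar>p x\<bar> \<le> (\<Sum>i<k. \<bar>ball_ip p (g i) * g i x\<bar>)" by (subst q[OF p]) (rule sum_abs)
    also have "\<dots> \<le> (\<Sum>i<k. sqrt (ball_ip p p) * B i)"
      unfolding abs_mult using j B xy by (intro sum_mono mult_mono) (auto simp: ball_ip_nonneg)
    finally show "\<bar>p x\<bar> \<le> (\<Sum>i<k. B i) * sqrt (ball_ip p p)"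
      by (simp add: sum_distrib_left sum_distrib_right mult.commute)
    have "p x - p y = (\<Sum>i<k. ball_ip p (g i) * (g i x - g i y))"
      by (subst (1 2) q[OF p]) (simp add: sum_subtractf right_diff_distrib)
    also have "\<bar>\<dots>\<bar> \<le> (\<Sum>i<k. \<bar>ball_ip p (g i) * (g i x - g i y)\<bar>)" by (rule sum_abs)
    also have "\<dots> \<le> (\<Sum>i<k. sqrt (ball_ip p p) * (B i * norm (x - y)))"
      unfolding abs_mult using j B xy by (intro sum_mono mult_mono) (auto simp: ball_ip_nonneg)
    finally show "\<bar>p x - p y\<bar> \<le> (\<Sum>i<k. B i) * norm (x - y) * sqrt (ball_ip p p)"
      by (simp add: sum_distrib_left sum_distrib_right mult_ac)
  qed (use B in \<open>auto intro: sum_nonneg\<close>)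
qed

section \<open>Scaling to arbitrary balls\<close>

lemma lborel_integral_affine:
  fixes f :: "'a::euclidean_space \<Rightarrow> real"
  assumes "c > 0" "f \<in> borel_measurable borel"
  shows "(LINT x|lborel. f x) = c ^ DIM('a) * (LINT x|lborel. f (a + c *\<^sub>R x))"
proof -
  have "(LINT x|lborel. f x) = (LINT x|density (distr lborel borel (\<lambda>x. a + c *\<^sub>R x)) (\<lambda>_. \<bar>c\<bar>^DIM('a)). f x)"
    using lborel_affine[of c a] assms by simp
  also have "\<dots> = (LINT x|distr lborel borel (\<lambda>x. a + c *\<^sub>R x). c ^ DIM('a) * f x)"
    using assms by (subst integral_density) auto
  also have "\<dots> = (LINT x|lborel. c ^ DIM('a) * f (a + c *\<^sub>R x))"
    using assms by (subst integral_distr) auto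
  finally show ?thesis by simp
qed

lemma lebesgue_on_integral_borel:
  fixes f :: "'a::euclidean_space \<Rightarrow> real"
  assumes "S \<in> sets borel" "f \<in> borel_measurable borel"
  shows "(LINT x|lebesgue_on S. f x) = (LINT x|lborel. indicator S x * f x)"
  using assms by (subst integral_restrict_space) (auto simp: integral_completion)

lemma ball_ip_scale:
  fixes q :: "'a::euclidean_space \<Rightarrow> real"
  assumes q: "poly_le m q" and r: "r > 0"
  shows "(LINT x|lebesgue_on (ball a r). (q x)\<^sup>2) = r ^ DIM('a) * ball_ip (\<lambda>x. q (a + r *\<^sub>R x)) (\<lambda>x. q (a + r *\<^sub>R x))"
proof -
  have [measurable]: "q \<in> borel_measurable borel" by (rule poly_le_measurable[OF q])
  have "(LINT x|lebesgue_on (ball a r). (q x)\<^sup>2) = (LINT x|lborel. indicator (ball a r) x * (q x)\<^sup>2)"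
    by (rule lebesgue_on_integral_borel) auto
  also have "\<dots> = r ^ DIM('a) * (LINT x|lborel. indicator (ball a r) (a + r *\<^sub>R x) * (q (a + r *\<^sub>R x))\<^sup>2)"
    by (rule lborel_integral_affine[OF r]) (intro borel_measurable_times borel_measurable_indicator borel_measurable_power, auto)
  also have "(\<lambda>x. indicator (ball a r) (a + r *\<^sub>R x) * (q (a + r *\<^sub>R x))\<^sup>2)
      = (\<lambda>x. indicator (ball 0 1) x * (q (a + r *\<^sub>R x) * q (a + r *\<^sub>R x)))"
    using r by (auto simp: indicator_def dist_norm power2_eq_square fun_eq_iff)
  also have "(LINT x|lborel. indicator (ball 0 1) x * (q (a + r *\<^sub>R x) * q (a + r *\<^sub>R x)))
     = ball_ip (\<lambda>x. q (a + r *\<^sub>R x)) (\<lambda>x. q (a + r *\<^sub>R x))"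
    unfolding ball_ip_def by (rule lebesgue_on_integral_borel[symmetric]) auto
  finally show ?thesis .
qed

text \<open>Pulling q back by x \<mapsto> a + r x keeps its degree, so C depends neither on the
  centre nor on the radius; the Lipschitz bound picks up 1 / r.\<close>

lemma inverse_estimate:
  "\<exists>C\<ge>0. \<forall>(q::'a::euclidean_space \<Rightarrow> real) a r. poly_le m q \<longrightarrow> r > 0 \<longrightarrow> (\<forall>x\<in>cball a (R * r). \<forall>y\<in>cball a (R * r).
     \<bar>q x\<bar> \<le> C * sqrt ((LINT x|lebesgue_on (ball a r). (q x)\<^sup>2) / r ^ DIM('a)) \<and>
     \<bar>q x - q y\<bar> \<le> C * (norm (x - y) / r) * sqrt ((LINT x|lebesgue_on (ball a r). (q x)\<^sup>2) / r ^ DIM('a)))"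
proof -
  obtain C where C: "C \<ge> 0" "\<forall>q::'a \<Rightarrow> real. poly_le m q \<longrightarrow> (\<forall>x\<in>cball 0 R. \<forall>y\<in>cball 0 R.
     \<bar>q x\<bar> \<le> C * sqrt (ball_ip q q) \<and> \<bar>q x - q y\<bar> \<le> C * norm (x - y) * sqrt (ball_ip q q))"
    using inverse_estimate_unit[of m R, where 'a='a] by (elim exE conjE) blast
  show ?thesis
  proof (rule exI[of _ C], rule conjI[OF C(1)], intro allI impI ballI)
    fix q :: "'a \<Rightarrow> real" and a x y :: 'a and r :: real
    assume q: "poly_le m q" and r: "r > 0" and xy: "x \<in> cball a (R * r)" "y \<in> cball a (R * r)"
    let ?q = "\<lambda>x. q (a + r *\<^sub>R x)"
    have ip: "ball_ip ?q ?q = (LINT x|lebesgue_on (ball a r). (q x)\<^sup>2) / r ^ DIM('a)"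
      using ball_ip_scale[OF q r, of a] r by simp
    have q': "poly_le m ?q"
      by (rule poly_le_compose_affine[OF q, of _ "\<lambda>i. r *\<^sub>R i" "\<lambda>i. a \<bullet> i"]) (simp add: inner_add_left)
    let ?x = "(x - a) /\<^sub>R r" and ?y = "(y - a) /\<^sub>R r"
    have "?x \<in> cball 0 R" "?y \<in> cball 0 R"
      using xy r by (auto simp: dist_norm norm_minus_commute[of a] pos_divide_le_eq divide_inverse_commute[symmetric])
    from C(2)[rule_format, OF q' this] have *: "\<bar>?q ?x\<bar> \<le> C * sqrt (ball_ip ?q ?q) \<and>
      \<bar>?q ?x - ?q ?y\<bar> \<le> C * norm (?x - ?y) * sqrt (ball_ip ?q ?q)" .
    have x: "?q ?x = q x" "?q ?y = q y" using r by auto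
    have n: "norm (?x - ?y) = norm (x - y) / r"
      using r by (simp flip: scaleR_diff_right add: divide_inverse)
    show "\<bar>q x\<bar> \<le> C * sqrt ((LINT x|lebesgue_on (ball a r). (q x)\<^sup>2) / r ^ DIM('a)) \<and>
     \<bar>q x - q y\<bar> \<le> C * (norm (x - y) / r) * sqrt ((LINT x|lebesgue_on (ball a r). (q x)\<^sup>2) / r ^ DIM('a))"
      using * unfolding ip x n .
  qed
qed

section \<open>Smooth bump functions\<close>

text \<open>The polynomial factor in 1 / t makes this family closed under differentiation.
  Smoothness of exp (-1/t), glued to 0, then follows by induction on the order, for all factors at
  once.\<close>

definition expo :: "real poly \<Rightarrow> real \<Rightarrow> real" where
  "expo p t = (if t > 0 then poly p (1 / t) * exp (- (1 / t)) else 0)"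

lemma poly_exp_tendsto_0: "((\<lambda>x::real. poly p x * exp (- x)) \<longlongrightarrow> 0) at_top"
proof -
  have "((\<lambda>x::real. \<Sum>i\<le>degree p. coeff p i * (x ^ i / exp x)) \<longlongrightarrow> (\<Sum>i\<le>degree p. coeff p i * 0)) at_top"
    by (intro tendsto_sum tendsto_mult_left tendsto_power_div_exp_0)
  then show ?thesis
    by (simp add: poly_altdef sum_distrib_left exp_minus divide_inverse mult_ac)
qed

lemma expo_tendsto_0: "(expo p \<longlongrightarrow> 0) (at 0)"
proof -
  have "((\<lambda>t::real. poly p (inverse t) * exp (- inverse t)) \<longlongrightarrow> 0) (at_right 0)"
    by (rule filterlim_compose[OF poly_exp_tendsto_0 filterlim_inverse_at_top_right])
  then have "(expo p \<longlongrightarrow> 0) (at_right 0)"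
    by (rule Lim_transform_eventually)
      (auto simp: expo_def eventually_at_right_less inverse_eq_divide intro: eventually_mono[OF eventually_at_right_less])
  moreover have "(expo p \<longlongrightarrow> 0) (at_left 0)"
    by (rule tendsto_eventually) (auto simp: expo_def eventually_at_filter)
  ultimately show ?thesis by (simp add: filterlim_at_split)
qed

text \<open>The factor \<open>[:0, 0, 1:]\<close>, the square of the indeterminate, comes from the
  derivative -1/t^2 of 1/t; the minus sign turns p' - p into p - p'.\<close>

lemma expo_has_derivative:
  "(expo p has_real_derivative expo ([:0, 0, 1:] * (p - pderiv p)) t) (at t)"
proof -
  consider "t > 0" | "t < 0" | "t = 0" by linarith
  then show ?thesis
  proof cases
    case 1
    have "((\<lambda>t. poly p (1 / t) * exp (- (1 / t))) has_real_derivative expo ([:0, 0, 1:] * (p - pderiv p)) t) (at t)"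
      using 1 by (auto intro!: derivative_eq_intros simp: expo_def field_simps power2_eq_square)
    then show ?thesis
      by (rule has_field_derivative_transform_within_open[of _ _ _ "{0<..}"]) (use 1 in \<open>auto simp: expo_def\<close>)
  next
    case 2
    have "((\<lambda>t. 0) has_real_derivative expo ([:0, 0, 1:] * (p - pderiv p)) t) (at t)"
      using 2 by (auto simp: expo_def)
    then show ?thesis
      by (rule has_field_derivative_transform_within_open[of _ _ _ "{..<0}"]) (use 2 in \<open>auto simp: expo_def\<close>)
  next
    case 3
    \<comment> \<open>At 0 the difference quotient of \<open>expo p\<close> is again of this form:
      dividing by t multiplies the polynomial by its indeterminate.\<close>
    have "(expo (pCons 0 p) \<longlongrightarrow> 0) (at 0)" by (rule expo_tendsto_0)
    moreover have "expo (pCons 0 p) = (\<lambda>h. (expo p (0 + h) - expo p 0) / h)"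
      by (auto simp: expo_def)
    ultimately have "(\<lambda>h. (expo p (0 + h) - expo p 0) / h) \<midarrow>0\<rightarrow> 0" by metis
    then show ?thesis using 3 by (simp add: DERIV_def expo_def)
  qed
qed

lemma C_k_Suc_imp: "C_k (Suc k) f \<Longrightarrow> C_k k f"
proof (induction k arbitrary: f)
  case 0 then show ?case by (auto intro: differentiable_imp_continuous_on)
next
  case (Suc k) then show ?case by (metis C_k.simps(2))
qed

lemma C_k_const: "C_k k (\<lambda>x. c)"
  by (rule poly_le_C_k[OF poly_le.const])

lemma C_k_SucI:
  assumes "\<And>x. (f has_derivative f' x) (at x)" "\<And>v. C_k k (\<lambda>x. f' x v)"
  shows "C_k (Suc k) f"
proof -
  have "frechet_derivative f (at x) = f' x" for x using assms(1) by (metis frechet_derivative_at)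
  then show ?thesis using assms by (auto simp: differentiable_on_def differentiable_def)
qed

lemma C_k_SucD: "C_k (Suc k) f \<Longrightarrow> (f has_derivative frechet_derivative f (at x)) (at x)"
  by (simp add: differentiable_on_def frechet_derivative_works)

lemma C_k_derivative: "C_k (Suc k) f \<Longrightarrow> C_k k (\<lambda>x. frechet_derivative f (at x) v)"
  by simp

lemma C_k_add: "C_k k f \<Longrightarrow> C_k k g \<Longrightarrow> C_k k (\<lambda>x. f x + g x)"
proof (induction k arbitrary: f g)
  case (Suc k)
  show ?case
    by (rule C_k_SucI[OF has_derivative_add[OF C_k_SucD[OF Suc.prems(1)] C_k_SucD[OF Suc.prems(2)]]])
      (use Suc in auto)
qed (auto intro: continuous_intros)

lemma C_k_mult: "C_k k f \<Longrightarrow> C_k k g \<Longrightarrow> C_k k (\<lambda>x. f x * g x)"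
proof (induction k arbitrary: f g)
  case (Suc k)
  show ?case
    by (rule C_k_SucI[OF has_derivative_mult[OF C_k_SucD[OF Suc.prems(1)] C_k_SucD[OF Suc.prems(2)]]])
      (intro C_k_add Suc.IH, use Suc.prems in \<open>auto intro: C_k_Suc_imp simp del: C_k.simps(2) simp: C_k_derivative\<close>)
qed (auto intro: continuous_intros)

lemma C_k_prod: "finite A \<Longrightarrow> (\<And>i. i \<in> A \<Longrightarrow> C_k k (f i)) \<Longrightarrow> C_k k (\<lambda>x. \<Prod>i\<in>A. f i x)"
  by (induction A rule: finite_induct) (auto intro: C_k_mult C_k_const)

lemma C_k_expo: "C_k k (\<lambda>x. expo p (x \<bullet> v + c))"
proof (induction k arbitrary: p)
  case 0
  have "continuous_on UNIV (expo p)"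
    using expo_has_derivative by (meson DERIV_isCont continuous_at_imp_continuous_on)
  then show ?case
    by (auto intro!: continuous_on_compose2[of UNIV "expo p"] continuous_intros)
next
  case (Suc k)
  let ?q = "[:0, 0, 1:] * (p - pderiv p)"
  show ?case
  proof (rule C_k_SucI)
    fix x
    show "((\<lambda>x. expo p (x \<bullet> v + c)) has_derivative (\<lambda>w. expo ?q (x \<bullet> v + c) * (w \<bullet> v))) (at x)"
      by (rule has_derivative_eq_rhs[OF DERIV_compose_FDERIV[OF expo_has_derivative]])
        (auto intro!: derivative_eq_intros)
  next
    show "C_k k (\<lambda>x. expo ?q (x \<bullet> v + c) * (w \<bullet> v))" for w
      by (rule C_k_mult[OF Suc.IH C_k_const])
  qed
qed

section \<open>Bump functions on boxes\<close>

text \<open>For positive n the function is nonzero exactly on the open box, whatever n is. Growing n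
  raises its values there to 1, so testing against bumps recovers integrals over boxes.\<close>

definition bump :: "'a::euclidean_space \<Rightarrow> 'a \<Rightarrow> real \<Rightarrow> 'a \<Rightarrow> real" where
  "bump a b n x = (\<Prod>i\<in>Basis. expo 1 (n * ((x - a) \<bullet> i)) * expo 1 (n * ((b - x) \<bullet> i)))"

lemma C_k_bump: "C_k k (bump a b n)"
proof -
  have "C_k k (\<lambda>x. \<Prod>i\<in>Basis. expo 1 (x \<bullet> (n *\<^sub>R i) + (- n * (a \<bullet> i))) * expo 1 (x \<bullet> ((- n) *\<^sub>R i) + n * (b \<bullet> i)))"
    by (intro C_k_prod C_k_mult C_k_expo) auto
  then show ?thesis by (simp add: bump_def[abs_def] inner_diff_left algebra_simps)
qed

lemma expo_1_bounds: "0 \<le> expo 1 t" "expo 1 t \<le> 1"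
  by (auto simp: expo_def)

lemma bump_bounds: "0 \<le> bump a b n x" "bump a b n x \<le> 1"
  unfolding bump_def
  by (auto intro!: prod_nonneg prod_le_1 mult_nonneg_nonneg mult_le_one expo_1_bounds)

lemma bump_nonzero: "n > 0 \<Longrightarrow> bump a b n x \<noteq> 0 \<longleftrightarrow> x \<in> box a b"
  by (auto simp: bump_def expo_def mem_box inner_diff_left zero_less_mult_iff)

lemma bump_support: "n > 0 \<Longrightarrow> closure {x. bump a b n x \<noteq> 0} \<subseteq> cbox a b"
  by (simp add: bump_nonzero, rule closure_minimal) (auto simp: box_subset_cbox)

lemma bump_test_function:
  assumes "n > 0" "cbox a b \<subseteq> U"
  shows "bump a b n \<in> test_functions U"
proof -
  have "compact (closure {x. bump a b n x \<noteq> 0})"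
    using bump_support[OF assms(1), of a b] compact_cbox[of a b] closed_closure
    by (metis compact_Int_closed inf.absorb_iff2)
  then show ?thesis
    using bump_support[OF assms(1), of a b] assms(2) by (auto simp: test_functions_def C_k_bump)
qed

lemma bump_translate: "bump (a + z) (b + z) n x = bump a b n (x - z)"
  by (simp add: bump_def algebra_simps)

lemma expo_1_tendsto: "t > 0 \<Longrightarrow> (\<lambda>n. expo 1 (real (Suc n) * t)) \<longlonglongrightarrow> 1"
proof -
  assume t: "t > 0"
  have "(\<lambda>n. exp (- ((1 / t) * inverse (real (Suc n))))) \<longlonglongrightarrow> exp (- ((1 / t) * 0))"
    by (intro tendsto_intros LIMSEQ_inverse_real_of_nat)
  moreover have "expo 1 (real (Suc n) * t) = exp (- ((1 / t) * inverse (real (Suc n))))" for n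
    using t by (auto simp: expo_def divide_inverse zero_less_mult_iff)
  ultimately show ?thesis by simp
qed

lemma bump_tendsto: "(\<lambda>n. bump a b (real (Suc n)) x) \<longlonglongrightarrow> indicator (box a b) x"
proof (cases "x \<in> box a b")
  case True
  have "(\<lambda>n. bump a b (real (Suc n)) x) \<longlonglongrightarrow> (\<Prod>i\<in>(Basis::'a set). 1 * 1)"
    unfolding bump_def using True
    by (intro tendsto_prod tendsto_mult expo_1_tendsto) (auto simp: mem_box inner_diff_left)
  then show ?thesis using True by simp
next
  case False
  then have "bump a b (real (Suc n)) x = 0" for n using bump_nonzero[of "real (Suc n)" a b x] by auto
  then show ?thesis using False by simp
qed

section \<open>Weak derivatives\<close>

lemma test_function_measurable:
  assumes "\<phi> \<in> test_functions U"
  shows "\<phi> \<in> borel_measurable (lebesgue_on S)" "(\<lambda>x. frechet_derivative \<phi> (at x) v) \<in> borel_measurable (lebesgue_on S)"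
proof -
  have "C_k 0 \<phi>" "C_k (Suc 0) \<phi>" using assms unfolding test_functions_def by blast+
  then show "\<phi> \<in> borel_measurable (lebesgue_on S)" "(\<lambda>x. frechet_derivative \<phi> (at x) v) \<in> borel_measurable (lebesgue_on S)"
    by (auto intro!: borel_measurable_lebesgue_on borel_measurable_continuous_onI)
qed

lemma test_function_has_derivative:
  "\<phi> \<in> test_functions U \<Longrightarrow> (\<phi> has_derivative frechet_derivative \<phi> (at x)) (at x)"
  by (rule C_k_SucD[of 0]) (auto simp: test_functions_def simp del: C_k.simps)

lemma test_function_0: 
  assumes "\<phi> \<in> test_functions U" "x \<notin> closure {x. \<phi> x \<noteq> 0}"
  shows "\<phi> x = 0" "frechet_derivative \<phi> (at x) v = 0"
proof -
  have z: "\<phi> y = 0" if "y \<notin> closure {x. \<phi> x \<noteq> 0}" for y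
    using that closure_subset[of "{x. \<phi> x \<noteq> 0}"] by blast
  then show "\<phi> x = 0" using assms(2) by blast
  have "((\<lambda>x. 0) has_derivative frechet_derivative \<phi> (at x)) (at x)"
    using test_function_has_derivative[OF assms(1)]
  proof (rule has_derivative_transform_within_open)
    show "open (- closure {x. \<phi> x \<noteq> 0})" "x \<in> - closure {x. \<phi> x \<noteq> 0}"
      using assms(2) by (simp_all add: open_Compl)
  qed (rule z, erule ComplD)
  then have "frechet_derivative \<phi> (at x) = (\<lambda>v. 0)"
    by (rule has_derivative_unique[OF _ has_derivative_const])
  then show "frechet_derivative \<phi> (at x) v = 0" by simp
qed

lemma continuous_zero_outside_compact_bounded:
  fixes f :: "'a::topological_space \<Rightarrow> real"
  assumes "compact S" "continuous_on UNIV f" "\<And>x. x \<notin> S \<Longrightarrow> f x = 0"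
  shows "\<exists>B\<ge>0. \<forall>x. \<bar>f x\<bar> \<le> B"
proof -
  have "compact (f ` S)" using assms by (meson compact_continuous_image continuous_on_subset subset_UNIV)
  then obtain B where B: "\<forall>y\<in>f ` S. norm y \<le> B" using bounded_iff compact_imp_bounded by blast
  then have "\<bar>f x\<bar> \<le> \<bar>B\<bar>" for x using assms(3)[of x] by (cases "x \<in> S") force+
  then show ?thesis by (intro exI[of _ "\<bar>B\<bar>"]) auto
qed

lemma test_function_bounded:
  assumes "\<phi> \<in> test_functions U"
  shows "\<exists>B\<ge>0. \<forall>x. \<bar>\<phi> x\<bar> \<le> B" "\<exists>B\<ge>0. \<forall>x. \<bar>frechet_derivative \<phi> (at x) v\<bar> \<le> B"
proof -
  have "C_k 0 \<phi>" "C_k (Suc 0) \<phi>" and c: "compact (closure {x. \<phi> x \<noteq> 0})"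
    using assms unfolding test_functions_def by blast+
  then show "\<exists>B\<ge>0. \<forall>x. \<bar>\<phi> x\<bar> \<le> B" "\<exists>B\<ge>0. \<forall>x. \<bar>frechet_derivative \<phi> (at x) v\<bar> \<le> B"
    by (auto intro!: continuous_zero_outside_compact_bounded[OF c] test_function_0[OF assms])
qed

lemma test_functions_mono: "\<phi> \<in> test_functions U \<Longrightarrow> U \<subseteq> V \<Longrightarrow> \<phi> \<in> test_functions V"
  by (auto simp: test_functions_def)

lemma integrable_lebesgue_on_subset:
  fixes f :: "'a::euclidean_space \<Rightarrow> real"
  assumes "integrable (lebesgue_on U) f" "S \<subseteq> U" "S \<in> sets lebesgue" "U \<in> sets lebesgue"
  shows "integrable (lebesgue_on S) f"
proof -
  have "set_integrable lebesgue U f" using assms by (simp add: set_integrable_def integrable_restrict_space)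
  then have "set_integrable lebesgue S f" using assms by (meson set_integrable_subset)
  then show ?thesis using assms by (simp add: set_integrable_def integrable_restrict_space)
qed

lemma integral_lebesgue_on_subset:
  fixes f :: "'a::euclidean_space \<Rightarrow> real"
  assumes "S \<subseteq> U" "S \<in> sets lebesgue" "U \<in> sets lebesgue" "\<And>x. x \<in> U - S \<Longrightarrow> f x = 0"
  shows "(LINT x|lebesgue_on U. f x) = (LINT x|lebesgue_on S. f x)"
proof -
  have "(\<lambda>x. indicator U x *\<^sub>R f x) = (\<lambda>x. indicator S x *\<^sub>R f x)"
    using assms by (auto simp: indicator_def fun_eq_iff)
  then show ?thesis using assms by (simp add: integral_restrict_space)
qed

lemma bump_integral_tendsto:
  fixes g :: "'a::euclidean_space \<Rightarrow> real"
  assumes g: "integrable (lebesgue_on U) g" and U: "U \<in> sets lebesgue" "cbox a b \<subseteq> U"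
  shows "(\<lambda>n. LINT x|lebesgue_on U. g x * bump a b (real (Suc n)) x) \<longlonglongrightarrow> integral (cbox a b) g"
proof -
  have bU: "box a b \<subseteq> U" using U box_subset_cbox by blast
  have m: "bump a b n \<in> borel_measurable (lebesgue_on U)" for n
    using C_k_bump[of 0 a b n] by (auto intro!: borel_measurable_lebesgue_on borel_measurable_continuous_onI)
  have "(\<lambda>n. LINT x|lebesgue_on U. g x * bump a b (real (Suc n)) x) \<longlonglongrightarrow> (LINT x|lebesgue_on U. g x * indicator (box a b) x)"
  proof (rule integral_dominated_convergence[where w="\<lambda>x. \<bar>g x\<bar>"])
    show "AE x in lebesgue_on U. (\<lambda>n. g x * bump a b (real (Suc n)) x) \<longlonglongrightarrow> g x * indicator (box a b) x"
      by (intro AE_I2 tendsto_mult_left bump_tendsto)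
    show "AE x in lebesgue_on U. norm (g x * bump a b (real (Suc n)) x) \<le> \<bar>g x\<bar>" for n
      using bump_bounds[of a b "real (Suc n)"] by (intro AE_I2) (auto simp: abs_mult intro: mult_left_le)
    show "(\<lambda>x. g x * bump a b (real (Suc n)) x) \<in> borel_measurable (lebesgue_on U)" for n
      using g m by (intro borel_measurable_times) auto
    show "(\<lambda>x. g x * indicat_real (box a b) x) \<in> borel_measurable (lebesgue_on U)"
      using g by (intro borel_measurable_times[OF _ borel_measurable_lebesgue_on] borel_measurable_indicator) auto
  qed (use g in auto)
  moreover have "(LINT x|lebesgue_on U. g x * indicator (box a b) x) = integral (cbox a b) g"
  proof -
    have "(LINT x|lebesgue_on U. g x * indicator (box a b) x) = (LINT x|lebesgue_on (box a b). g x * indicator (box a b) x)"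
      using U bU by (intro integral_lebesgue_on_subset) auto
    also have "\<dots> = (LINT x|lebesgue_on (box a b). g x)"
      by (intro Bochner_Integration.integral_cong) auto
    also have "\<dots> = integral (box a b) g"
      using integrable_lebesgue_on_subset[OF g bU _ U(1)] by (intro lebesgue_integral_eq_integral) auto
    finally show ?thesis by (simp add: integral_open_interval)
  qed
  ultimately show ?thesis by simp
qed

section \<open>Lebesgue points and the fundamental lemma\<close>

text \<open>g is extended by zero. As U is open, small cubes with lower corner x stay inside U and
  do not see the extension.\<close>

lemma lebesgue_differentiation:
  fixes g :: "'a::euclidean_space \<Rightarrow> real"
  assumes g: "integrable (lebesgue_on U) g" and U: "U \<in> sets lebesgue" "open U"
  shows "\<exists>N. negligible N \<and> (\<forall>x\<in>U - N. \<forall>e>0. \<exists>d>0. \<forall>h. 0 < h \<and> h < d \<longrightarrow>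
    cbox x (x + h *\<^sub>R One) \<subseteq> U \<and> \<bar>integral (cbox x (x + h *\<^sub>R One)) g / h ^ DIM('a) - g x\<bar> < e)"
proof -
  let ?f = "\<lambda>x. if x \<in> U then g x else 0"
  have "integrable lebesgue ?f"
  proof -
    have "?f = (\<lambda>x. indicator U x *\<^sub>R g x)" by (auto simp: indicator_def)
    then show ?thesis using g U by (simp add: integrable_restrict_space)
  qed
  then have "?f absolutely_integrable_on UNIV" by (simp add: set_integrable_def)
  then have int: "?f integrable_on cbox a b" for a b
    by (meson integrable_on_subcbox set_lebesgue_integral_eq_integral(1) subset_UNIV)
  obtain N where N: "negligible N" "\<And>x e. \<lbrakk>x \<notin> N; 0 < e\<rbrakk> \<Longrightarrow>
               \<exists>d>0. \<forall>h. 0 < h \<and> h < d \<longrightarrow>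
                         norm(integral (cbox x (x + h *\<^sub>R One)) ?f /\<^sub>R h ^ DIM('a) - ?f x) < e"
    by (rule integrable_ccontinuous_explicit[OF int]) blast
  show ?thesis
  proof (intro exI[of _ N] conjI ballI allI impI)
    fix x :: 'a and e :: real assume x: "x \<in> U - N" and "0 < e"
    obtain d where d: "d > 0" "\<And>h. 0 < h \<and> h < d \<Longrightarrow>
                         norm(integral (cbox x (x + h *\<^sub>R One)) ?f /\<^sub>R h ^ DIM('a) - ?f x) < e"
      using N(2)[of x e] x \<open>0 < e\<close> by blast
    obtain r where r: "r > 0" "ball x r \<subseteq> U" using x U open_contains_ball by blast
    \<comment> \<open>A point of a cube of edge h is within \<open>DIM('a)\<close> times h of the
      corner, by the sum norm.\<close>
    define d' where "d' = min d (r / real DIM('a))"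
    have d': "d' > 0" using d r by (simp add: d'_def)
    have "cbox x (x + h *\<^sub>R One) \<subseteq> U \<and> \<bar>integral (cbox x (x + h *\<^sub>R One)) g / h ^ DIM('a) - g x\<bar> < e"
      if h: "0 < h" "h < d'" for h
    proof
      show sub: "cbox x (x + h *\<^sub>R One) \<subseteq> U"
      proof
        fix y assume y: "y \<in> cbox x (x + h *\<^sub>R One)"
        have "norm (y - x) \<le> (\<Sum>i\<in>Basis. \<bar>(y - x) \<bullet> i\<bar>)" by (rule norm_le_l1)
        also have "\<dots> \<le> (\<Sum>i\<in>(Basis::'a set). h)"
          using y by (intro sum_mono) (auto simp: mem_box inner_diff_left inner_add_left)
        also have "\<dots> < r" using h by (simp add: d'_def field_simps)
        finally show "y \<in> U" using r by (auto simp: dist_norm norm_minus_commute)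
      qed
      have "integral (cbox x (x + h *\<^sub>R One)) g = integral (cbox x (x + h *\<^sub>R One)) ?f"
        using sub by (intro integral_cong) auto
      then show "\<bar>integral (cbox x (x + h *\<^sub>R One)) g / h ^ DIM('a) - g x\<bar> < e"
        using d(2)[of h] h x by (simp add: d'_def divide_inverse_commute)
    qed
    then show "\<exists>d>0. \<forall>h. 0 < h \<and> h < d \<longrightarrow>
      cbox x (x + h *\<^sub>R One) \<subseteq> U \<and> \<bar>integral (cbox x (x + h *\<^sub>R One)) g / h ^ DIM('a) - g x\<bar> < e"
      using d' by blast
  qed (rule N)
qed

lemma AE_lebesgue_onI:
  assumes "negligible N" "U \<in> sets lebesgue" "\<And>x. x \<in> U - N \<Longrightarrow> P x"
  shows "AE x in lebesgue_on U. P x"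
proof -
  have "N \<in> null_sets lebesgue" using assms(1) by (simp add: negligible_iff_null_sets)
  then have "AE x in lebesgue. x \<notin> N" by (rule AE_not_in)
  then show ?thesis using assms by (auto simp: AE_restrict_space_iff elim!: eventually_mono)
qed

text \<open>Bumps show that g has integral 0 over every closed box in U, and at a Lebesgue point g
  is a limit of averages over such boxes.\<close>

lemma fundamental_lemma:
  fixes g :: "'a::euclidean_space \<Rightarrow> real"
  assumes U: "open U" and g: "integrable (lebesgue_on U) g"
    and 0: "\<And>\<phi>. \<phi> \<in> test_functions U \<Longrightarrow> (LINT x|lebesgue_on U. g x * \<phi> x) = 0"
  shows "AE x in lebesgue_on U. g x = 0"
proof -
  have Us: "U \<in> sets lebesgue" using U by simp
  have i0: "integral (cbox a b) g = 0" if "cbox a b \<subseteq> U" for a b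
  proof -
    have "(\<lambda>n. LINT x|lebesgue_on U. g x * bump a b (real (Suc n)) x) = (\<lambda>n. 0)"
      using 0[OF bump_test_function[OF _ that]] by auto
    then show ?thesis using bump_integral_tendsto[OF g Us that] LIMSEQ_unique by (metis tendsto_const)
  qed
  obtain N where N: "negligible N" "\<forall>x\<in>U - N. \<forall>e>0. \<exists>d>0. \<forall>h. 0 < h \<and> h < d \<longrightarrow>
    cbox x (x + h *\<^sub>R One) \<subseteq> U \<and> \<bar>integral (cbox x (x + h *\<^sub>R One)) g / h ^ DIM('a) - g x\<bar> < e"
    using lebesgue_differentiation[OF g Us U] by blast
  show ?thesis
  proof (rule AE_lebesgue_onI[OF N(1) Us], rule ccontr)
    fix x assume x: "x \<in> U - N" "g x \<noteq> 0"
    then obtain d where d: "d > 0" "\<forall>h. 0 < h \<and> h < d \<longrightarrow>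
      cbox x (x + h *\<^sub>R One) \<subseteq> U \<and> \<bar>integral (cbox x (x + h *\<^sub>R One)) g / h ^ DIM('a) - g x\<bar> < \<bar>g x\<bar>"
      using N(2) by (meson zero_less_abs_iff)
    \<comment> \<open>Any admissible edge length will do: the average is 0, yet it would have to be
      closer to g x than \<bar>g x\<bar>.\<close>
    then show False using i0 d(2)[rule_format, of "d / 2"] by auto
  qed
qed

section \<open>Essentially bounded functions and restriction to subsets\<close>

lemma AE_abs_le_of_Linf_norm:
  assumes "Linf_norm U f \<le> ereal B"
  shows "AE x in lebesgue_on U. \<bar>f x\<bar> \<le> B"
proof -
  have "AE x in lebesgue_on U. ereal \<bar>f x\<bar> \<le> Linf_norm U f"
    unfolding Linf_norm_def by (rule esssup_AE)
  then show ?thesis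
    by eventually_elim (use assms in \<open>metis ereal_less_eq(3) order_trans\<close>)
qed

lemma Linf_iff:
  "f \<in> Linf U \<longleftrightarrow> f \<in> borel_measurable (lebesgue_on U) \<and> (\<exists>B. AE x in lebesgue_on U. \<bar>f x\<bar> \<le> B)"
proof
  assume f: "f \<in> Linf U"
  then have "\<exists>B. Linf_norm U f \<le> ereal B"
    unfolding Linf_def by (cases "Linf_norm U f") auto
  then show "f \<in> borel_measurable (lebesgue_on U) \<and> (\<exists>B. AE x in lebesgue_on U. \<bar>f x\<bar> \<le> B)"
    using f AE_abs_le_of_Linf_norm unfolding Linf_def by blast
next
  assume "f \<in> borel_measurable (lebesgue_on U) \<and> (\<exists>B. AE x in lebesgue_on U. \<bar>f x\<bar> \<le> B)"
  then obtain B where f: "f \<in> borel_measurable (lebesgue_on U)" "AE x in lebesgue_on U. \<bar>f x\<bar> \<le> B" by blast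
  have "Linf_norm U f \<le> ereal B"
    unfolding Linf_norm_def using f by (intro esssup_I) auto
  then show "f \<in> Linf U" using f by (auto simp: Linf_def intro: le_less_trans)
qed

lemma Linf_measurable: "f \<in> Linf U \<Longrightarrow> f \<in> borel_measurable (lebesgue_on U)"
  by (simp add: Linf_def)

lemma Linf_integrable: "U \<in> lmeasurable \<Longrightarrow> f \<in> Linf U \<Longrightarrow> integrable (lebesgue_on U) f"
  unfolding Linf_iff by (blast intro: bounded_integrable_lebesgue_on)

lemma Linf_const: "(\<lambda>x. c) \<in> Linf U"
  unfolding Linf_iff by (auto intro!: exI[of _ "\<bar>c\<bar>"])

lemma Linf_add: assumes "f \<in> Linf U" "g \<in> Linf U" shows "(\<lambda>x. f x + g x) \<in> Linf U"
proof -
  obtain B C where "AE x in lebesgue_on U. \<bar>f x\<bar> \<le> B" "AE x in lebesgue_on U. \<bar>g x\<bar> \<le> C"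
    using assms unfolding Linf_iff by blast
  then have "AE x in lebesgue_on U. \<bar>f x + g x\<bar> \<le> B + C" by eventually_elim auto
  then show ?thesis using assms unfolding Linf_iff by auto
qed

lemma Linf_mult: assumes "f \<in> Linf U" "g \<in> Linf U" shows "(\<lambda>x. f x * g x) \<in> Linf U"
proof -
  obtain B C where "AE x in lebesgue_on U. \<bar>f x\<bar> \<le> B" "AE x in lebesgue_on U. \<bar>g x\<bar> \<le> C"
    using assms unfolding Linf_iff by blast
  then have "AE x in lebesgue_on U. \<bar>f x * g x\<bar> \<le> \<bar>B\<bar> * \<bar>C\<bar>"
    by eventually_elim (auto simp: abs_mult intro!: mult_mono)
  then show ?thesis using assms unfolding Linf_iff by auto
qed

lemma Linf_diff: assumes "f \<in> Linf U" "g \<in> Linf U" shows "(\<lambda>x. f x - g x) \<in> Linf U"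
  using Linf_add[OF assms(1) Linf_mult[OF Linf_const[of "-1"] assms(2)]] by simp

lemma Linf_sum: "finite A \<Longrightarrow> (\<And>i. i \<in> A \<Longrightarrow> f i \<in> Linf U) \<Longrightarrow> (\<lambda>x. \<Sum>i\<in>A. f i x) \<in> Linf U"
  by (induction A rule: finite_induct) (auto intro: Linf_add Linf_const)

lemma Linf_poly:
  fixes p :: "'a::euclidean_space \<Rightarrow> real"
  assumes "poly_le m p" "bounded U"
  shows "p \<in> Linf U"
proof -
  obtain R where R: "\<forall>x\<in>U. norm x \<le> R" using assms(2) bounded_iff by blast
  obtain B where B: "\<forall>x\<in>cball 0 R. \<forall>y\<in>cball 0 R. \<bar>p x\<bar> \<le> B \<and> \<bar>p x - p y\<bar> \<le> B * norm (x - y)"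
    using poly_le_bounded_lipschitz[OF assms(1), of R] by blast
  have "\<bar>p x\<bar> \<le> B" if "x \<in> U" for x
    using B R that by (metis dist_0_norm mem_cball)
  then have "AE x in lebesgue_on U. \<bar>p x\<bar> \<le> B" by (intro AE_I2) auto
  then show ?thesis
    unfolding Linf_iff using borel_measurable_lebesgue_on[OF poly_le_measurable[OF assms(1)]] by blast
qed

lemma Linf_test_function:
  assumes "\<phi> \<in> test_functions V"
  shows "\<phi> \<in> Linf U" "(\<lambda>x. frechet_derivative \<phi> (at x) v) \<in> Linf U"
  using test_function_bounded[OF assms] test_function_measurable[OF assms] unfolding Linf_iff
  by (blast intro: AE_I2)+

lemma Linf_subset:
  assumes "f \<in> Linf U" "S \<subseteq> U" "S \<in> sets lebesgue" "U \<in> sets lebesgue"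
  shows "f \<in> Linf S"
proof -
  obtain B where B: "AE x in lebesgue_on U. \<bar>f x\<bar> \<le> B" using assms unfolding Linf_iff by blast
  then have "AE x in lebesgue_on S. \<bar>f x\<bar> \<le> B"
    using assms(2-4) by (auto simp: AE_restrict_space_iff elim!: eventually_mono)
  then show ?thesis
    using assms unfolding Linf_iff by (blast intro: measurable_restrict_mono)
qed

text \<open>A test function on S is also one on U, and both it and its derivatives vanish on the
  rest of U.\<close>

lemma is_weak_partial_subset:
  assumes "is_weak_partial U i f g" "S \<subseteq> U" "S \<in> sets lebesgue" "U \<in> sets lebesgue"
  shows "is_weak_partial S i f g"
  unfolding is_weak_partial_def
proof
  fix \<phi> assume \<phi>: "\<phi> \<in> test_functions S"
  then have c: "closure {x. \<phi> x \<noteq> 0} \<subseteq> S" by (simp add: test_functions_def)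
  have z: "\<phi> x = 0" "frechet_derivative \<phi> (at x) i = 0" if "x \<in> U - S" for x
    using test_function_0[OF \<phi>, of x] c that by blast+
  have "(LINT x|lebesgue_on U. g x * \<phi> x) = - (LINT x|lebesgue_on U. f x * frechet_derivative \<phi> (at x) i)"
    using assms(1) test_functions_mono[OF \<phi> assms(2)] by (simp add: is_weak_partial_def)
  moreover have "(LINT x|lebesgue_on U. g x * \<phi> x) = (LINT x|lebesgue_on S. g x * \<phi> x)"
    by (rule integral_lebesgue_on_subset[OF assms(2-4)]) (simp only: z mult_zero_right)
  moreover have "(LINT x|lebesgue_on U. f x * frechet_derivative \<phi> (at x) i)
    = (LINT x|lebesgue_on S. f x * frechet_derivative \<phi> (at x) i)"
    by (rule integral_lebesgue_on_subset[OF assms(2-4)]) (simp only: z mult_zero_right)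
  ultimately show "(LINT x|lebesgue_on S. g x * \<phi> x) = - (LINT x|lebesgue_on S. f x * frechet_derivative \<phi> (at x) i)"
    by simp
qed

section \<open>From bounded weak partials to Lipschitz bounds\<close>

lemma test_function_line_derivative:
  assumes "\<phi> \<in> test_functions V"
  shows "((\<lambda>s. \<phi> (x - s *\<^sub>R h)) has_real_derivative - frechet_derivative \<phi> (at (x - t *\<^sub>R h)) h) (at t)"
proof -
  let ?D = "frechet_derivative \<phi> (at (x - t *\<^sub>R h))"
  have d: "(\<phi> has_derivative ?D) (at (x - t *\<^sub>R h))"
    by (rule test_function_has_derivative[OF assms])
  have "((\<lambda>s. x - s *\<^sub>R h) has_derivative (\<lambda>s. - (s *\<^sub>R h))) (at t)"
    by (auto intro!: derivative_eq_intros)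
  then have "((\<lambda>s. \<phi> (x - s *\<^sub>R h)) has_derivative (\<lambda>s. ?D (- (s *\<^sub>R h)))) (at t)"
    by (rule has_derivative_compose) (rule d)
  moreover have "?D (- (s *\<^sub>R h)) = - ?D h * s" for s
    using linear_cmul[OF has_derivative_linear[OF d], of "-s" h] by simp
  then have "(\<lambda>s. ?D (- (s *\<^sub>R h))) = (*) (- ?D h)" by (intro ext)
  ultimately show ?thesis unfolding has_field_derivative_def by simp
qed

text \<open>Differentiation under the integral sign: a bound on the directional derivative of \<phi>
  dominates the difference quotients. Moving the test function is how a weak derivative of f becomes
  visible in averages of f.\<close>

lemma translate_test_function_derivative:
  fixes f :: "'a::euclidean_space \<Rightarrow> real"
  assumes f: "integrable (lebesgue_on U) f" and \<phi>: "\<phi> \<in> test_functions V"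
  shows "((\<lambda>t. LINT x|lebesgue_on U. f x * \<phi> (x - t *\<^sub>R h)) has_real_derivative
    (LINT x|lebesgue_on U. f x * - frechet_derivative \<phi> (at (x - t *\<^sub>R h)) h)) (at t)"
proof -
  obtain B where B: "\<And>x. \<bar>frechet_derivative \<phi> (at x) h\<bar> \<le> B"
    using test_function_bounded(2)[OF \<phi>] by blast
  obtain C where C: "\<And>x. \<bar>\<phi> x\<bar> \<le> C" using test_function_bounded(1)[OF \<phi>] by blast
  have C0: "C_k 0 \<phi>" "C_k (Suc 0) \<phi>" using \<phi> unfolding test_functions_def by blast+
  have c: "continuous_on UNIV (\<lambda>x. x - s *\<^sub>R h)" for s by (intro continuous_intros)
  have m1: "(\<lambda>x. \<phi> (x - s *\<^sub>R h)) \<in> borel_measurable (lebesgue_on U)" for s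
    by (intro borel_measurable_lebesgue_on borel_measurable_continuous_onI)
      (rule continuous_on_compose2[OF _ c subset_UNIV], use C0 in simp)
  have m2: "(\<lambda>x. frechet_derivative \<phi> (at (x - s *\<^sub>R h)) h) \<in> borel_measurable (lebesgue_on U)" for s
    by (intro borel_measurable_lebesgue_on borel_measurable_continuous_onI)
      (rule continuous_on_compose2[OF _ c subset_UNIV, where g="\<lambda>x. frechet_derivative \<phi> (at x) h"], use C0 in simp)
  have fm: "f \<in> borel_measurable (lebesgue_on U)" by (rule borel_measurable_integrable[OF f])
  have lip: "\<bar>\<phi> (x - s *\<^sub>R h) - \<phi> (x - t *\<^sub>R h)\<bar> \<le> B * \<bar>s - t\<bar>" for x s t
    using field_differentiable_bound[of UNIV "\<lambda>s. \<phi> (x - s *\<^sub>R h)" "\<lambda>t. - frechet_derivative \<phi> (at (x - t *\<^sub>R h)) h" B s t]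
      test_function_line_derivative[OF \<phi>] B by auto
  have int: "integrable (lebesgue_on U) (\<lambda>x. f x * \<phi> (x - s *\<^sub>R h))" for s
  proof (rule Bochner_Integration.integrable_bound[of _ "\<lambda>x. C * f x"])
    show "AE x in lebesgue_on U. norm (f x * \<phi> (x - s *\<^sub>R h)) \<le> norm (C * f x)"
      using C by (intro AE_I2) (auto simp: abs_mult mult.commute[of "\<bar>C\<bar>"] intro!: mult_left_mono intro: order_trans[OF C])
  qed (use f fm m1 in auto)
  show ?thesis
    unfolding DERIV_def tendsto_at_iff_sequentially
  proof (intro allI impI)
    fix X :: "nat \<Rightarrow> real" assume X: "\<forall>i. X i \<in> UNIV - {0}" and X0: "X \<longlonglongrightarrow> 0"
    have "(\<lambda>i. LINT x|lebesgue_on U. f x * ((\<phi> (x - (t + X i) *\<^sub>R h) - \<phi> (x - t *\<^sub>R h)) / X i))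
      \<longlonglongrightarrow> (LINT x|lebesgue_on U. f x * - frechet_derivative \<phi> (at (x - t *\<^sub>R h)) h)"
    proof (rule integral_dominated_convergence[where w="\<lambda>x. \<bar>f x\<bar> * B"])
      show "AE x in lebesgue_on U. (\<lambda>i. f x * ((\<phi> (x - (t + X i) *\<^sub>R h) - \<phi> (x - t *\<^sub>R h)) / X i))
          \<longlonglongrightarrow> f x * - frechet_derivative \<phi> (at (x - t *\<^sub>R h)) h"
      proof (intro AE_I2 tendsto_mult_left)
        fix x
        have "(\<lambda>s. (\<phi> (x - (t + s) *\<^sub>R h) - \<phi> (x - t *\<^sub>R h)) / s) \<midarrow>0\<rightarrow> - frechet_derivative \<phi> (at (x - t *\<^sub>R h)) h"
          using test_function_line_derivative[OF \<phi>, of x h t] by (simp add: DERIV_def)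
        then show "(\<lambda>i. (\<phi> (x - (t + X i) *\<^sub>R h) - \<phi> (x - t *\<^sub>R h)) / X i) \<longlonglongrightarrow> - frechet_derivative \<phi> (at (x - t *\<^sub>R h)) h"
          using X X0 unfolding tendsto_at_iff_sequentially comp_def by blast
      qed
      show "AE x in lebesgue_on U. norm (f x * ((\<phi> (x - (t + X i) *\<^sub>R h) - \<phi> (x - t *\<^sub>R h)) / X i)) \<le> \<bar>f x\<bar> * B" for i
      proof (intro AE_I2)
        fix x
        have "\<bar>(\<phi> (x - (t + X i) *\<^sub>R h) - \<phi> (x - t *\<^sub>R h)) / X i\<bar> \<le> B"
          using lip[of x "t + X i" t] X[rule_format, of i] by (simp add: abs_divide divide_le_eq)
        then show "norm (f x * ((\<phi> (x - (t + X i) *\<^sub>R h) - \<phi> (x - t *\<^sub>R h)) / X i)) \<le> \<bar>f x\<bar> * B"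
          unfolding real_norm_def abs_mult by (rule mult_left_mono) auto
      qed
      show "integrable (lebesgue_on U) (\<lambda>x. \<bar>f x\<bar> * B)" using f by auto
    qed (use fm m1 m2 in \<open>auto intro!: borel_measurable_times borel_measurable_divide borel_measurable_diff borel_measurable_uminus\<close>)
    moreover have "(LINT x|lebesgue_on U. f x * ((\<phi> (x - (t + X i) *\<^sub>R h) - \<phi> (x - t *\<^sub>R h)) / X i))
      = ((LINT x|lebesgue_on U. f x * \<phi> (x - (t + X i) *\<^sub>R h)) - (LINT x|lebesgue_on U. f x * \<phi> (x - t *\<^sub>R h))) / X i" for i
      by (subst Bochner_Integration.integral_diff[symmetric, OF int int])
        (simp add: right_diff_distrib diff_divide_distrib flip: integral_divide_zero)
    ultimately show "((\<lambda>s. ((LINT x|lebesgue_on U. f x * \<phi> (x - (t + s) *\<^sub>R h)) - (LINT x|lebesgue_on U. f x * \<phi> (x - t *\<^sub>R h))) / s) \<circ> X)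
      \<longlonglongrightarrow> (LINT x|lebesgue_on U. f x * - frechet_derivative \<phi> (at (x - t *\<^sub>R h)) h)"
      by (simp only: comp_def)
  qed
qed

lemma frechet_derivative_basis:
  fixes f :: "'a::euclidean_space \<Rightarrow> real"
  assumes "f differentiable (at x)"
  shows "frechet_derivative f (at x) h = (\<Sum>i\<in>Basis. (h \<bullet> i) * frechet_derivative f (at x) i)"
proof -
  have l: "linear (frechet_derivative f (at x))" by (rule linear_frechet_derivative[OF assms])
  have "frechet_derivative f (at x) h = frechet_derivative f (at x) (\<Sum>i\<in>Basis. (h \<bullet> i) *\<^sub>R i)"
    by (simp add: euclidean_representation)
  then show ?thesis by (simp add: linear_sum[OF l] linear_cmul[OF l])
qed

lemma frechet_derivative_translate:
  assumes "f differentiable (at (x - z))"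
  shows "frechet_derivative (\<lambda>x. f (x - z)) (at x) = frechet_derivative f (at (x - z))"
proof -
  have "(f has_derivative frechet_derivative f (at (x - z))) (at (x - z))"
    using assms frechet_derivative_works by blast
  moreover have "((\<lambda>x. x - z) has_derivative (\<lambda>v. v)) (at x)" by (auto intro!: derivative_eq_intros)
  ultimately have "((\<lambda>x. f (x - z)) has_derivative (\<lambda>v. frechet_derivative f (at (x - z)) v)) (at x)"
    by (rule_tac has_derivative_compose)
  then show ?thesis by (metis frechet_derivative_at)
qed

lemma bump_integral_le:
  assumes "n > 0" "cbox a b \<subseteq> U" "U \<in> lmeasurable"
  shows "(LINT x|lebesgue_on U. bump a b n x) \<le> measure lborel (cbox a b)"
proof -
  have U: "U \<in> sets lebesgue" using assms(3) by auto
  have "(LINT x|lebesgue_on U. bump a b n x) = (LINT x|lebesgue_on (cbox a b). bump a b n x)"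
    using bump_nonzero[OF assms(1), of a b] box_subset_cbox[of a b] U assms(2)
    by (intro integral_lebesgue_on_subset) auto
  also have "\<dots> \<le> (LINT x|lebesgue_on (cbox a b). 1)"
  proof (rule integral_mono)
    show "integrable (lebesgue_on (cbox a b)) (bump a b n)"
      by (rule Linf_integrable[OF _ Linf_test_function(1)[OF bump_test_function[OF assms(1) subset_UNIV]]]) auto
    show "integrable (lebesgue_on (cbox a b)) (\<lambda>x. 1::real)"
      by (rule Linf_integrable[OF _ Linf_const]) auto
  qed (rule bump_bounds)
  finally show ?thesis by (simp add: measure_restrict_space)
qed

text \<open>A bump slides from one box to the other along h. The weak partials turn the rate of
  change of its pairing with f into pairings of the functions g i with the bump, each at most G i
  times the volume of the box. Letting the bump tend to the indicator gives the claim.\<close>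

lemma weak_partials_box_average:
  fixes f :: "'a::euclidean_space \<Rightarrow> real"
  assumes U: "open U" "convex U" "bounded U" and f: "f \<in> Linf U"
    and g: "\<And>i. i \<in> Basis \<Longrightarrow> g i \<in> Linf U" "\<And>i. i \<in> Basis \<Longrightarrow> AE x in lebesgue_on U. \<bar>g i x\<bar> \<le> G i"
    and w: "\<And>i. i \<in> Basis \<Longrightarrow> is_weak_partial U i f (g i)"
    and sub: "cbox a b \<subseteq> U" "cbox (a + h) (b + h) \<subseteq> U" and ne: "cbox a b \<noteq> {}"
  shows "\<bar>integral (cbox (a + h) (b + h)) f - integral (cbox a b) f\<bar> \<le> (\<Sum>i\<in>Basis. G i) * norm h * measure lborel (cbox a b)"
proof -
  have Um: "U \<in> lmeasurable" and Us: "U \<in> sets lebesgue" using U by (auto simp: lmeasurable_open)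
  have fi: "integrable (lebesgue_on U) f" by (rule Linf_integrable[OF Um f])
  \<comment> \<open>U contains a nonempty box, so it is not negligible, and a bound on an absolute
    value that holds almost everywhere on it cannot be negative.\<close>
  have G0: "G i \<ge> 0" if "i \<in> Basis" for i
  proof (rule ccontr)
    assume "\<not> G i \<ge> 0"
    then have "AE x in lebesgue_on U. False" using g(2)[OF that] by (auto elim!: eventually_mono)
    then have "negligible U"
      using Us by (simp add: AE_restrict_space_iff negligible_iff_null_sets completion.AE_iff_null_sets)
    then show False using open_not_negligible[OF U(1)] ne sub(1) by auto
  qed
  \<comment> \<open>A point of an intermediate box is the convex combination, with weight t, of its
    shifts into the first and the last box; convexity of U enters here.\<close>
  have subt: "cbox (a + t *\<^sub>R h) (b + t *\<^sub>R h) \<subseteq> U" if t: "0 \<le> t" "t \<le> 1" for t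
  proof
    fix y assume y: "y \<in> cbox (a + t *\<^sub>R h) (b + t *\<^sub>R h)"
    have "y - t *\<^sub>R h \<in> U" using y sub(1) by (auto simp: mem_box algebra_simps subset_iff)
    moreover have "y - t *\<^sub>R h + h \<in> U" using y sub(2) by (auto simp: mem_box algebra_simps subset_iff)
    ultimately have "(1 - t) *\<^sub>R (y - t *\<^sub>R h) + t *\<^sub>R (y - t *\<^sub>R h + h) \<in> U"
      using U(2) t by (auto simp: convex_def)
    then show "y \<in> U" by (simp add: algebra_simps)
  qed
  have main: "\<bar>(LINT x|lebesgue_on U. f x * bump (a + h) (b + h) n x) - (LINT x|lebesgue_on U. f x * bump a b n x)\<bar>
    \<le> (\<Sum>i\<in>Basis. G i) * norm h * measure lborel (cbox a b)" if n: "n > 0" for n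
  proof -
    let ?\<phi> = "bump a b n"
    let ?F = "\<lambda>t. LINT x|lebesgue_on U. f x * ?\<phi> (x - t *\<^sub>R h)"
    let ?F' = "\<lambda>t. LINT x|lebesgue_on U. f x * - frechet_derivative ?\<phi> (at (x - t *\<^sub>R h)) h"
    have \<phi>: "?\<phi> \<in> test_functions U" by (rule bump_test_function[OF n sub(1)])
    have "(?F has_real_derivative ?F' t) (at t within {0..1})" for t
      using translate_test_function_derivative[OF fi \<phi>] by (rule has_field_derivative_at_within)
    moreover have "norm (?F' t) \<le> (\<Sum>i\<in>Basis. G i) * norm h * measure lborel (cbox a b)" if t: "t \<in> {0..1}" for t
    proof -
      let ?\<psi> = "bump (a + t *\<^sub>R h) (b + t *\<^sub>R h) n"
      have \<psi>: "?\<psi> \<in> test_functions U" using bump_test_function[OF n subt] t by auto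
      have \<psi>d: "?\<psi> differentiable (at x)" for x
        using test_function_has_derivative[OF \<psi>] differentiable_def by blast
      have \<phi>d: "?\<phi> differentiable (at x)" for x
        using test_function_has_derivative[OF \<phi>] differentiable_def by blast
      have eq: "frechet_derivative ?\<phi> (at (x - t *\<^sub>R h)) = frechet_derivative ?\<psi> (at x)" for x
        using frechet_derivative_translate[where x=x and z="t *\<^sub>R h", OF \<phi>d]
        by (simp only: bump_translate[abs_def])
      have i1: "integrable (lebesgue_on U) (\<lambda>x. f x * frechet_derivative ?\<psi> (at x) v)" for v
        by (intro Linf_integrable[OF Um] Linf_mult f Linf_test_function[OF \<psi>])
      have "?F' t = - (LINT x|lebesgue_on U. (\<Sum>i\<in>Basis. (h \<bullet> i) * (f x * frechet_derivative ?\<psi> (at x) i)))"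
        unfolding eq
        by (subst frechet_derivative_basis[OF \<psi>d]) (simp add: sum_distrib_left algebra_simps)
      also have "\<dots> = - (\<Sum>i\<in>Basis. (h \<bullet> i) * (LINT x|lebesgue_on U. f x * frechet_derivative ?\<psi> (at x) i))"
        using i1 by (subst Bochner_Integration.integral_sum) auto
      also have "\<dots> = (\<Sum>i\<in>Basis. (h \<bullet> i) * (LINT x|lebesgue_on U. g i x * ?\<psi> x))"
        using w \<psi> by (simp add: is_weak_partial_def sum_negf)
      also have "\<bar>\<dots>\<bar> \<le> (\<Sum>i\<in>Basis. norm h * (G i * measure lborel (cbox a b)))"
      proof (rule order_trans[OF sum_abs sum_mono])
        fix i :: 'a assume i: "i \<in> Basis"
        have "\<bar>LINT x|lebesgue_on U. g i x * ?\<psi> x\<bar> \<le> (LINT x|lebesgue_on U. G i * ?\<psi> x)"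
        proof (rule order_trans[OF integral_abs_bound integral_mono_AE])
          show "integrable (lebesgue_on U) (\<lambda>x. \<bar>g i x * ?\<psi> x\<bar>)"
            by (intro integrable_abs Linf_integrable[OF Um] Linf_mult g i Linf_test_function[OF \<psi>])
          show "integrable (lebesgue_on U) (\<lambda>x. G i * ?\<psi> x)"
            by (intro Linf_integrable[OF Um] Linf_mult Linf_const Linf_test_function[OF \<psi>])
          show "AE x in lebesgue_on U. \<bar>g i x * ?\<psi> x\<bar> \<le> G i * ?\<psi> x"
            using g(2)[OF i] by eventually_elim (auto simp: abs_mult bump_bounds intro: mult_right_mono)
        qed
        also have "\<dots> = G i * (LINT x|lebesgue_on U. ?\<psi> x)" by simp
        also have "\<dots> \<le> G i * measure lborel (cbox a b)"
        proof -
          have "(LINT x|lebesgue_on U. ?\<psi> x) \<le> measure lborel (cbox (a + t *\<^sub>R h) (b + t *\<^sub>R h))"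
            using subt t by (intro bump_integral_le[OF n _ Um]) auto
          also have "\<dots> = measure lborel (cbox a b)"
          proof -
            have "cbox (a + t *\<^sub>R h) (b + t *\<^sub>R h) \<noteq> {}"
              using ne by (auto simp: box_ne_empty inner_add_left)
            then show ?thesis using ne by (simp add: content_cbox' inner_add_left)
          qed
          finally show ?thesis by (rule mult_left_mono[OF _ G0[OF i]])
        qed
        finally show "\<bar>(h \<bullet> i) * (LINT x|lebesgue_on U. g i x * ?\<psi> x)\<bar> \<le> norm h * (G i * measure lborel (cbox a b))"
          unfolding abs_mult using Basis_le_norm[OF i, of h] by (intro mult_mono) auto
      qed
      finally show ?thesis by (simp add: sum_distrib_left sum_distrib_right mult_ac)
    qed
    ultimately have "norm (?F 1 - ?F 0) \<le> (\<Sum>i\<in>Basis. G i) * norm h * measure lborel (cbox a b) * norm (1 - 0 :: real)"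
      by (intro field_differentiable_bound[of "{0..1}" ?F ?F']) auto
    then show ?thesis by (simp add: bump_translate[abs_def])
  qed
  have "(\<lambda>n. \<bar>(LINT x|lebesgue_on U. f x * bump (a + h) (b + h) (real (Suc n)) x) - (LINT x|lebesgue_on U. f x * bump a b (real (Suc n)) x)\<bar>)
     \<longlonglongrightarrow> \<bar>integral (cbox (a + h) (b + h)) f - integral (cbox a b) f\<bar>"
    by (intro tendsto_intros bump_integral_tendsto[OF fi Us] sub)
  then show ?thesis
    by (rule Lim_bounded[of _ _ 0]) (use main in auto)
qed

text \<open>At Lebesgue points f x and f y are limits of averages over cubes with lower corners x
  and y, and cubes of equal edge are translates of each other. The null set consists of the points
  where this limit may fail, so it does not depend on the pair.\<close>

lemma weak_partials_lipschitz:
  fixes f :: "'a::euclidean_space \<Rightarrow> real"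
  assumes U: "open U" "convex U" "bounded U" and f: "f \<in> Linf U"
    and g: "\<And>i. i \<in> Basis \<Longrightarrow> g i \<in> Linf U" "\<And>i. i \<in> Basis \<Longrightarrow> AE x in lebesgue_on U. \<bar>g i x\<bar> \<le> G i"
    and w: "\<And>i. i \<in> Basis \<Longrightarrow> is_weak_partial U i f (g i)"
  shows "\<exists>N. negligible N \<and> (\<forall>x\<in>U - N. \<forall>y\<in>U - N. \<bar>f x - f y\<bar> \<le> (\<Sum>i\<in>Basis. G i) * norm (x - y))"
proof -
  have Um: "U \<in> lmeasurable" and Us: "U \<in> sets lebesgue" using U by (auto simp: lmeasurable_open)
  obtain N where N: "negligible N" "\<forall>x\<in>U - N. \<forall>e>0. \<exists>d>0. \<forall>h. 0 < h \<and> h < d \<longrightarrow>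
    cbox x (x + h *\<^sub>R One) \<subseteq> U \<and> \<bar>integral (cbox x (x + h *\<^sub>R One)) f / h ^ DIM('a) - f x\<bar> < e"
    using lebesgue_differentiation[OF Linf_integrable[OF Um f] Us U(1)] by blast
  show ?thesis
  proof (intro exI[of _ N] conjI ballI N(1))
    fix x y assume x: "x \<in> U - N" and y: "y \<in> U - N"
    show "\<bar>f x - f y\<bar> \<le> (\<Sum>i\<in>Basis. G i) * norm (x - y)"
    proof (rule field_le_epsilon)
      fix e :: real assume e: "e > 0"
      then have e2: "e / 2 > 0" by simp
      obtain d1 where d1: "d1 > 0" "\<forall>h. 0 < h \<and> h < d1 \<longrightarrow>
        cbox x (x + h *\<^sub>R One) \<subseteq> U \<and> \<bar>integral (cbox x (x + h *\<^sub>R One)) f / h ^ DIM('a) - f x\<bar> < e / 2"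
        using N(2) x e2 by blast
      obtain d2 where d2: "d2 > 0" "\<forall>h. 0 < h \<and> h < d2 \<longrightarrow>
        cbox y (y + h *\<^sub>R One) \<subseteq> U \<and> \<bar>integral (cbox y (y + h *\<^sub>R One)) f / h ^ DIM('a) - f y\<bar> < e / 2"
        using N(2) y e2 by blast
      define s where "s = min d1 d2 / 2"
      have s: "s > 0" "s < d1" "s < d2" using d1 d2 by (auto simp: s_def)
      let ?I = "\<lambda>x. integral (cbox x (x + s *\<^sub>R One)) f"
      define A where "A = ?I x / s ^ DIM('a)"
      define B where "B = ?I y / s ^ DIM('a)"
      have "\<bar>?I (y + (x - y)) - ?I y\<bar> \<le> (\<Sum>i\<in>Basis. G i) * norm (x - y) * measure lborel (cbox y (y + s *\<^sub>R One))"
        using weak_partials_box_average[OF U f g w, of y "y + s *\<^sub>R One" "x - y"] d1 d2 s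
        by (auto simp: algebra_simps box_ne_empty)
      moreover have "measure lborel (cbox y (y + s *\<^sub>R One)) = s ^ DIM('a)"
        using s by (subst content_cbox) (auto simp: inner_add_left)
      ultimately have "\<bar>?I x - ?I y\<bar> / s ^ DIM('a) \<le> (\<Sum>i\<in>Basis. G i) * norm (x - y)"
        using s by (simp add: divide_le_eq)
      moreover have "\<bar>?I x - ?I y\<bar> / s ^ DIM('a) = \<bar>A - B\<bar>"
        using s by (simp add: A_def B_def flip: diff_divide_distrib)
      moreover have "\<bar>A - f x\<bar> < e / 2" "\<bar>B - f y\<bar> < e / 2"
        using d1 d2 s by (auto simp: A_def B_def)
      ultimately show "\<bar>f x - f y\<bar> \<le> (\<Sum>i\<in>Basis. G i) * norm (x - y) + e"
        by linarith
    qed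
  qed
qed

section \<open>The advective derivative of piecewise polynomials\<close>

lemma W1inf_weak_partial:
  assumes "f \<in> W1inf U" "i \<in> Basis"
  shows "weak_partial U i f \<in> Linf U" "is_weak_partial U i f (weak_partial U i f)"
proof -
  have "\<exists>g. g \<in> Linf U \<and> is_weak_partial U i f g" using assms by (auto simp: W1inf_def)
  from someI_ex[OF this]
  show "weak_partial U i f \<in> Linf U" "is_weak_partial U i f (weak_partial U i f)"
    unfolding weak_partial_def by blast+
qed

lemma W1inf_subset:
  assumes "f \<in> W1inf U" "S \<subseteq> U" "S \<in> sets lebesgue" "U \<in> sets lebesgue"
  shows "f \<in> W1inf S"
  unfolding W1inf_def
proof (intro CollectI conjI ballI)
  show "f \<in> Linf S" using assms Linf_subset by (auto simp: W1inf_def)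
  fix i :: 'a assume i: "i \<in> Basis"
  show "\<exists>g\<in>Linf S. is_weak_partial S i f g"
    using W1inf_weak_partial[OF assms(1) i] Linf_subset is_weak_partial_subset assms(2-4) by blast
qed

text \<open>Convexity is asked of the subset K, not of \<Omega>. L comes from bounds on the weak
  partials over all of \<Omega> and so serves every K, whereas the null set may vary with K.\<close>

lemma W1inf_lipschitz:
  fixes f :: "'a::euclidean_space \<Rightarrow> real"
  assumes f: "f \<in> W1inf \<Omega>" and \<Omega>: "\<Omega> \<in> sets lebesgue"
  shows "\<exists>L\<ge>0. \<forall>K. open K \<longrightarrow> convex K \<longrightarrow> bounded K \<longrightarrow> K \<subseteq> \<Omega> \<longrightarrow>
    (\<exists>N. negligible N \<and> (\<forall>x\<in>K - N. \<forall>y\<in>K - N. \<bar>f x - f y\<bar> \<le> L * norm (x - y)))"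
proof -
  let ?g = "\<lambda>i. weak_partial \<Omega> i f"
  have "\<forall>i\<in>Basis. \<exists>G. AE x in lebesgue_on \<Omega>. \<bar>?g i x\<bar> \<le> G"
    using W1inf_weak_partial[OF f] unfolding Linf_iff by blast
  then obtain G where G: "\<And>i. i \<in> Basis \<Longrightarrow> AE x in lebesgue_on \<Omega>. \<bar>?g i x\<bar> \<le> G i" by metis
  show ?thesis
  proof (intro exI[of _ "\<bar>\<Sum>i\<in>Basis. G i\<bar>"] conjI allI impI)
    fix K :: "'a set" assume K: "open K" "convex K" "bounded K" "K \<subseteq> \<Omega>"
    have Ks: "K \<in> sets lebesgue" using K by simp
    have "AE x in lebesgue_on K. \<bar>?g i x\<bar> \<le> G i" if "i \<in> Basis" for i
      using G[OF that] K(4) Ks \<Omega> by (auto simp: AE_restrict_space_iff elim!: eventually_mono)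
    then obtain N where N: "negligible N" "\<forall>x\<in>K - N. \<forall>y\<in>K - N. \<bar>f x - f y\<bar> \<le> (\<Sum>i\<in>Basis. G i) * norm (x - y)"
      using weak_partials_lipschitz[OF K(1-3), of f ?g G] f Linf_subset[OF _ K(4) Ks \<Omega>]
        W1inf_weak_partial[OF f] is_weak_partial_subset[OF _ K(4) Ks \<Omega>]
      by (auto simp: W1inf_def)
    have "(\<Sum>i\<in>Basis. G i) * norm (x - y) \<le> \<bar>\<Sum>i\<in>Basis. G i\<bar> * norm (x - y)" for x y :: 'a
      by (intro mult_right_mono) auto
    then show "\<exists>N. negligible N \<and> (\<forall>x\<in>K - N. \<forall>y\<in>K - N. \<bar>f x - f y\<bar> \<le> \<bar>\<Sum>i\<in>Basis. G i\<bar> * norm (x - y))"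
      using N by (meson order_trans)
  qed auto
qed

text \<open>f x minus the average is the mean of f x - f y over y, and the distance of x and y is at
  most the diameter.\<close>

lemma average_close:
  fixes f :: "'a::euclidean_space \<Rightarrow> real"
  assumes K: "open K" "bounded K" "K \<noteq> {}" and f: "f \<in> Linf K" and L: "L \<ge> 0"
    and N: "negligible N" "\<And>x y. x \<in> K - N \<Longrightarrow> y \<in> K - N \<Longrightarrow> \<bar>f x - f y\<bar> \<le> L * norm (x - y)"
    and x: "x \<in> K - N"
  shows "\<bar>f x - average K f\<bar> \<le> L * diameter K"
proof -
  have Km: "K \<in> lmeasurable" and Ks: "K \<in> sets lebesgue" using K by (auto simp: lmeasurable_open)
  let ?V = "measure lebesgue K"
  have "\<not> negligible K" using open_not_negligible K by blast
  then have V: "?V > 0" using Km by (simp add: negligible_iff_measure zero_less_measure_iff)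
  have fi: "integrable (lebesgue_on K) f" by (rule Linf_integrable[OF Km f])
  have ci: "integrable (lebesgue_on K) (\<lambda>y. c)" for c :: real by (rule Linf_integrable[OF Km Linf_const])
  have mK: "measure (lebesgue_on K) K = ?V" using Ks by (simp add: measure_restrict_space)
  have "f x - average K f = (1 / ?V) * (LINT y|lebesgue_on K. f x - f y)"
    using V by (simp add: average_def Bochner_Integration.integral_diff[OF ci fi] mK field_simps)
  also have "\<bar>\<dots>\<bar> = (1 / ?V) * \<bar>LINT y|lebesgue_on K. f x - f y\<bar>"
    using V by (simp add: abs_mult)
  also have "\<dots> \<le> (1 / ?V) * (LINT y|lebesgue_on K. L * diameter K)"
  proof (intro mult_left_mono order_trans[OF integral_abs_bound integral_mono_AE])
    show "AE y in lebesgue_on K. \<bar>f x - f y\<bar> \<le> L * diameter K"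
    proof (rule AE_lebesgue_onI[OF N(1) Ks])
      fix y assume y: "y \<in> K - N"
      have "norm (x - y) \<le> diameter K" using diameter_bounded_bound[OF K(2)] x y by (auto simp: dist_norm)
      then show "\<bar>f x - f y\<bar> \<le> L * diameter K"
        using N(2)[OF x y] L by (meson mult_left_mono order_trans)
    qed
  qed (use V fi ci in auto)
  also have "\<dots> = L * diameter K" using V by (simp add: mK)
  finally show ?thesis .
qed

lemma poly_mult_test_function:
  assumes "poly_le m p" "\<phi> \<in> test_functions U"
  shows "(\<lambda>x. p x * \<phi> x) \<in> test_functions U"
proof -
  have s: "{x. p x * \<phi> x \<noteq> 0} \<subseteq> {x. \<phi> x \<noteq> 0}" by auto
  have \<phi>: "\<And>k. C_k k \<phi>" "bounded {x. \<phi> x \<noteq> 0}" "closure {x. \<phi> x \<noteq> 0} \<subseteq> U"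
    using assms(2) unfolding test_functions_def compact_closure by blast+
  have "bounded {x. p x * \<phi> x \<noteq> 0}" by (rule bounded_subset[OF \<phi>(2) s])
  moreover have "closure {x. p x * \<phi> x \<noteq> 0} \<subseteq> U" using closure_mono[OF s] \<phi>(3) by blast
  ultimately show ?thesis
    unfolding test_functions_def compact_closure
    using C_k_mult[OF poly_le_C_k[OF assms(1)] \<phi>(1)] by blast
qed

text \<open>Integration by parts for the divergence of p \<phi> b: the weak partial of each
  component of b is tested with p \<phi>, which is again a test function, and the results are summed
  over the coordinates.\<close>

lemma adv_integral_identity:
  fixes p :: "'a::euclidean_space \<Rightarrow> real" and b :: "'a \<Rightarrow> 'a"
  assumes U: "open U" "bounded U" and b: "\<And>i. i \<in> Basis \<Longrightarrow> (\<lambda>x. b x \<bullet> i) \<in> Linf U"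
    and d: "\<And>i. i \<in> Basis \<Longrightarrow> d i \<in> Linf U" "\<And>i. i \<in> Basis \<Longrightarrow> is_weak_partial U i (\<lambda>x. b x \<bullet> i) (d i)"
    and p: "poly_le m p" and \<phi>: "\<phi> \<in> test_functions U"
  shows "(LINT x|lebesgue_on U. frechet_derivative p (at x) (b x) * \<phi> x)
    = - (LINT x|lebesgue_on U. p x * (frechet_derivative \<phi> (at x) (b x) + \<phi> x * (\<Sum>i\<in>Basis. d i x)))"
proof -
  have Um: "U \<in> lmeasurable" using U by (auto simp: lmeasurable_open)
  let ?p = "\<lambda>i x. frechet_derivative p (at x) i" and ?\<phi> = "\<lambda>i x. frechet_derivative \<phi> (at x) i"
  note L = Linf_mult Linf_add Linf_sum Linf_poly[OF p U(2)] Linf_poly[OF poly_le_frechet_derivative[OF p] U(2)]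
    Linf_test_function[OF \<phi>] b d(1)
  have pd: "p differentiable (at x)" and \<phi>d: "\<phi> differentiable (at x)" for x
    using poly_le_differentiable[OF p] test_function_has_derivative[OF \<phi>] differentiable_def by blast+
  have eq: "frechet_derivative p (at x) (b x) = (\<Sum>i\<in>Basis. (b x \<bullet> i) * ?p i x)"
    "frechet_derivative \<phi> (at x) (b x) = (\<Sum>i\<in>Basis. (b x \<bullet> i) * ?\<phi> i x)" for x
    by (rule frechet_derivative_basis[OF pd], rule frechet_derivative_basis[OF \<phi>d])
  have part: "(LINT x|lebesgue_on U. d i x * (p x * \<phi> x) + (b x \<bullet> i) * (p x * ?\<phi> i x + ?p i x * \<phi> x)) = 0"
    if i: "i \<in> Basis" for i
  proof -
    have "frechet_derivative (\<lambda>x. p x * \<phi> x) (at x) i = p x * ?\<phi> i x + ?p i x * \<phi> x" for x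
      by (rule fun_cong[OF frechet_derivative_at[OF has_derivative_mult[OF
        pd[of x, unfolded frechet_derivative_works] \<phi>d[of x, unfolded frechet_derivative_works]]], symmetric])
    then have "(LINT x|lebesgue_on U. d i x * (p x * \<phi> x)) = - (LINT x|lebesgue_on U. (b x \<bullet> i) * (p x * ?\<phi> i x + ?p i x * \<phi> x))"
      using d(2)[OF i] poly_mult_test_function[OF p \<phi>] by (simp add: is_weak_partial_def)
    then show ?thesis
      by (subst Bochner_Integration.integral_add) (auto intro!: Linf_integrable[OF Um] L i)
  qed
  have A: "(\<lambda>x. frechet_derivative p (at x) (b x) * \<phi> x) \<in> Linf U"
    "(\<lambda>x. p x * (frechet_derivative \<phi> (at x) (b x) + \<phi> x * (\<Sum>i\<in>Basis. d i x))) \<in> Linf U"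
    unfolding eq by (auto intro!: L)
  have "(LINT x|lebesgue_on U. frechet_derivative p (at x) (b x) * \<phi> x)
    + (LINT x|lebesgue_on U. p x * (frechet_derivative \<phi> (at x) (b x) + \<phi> x * (\<Sum>i\<in>Basis. d i x)))
    = (LINT x|lebesgue_on U. frechet_derivative p (at x) (b x) * \<phi> x
       + p x * (frechet_derivative \<phi> (at x) (b x) + \<phi> x * (\<Sum>i\<in>Basis. d i x)))"
    by (rule Bochner_Integration.integral_add[symmetric]; rule Linf_integrable[OF Um A(1)] Linf_integrable[OF Um A(2)])
  also have "\<dots> = (LINT x|lebesgue_on U. (\<Sum>i\<in>Basis. d i x * (p x * \<phi> x) + (b x \<bullet> i) * (p x * ?\<phi> i x + ?p i x * \<phi> x)))"
    unfolding eq by (simp add: sum.distrib sum_distrib_left sum_distrib_right algebra_simps)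
  also have "\<dots> = (\<Sum>i\<in>Basis. LINT x|lebesgue_on U. d i x * (p x * \<phi> x) + (b x \<bullet> i) * (p x * ?\<phi> i x + ?p i x * \<phi> x))"
    by (rule Bochner_Integration.integral_sum) (auto intro!: Linf_integrable[OF Um] L)
  also have "\<dots> = 0" using part by simp
  finally show ?thesis by simp
qed

section \<open>Square-integrable functions\<close>

lemma L2_integrable:
  assumes "U \<in> lmeasurable" "f \<in> L2 U"
  shows "integrable (lebesgue_on U) f"
proof (rule Bochner_Integration.integrable_bound)
  show "integrable (lebesgue_on U) (\<lambda>x. 1 + (f x)\<^sup>2)"
    using assms Linf_integrable[OF assms(1) Linf_const, of 1] by (auto simp: L2_def)
  have "\<bar>t\<bar> \<le> 1 + t\<^sup>2" for t :: real
    using zero_le_power2[of "\<bar>t\<bar> - 1"] by (auto simp: power2_eq_square algebra_simps abs_if split: if_splits)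
  then show "AE x in lebesgue_on U. norm (f x) \<le> norm (1 + (f x)\<^sup>2)" by (intro AE_I2) auto
qed (use assms in \<open>auto simp: L2_def\<close>)

lemma Linf_imp_L2:
  assumes "U \<in> lmeasurable" "f \<in> Linf U"
  shows "f \<in> L2 U"
  using Linf_integrable[OF assms(1) Linf_mult[OF assms(2,2)]] Linf_measurable[OF assms(2)]
  by (simp add: L2_def power2_eq_square)

lemma L2_add:
  assumes "f \<in> L2 U" "g \<in> L2 U"
  shows "(\<lambda>x. f x + g x) \<in> L2 U"
proof -
  have "integrable (lebesgue_on U) (\<lambda>x. (f x + g x)\<^sup>2)"
  proof (rule Bochner_Integration.integrable_bound)
    show "integrable (lebesgue_on U) (\<lambda>x. 2 * (f x)\<^sup>2 + 2 * (g x)\<^sup>2)" using assms by (auto simp: L2_def)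
    have "(s + t)\<^sup>2 \<le> 2 * s\<^sup>2 + 2 * t\<^sup>2" for s t :: real
      using zero_le_power2[of "s - t"] by (auto simp: power2_eq_square algebra_simps)
    then show "AE x in lebesgue_on U. norm ((f x + g x)\<^sup>2) \<le> norm (2 * (f x)\<^sup>2 + 2 * (g x)\<^sup>2)"
      by (intro AE_I2) auto
  qed (use assms in \<open>auto simp: L2_def\<close>)
  then show ?thesis using assms by (auto simp: L2_def)
qed

lemma L2_Linf_mult:
  assumes "f \<in> L2 U" "c \<in> Linf U"
  shows "(\<lambda>x. c x * f x) \<in> L2 U"
proof -
  obtain B where B: "AE x in lebesgue_on U. \<bar>c x\<bar> \<le> B" using assms(2) by (auto simp: Linf_iff)
  have m: "c \<in> borel_measurable (lebesgue_on U)" using assms(2) by (rule Linf_measurable)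
  have "integrable (lebesgue_on U) (\<lambda>x. (c x * f x)\<^sup>2)"
  proof (rule Bochner_Integration.integrable_bound)
    show "integrable (lebesgue_on U) (\<lambda>x. B\<^sup>2 * (f x)\<^sup>2)" using assms by (auto simp: L2_def)
    show "AE x in lebesgue_on U. norm ((c x * f x)\<^sup>2) \<le> norm (B\<^sup>2 * (f x)\<^sup>2)"
      using B by eventually_elim (auto simp: power_mult_distrib abs_le_square_iff[symmetric] intro!: mult_right_mono)
  qed (use assms m in \<open>auto simp: L2_def\<close>)
  then show ?thesis using assms m by (auto simp: L2_def)
qed

lemma L2_diff: "f \<in> L2 U \<Longrightarrow> g \<in> L2 U \<Longrightarrow> (\<lambda>x. f x - g x) \<in> L2 U"
  using L2_add[of f U "\<lambda>x. (-1) * g x"] L2_Linf_mult[of g U "\<lambda>x. -1"] Linf_const by fastforce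

lemma L2_mult_integrable:
  assumes "f \<in> L2 U" "g \<in> L2 U"
  shows "integrable (lebesgue_on U) (\<lambda>x. f x * g x)"
proof (rule Bochner_Integration.integrable_bound)
  show "integrable (lebesgue_on U) (\<lambda>x. (f x)\<^sup>2 + (g x)\<^sup>2)" using assms by (auto simp: L2_def)
  have "\<bar>s * t\<bar> \<le> s\<^sup>2 + t\<^sup>2" for s t :: real
    using zero_le_power2[of "s - t"] zero_le_power2[of "s + t"] by (auto simp: power2_eq_square algebra_simps abs_if)
  then show "AE x in lebesgue_on U. norm (f x * g x) \<le> norm ((f x)\<^sup>2 + (g x)\<^sup>2)" by (intro AE_I2) auto
qed (use assms in \<open>auto simp: L2_def\<close>)

lemma L2_subset:
  assumes "f \<in> L2 U" "S \<subseteq> U" "S \<in> sets lebesgue" "U \<in> sets lebesgue"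
  shows "f \<in> L2 S"
  using assms integrable_lebesgue_on_subset[of U "\<lambda>x. (f x)\<^sup>2" S] by (auto simp: L2_def intro: measurable_restrict_mono)

section \<open>Classical and distributional derivatives along b\<close>

text \<open>The difference of g and the classical derivative is orthogonal to all test functions.
  The partials d are a parameter instead of \<open>weak_partial U\<close>, because on a subset the
  divergence occurring in \<open>adv\<close> is still the one chosen on the larger domain.\<close>

lemma advection_unique:
  fixes b :: "'a::euclidean_space \<Rightarrow> 'a"
  assumes U: "open U" "bounded U" and b: "\<And>i. i \<in> Basis \<Longrightarrow> (\<lambda>x. b x \<bullet> i) \<in> Linf U"
    and d: "\<And>i. i \<in> Basis \<Longrightarrow> d i \<in> Linf U" "\<And>i. i \<in> Basis \<Longrightarrow> is_weak_partial U i (\<lambda>x. b x \<bullet> i) (d i)"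
    and p: "poly_le m p" and u: "\<And>x. x \<in> U \<Longrightarrow> u x = p x" and g: "g \<in> L2 U"
    and adv: "\<And>\<phi>. \<phi> \<in> test_functions U \<Longrightarrow> (LINT x|lebesgue_on U. g x * \<phi> x)
      = - (LINT x|lebesgue_on U. u x * (frechet_derivative \<phi> (at x) (b x) + \<phi> x * (\<Sum>i\<in>Basis. d i x)))"
  shows "AE x in lebesgue_on U. g x = frechet_derivative p (at x) (b x)"
proof -
  have Um: "U \<in> lmeasurable" using U by (auto simp: lmeasurable_open)
  have "frechet_derivative p (at x) (b x) = (\<Sum>i\<in>Basis. (b x \<bullet> i) * frechet_derivative p (at x) i)" for x
    by (rule frechet_derivative_basis[OF poly_le_differentiable[OF p]])
  then have P: "(\<lambda>x. frechet_derivative p (at x) (b x)) \<in> Linf U"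
    by (auto intro!: Linf_sum Linf_mult b Linf_poly[OF poly_le_frechet_derivative[OF p] U(2)])
  have Pi: "integrable (lebesgue_on U) (\<lambda>x. frechet_derivative p (at x) (b x) * \<phi> x)" "integrable (lebesgue_on U) (\<lambda>x. g x * \<phi> x)"
    if "\<phi> \<in> test_functions U" for \<phi>
    using L2_mult_integrable[OF g Linf_imp_L2[OF Um Linf_test_function(1)[OF that]]]
      Linf_integrable[OF Um Linf_mult[OF P Linf_test_function(1)[OF that]]] by auto
  have "AE x in lebesgue_on U. g x - frechet_derivative p (at x) (b x) = 0"
  proof (rule fundamental_lemma[OF U(1)])
    show "integrable (lebesgue_on U) (\<lambda>x. g x - frechet_derivative p (at x) (b x))"
      using L2_integrable[OF Um g] Linf_integrable[OF Um P] by (rule Bochner_Integration.integrable_diff)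
    fix \<phi> assume \<phi>: "\<phi> \<in> test_functions U"
    have "(LINT x|lebesgue_on U. u x * (frechet_derivative \<phi> (at x) (b x) + \<phi> x * (\<Sum>i\<in>Basis. d i x)))
      = (LINT x|lebesgue_on U. p x * (frechet_derivative \<phi> (at x) (b x) + \<phi> x * (\<Sum>i\<in>Basis. d i x)))"
      using u by (intro Bochner_Integration.integral_cong) auto
    then have "(LINT x|lebesgue_on U. g x * \<phi> x) = (LINT x|lebesgue_on U. frechet_derivative p (at x) (b x) * \<phi> x)"
      using adv[OF \<phi>] adv_integral_identity[OF U b d p \<phi>] by simp
    then show "(LINT x|lebesgue_on U. (g x - frechet_derivative p (at x) (b x)) * \<phi> x) = 0"
      using Pi[OF \<phi>] by (simp add: left_diff_distrib)
  qed
  then show ?thesis by eventually_elim auto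
qed

lemma W1inf_div_facts:
  assumes "b \<in> W1inf_div U" "i \<in> Basis"
  shows "(\<lambda>x. b x \<bullet> i) \<in> W1inf U" "(\<lambda>x. b x \<bullet> i) \<in> Linf U" "weak_partial U i (\<lambda>x. b x \<bullet> i) \<in> Linf U"
    "is_weak_partial U i (\<lambda>x. b x \<bullet> i) (weak_partial U i (\<lambda>x. b x \<bullet> i))"
    "weak_div U b \<in> W1inf U" "weak_div U b \<in> Linf U"
proof -
  show b: "(\<lambda>x. b x \<bullet> i) \<in> W1inf U" and "weak_div U b \<in> W1inf U"
    using assms by (auto simp: W1inf_div_def)
  then show "(\<lambda>x. b x \<bullet> i) \<in> Linf U" "weak_div U b \<in> Linf U" by (auto simp: W1inf_def)
  show "weak_partial U i (\<lambda>x. b x \<bullet> i) \<in> Linf U"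
    "is_weak_partial U i (\<lambda>x. b x \<bullet> i) (weak_partial U i (\<lambda>x. b x \<bullet> i))"
    by (rule W1inf_weak_partial[OF b assms(2)])+
qed

text \<open>The classical derivative is a member of the set from which \<open>adv\<close> chooses,
  so the choice is genuine; uniqueness then identifies it almost everywhere.\<close>

lemma adv_poly:
  fixes b :: "'a::euclidean_space \<Rightarrow> 'a"
  assumes U: "open U" "bounded U" and b: "\<And>i. i \<in> Basis \<Longrightarrow> (\<lambda>x. b x \<bullet> i) \<in> W1inf U"
    and p: "poly_le m p" and u: "\<And>x. x \<in> U \<Longrightarrow> u x = p x"
  shows "adv U b u \<in> L2 U" "AE x in lebesgue_on U. adv U b u x = frechet_derivative p (at x) (b x)"
proof -
  have Um: "U \<in> lmeasurable" using U by (auto simp: lmeasurable_open)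
  let ?d = "\<lambda>i. weak_partial U i (\<lambda>y. b y \<bullet> i)"
  have bL: "(\<lambda>x. b x \<bullet> i) \<in> Linf U" if "i \<in> Basis" for i using b[OF that] by (simp add: W1inf_def)
  have d: "\<And>i. i \<in> Basis \<Longrightarrow> ?d i \<in> Linf U" "\<And>i. i \<in> Basis \<Longrightarrow> is_weak_partial U i (\<lambda>x. b x \<bullet> i) (?d i)"
    using W1inf_weak_partial[OF b] by auto
  have "frechet_derivative p (at x) (b x) = (\<Sum>i\<in>Basis. (b x \<bullet> i) * frechet_derivative p (at x) i)" for x
    by (rule frechet_derivative_basis[OF poly_le_differentiable[OF p]])
  then have "(\<lambda>x. frechet_derivative p (at x) (b x)) \<in> L2 U"
    by (auto intro!: Linf_imp_L2[OF Um] Linf_sum Linf_mult bL Linf_poly[OF poly_le_frechet_derivative[OF p] U(2)])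
  moreover have "is_adv U b u (\<lambda>x. frechet_derivative p (at x) (b x))"
    unfolding is_adv_def weak_div_def
  proof
    fix \<phi> assume \<phi>: "\<phi> \<in> test_functions U"
    have "(LINT x|lebesgue_on U. u x * (frechet_derivative \<phi> (at x) (b x) + \<phi> x * (\<Sum>i\<in>Basis. ?d i x)))
      = (LINT x|lebesgue_on U. p x * (frechet_derivative \<phi> (at x) (b x) + \<phi> x * (\<Sum>i\<in>Basis. ?d i x)))"
      using u by (intro Bochner_Integration.integral_cong) auto
    then show "(LINT x|lebesgue_on U. frechet_derivative p (at x) (b x) * \<phi> x) =
        - (LINT x|lebesgue_on U. u x * (frechet_derivative \<phi> (at x) (b x) + \<phi> x * (\<Sum>i\<in>Basis. ?d i x)))"
      using adv_integral_identity[OF U bL d p \<phi>] by simp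
  qed
  ultimately have "\<exists>g. g \<in> L2 U \<and> is_adv U b u g" by blast
  from someI_ex[OF this] have *: "adv U b u \<in> L2 U" "is_adv U b u (adv U b u)"
    unfolding adv_def by blast+
  then show "adv U b u \<in> L2 U" by simp
  show "AE x in lebesgue_on U. adv U b u x = frechet_derivative p (at x) (b x)"
    by (rule advection_unique[OF U bL d p u *(1)]) (use *(2) in \<open>auto simp: is_adv_def weak_div_def\<close>)
qed

lemma H_adv_adv:
  assumes "w \<in> H_adv U b"
  shows "adv U b w \<in> L2 U" "is_adv U b w (adv U b w)"
proof -
  have "\<exists>g. g \<in> L2 U \<and> is_adv U b w g" using assms by (auto simp: H_adv_def)
  from someI_ex[OF this] show "adv U b w \<in> L2 U" "is_adv U b w (adv U b w)"
    unfolding adv_def by blast+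
qed

text \<open>w is polynomial only piecewise, so its derivative along b is a global choice on U.
  Testing it with functions supported in K shows that on K it is the classical derivative of the
  local polynomial.\<close>

lemma adv_on_subset:
  fixes b :: "'a::euclidean_space \<Rightarrow> 'a"
  assumes U: "open U" and b: "b \<in> W1inf_div U" and w: "w \<in> H_adv U b"
    and K: "open K" "bounded K" "K \<subseteq> U" and p: "poly_le m p" and u: "\<And>x. x \<in> K \<Longrightarrow> w x = p x"
  shows "AE x in lebesgue_on K. adv U b w x = frechet_derivative p (at x) (b x)"
proof (rule advection_unique[OF K(1,2)])
  have s: "U \<in> sets lebesgue" "K \<in> sets lebesgue" using U K by auto
  let ?d = "\<lambda>i. weak_partial U i (\<lambda>y. b y \<bullet> i)"
  show "(\<lambda>x. b x \<bullet> i) \<in> Linf K" "?d i \<in> Linf K" if "i \<in> Basis" for i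
    using W1inf_div_facts[OF b that] Linf_subset K s by blast+
  show "is_weak_partial K i (\<lambda>x. b x \<bullet> i) (?d i)" if "i \<in> Basis" for i
    using W1inf_div_facts[OF b that] is_weak_partial_subset K s by blast
  show "adv U b w \<in> L2 K" using H_adv_adv(1)[OF w] L2_subset K s by blast
  fix \<phi> assume \<phi>: "\<phi> \<in> test_functions K"
  then have c: "closure {x. \<phi> x \<noteq> 0} \<subseteq> K" by (simp add: test_functions_def)
  have z: "\<phi> x = 0" "frechet_derivative \<phi> (at x) v = 0" if "x \<in> U - K" for x v
    using test_function_0[OF \<phi>, of x] c that by blast+
  have "(LINT x|lebesgue_on U. adv U b w x * \<phi> x) = - (LINT x|lebesgue_on U. w x * (frechet_derivative \<phi> (at x) (b x) + \<phi> x * weak_div U b x))"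
    using H_adv_adv(2)[OF w] test_functions_mono[OF \<phi> K(3)] by (simp add: is_adv_def)
  moreover have "(LINT x|lebesgue_on U. adv U b w x * \<phi> x) = (LINT x|lebesgue_on K. adv U b w x * \<phi> x)"
    by (rule integral_lebesgue_on_subset[OF K(3) s(2,1)]) (simp only: z mult_zero_right)
  moreover have "(LINT x|lebesgue_on U. w x * (frechet_derivative \<phi> (at x) (b x) + \<phi> x * weak_div U b x))
    = (LINT x|lebesgue_on K. w x * (frechet_derivative \<phi> (at x) (b x) + \<phi> x * weak_div U b x))"
    by (rule integral_lebesgue_on_subset[OF K(3) s(2,1)]) (simp only: z mult_zero_right mult_zero_left add_0_right)
  ultimately show "(LINT x|lebesgue_on K. adv U b w x * \<phi> x)
      = - (LINT x|lebesgue_on K. w x * (frechet_derivative \<phi> (at x) (b x) + \<phi> x * (\<Sum>i\<in>Basis. ?d i x)))"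
    by (simp add: weak_div_def)
qed (use p u in auto)

section \<open>Geometry of the elements\<close>

lemma open_simplex_facts:
  fixes K :: "'a::euclidean_space set"
  assumes "open_simplex K"
  shows "open K" "convex K" "bounded K" "K \<noteq> {}" "polytope (closure K)" "interior (closure K) = K"
    "negligible (closure K - K)"
proof -
  obtain S where S: "int DIM('a) simplex S" and K: "K = interior S" using assms by (auto simp: open_simplex_def)
  have pS: "polytope S" by (rule simplex_imp_polytope[OF S])
  have cS: "convex S" "compact S" using pS polytope_imp_convex polytope_imp_compact by blast+
  have "rel_interior S = interior S" using aff_dim_simplex[OF S] by (rule interior_rel_interior)
  moreover have "S \<noteq> {}" using aff_dim_simplex[OF S] by auto
  ultimately have ne: "interior S \<noteq> {}" using cS rel_interior_eq_empty by metis
  then have cl: "closure K = S" using convex_closure_interior[OF cS(1)] cS(2) K by (simp add: compact_imp_closed)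
  show "open K" "K \<noteq> {}" "interior (closure K) = K" "polytope (closure K)"
    using K ne cl pS by auto
  show "convex K" using cS K by auto
  then have "negligible (frontier K)" by (rule negligible_convex_frontier)
  then show "negligible (closure K - K)" by (simp add: frontier_def interior_open[OF \<open>open K\<close>])
  show "bounded K" using cS(2) K compact_imp_bounded bounded_interior by blast
qed

section \<open>Inscribed balls\<close>

lemma shape_param_nonneg: "bounded K \<Longrightarrow> shape_param (K :: 'a::euclidean_space set) \<ge> 0"
  unfolding shape_param_def
proof (intro divide_nonneg_nonneg diameter_ge_0)
  assume K: "bounded K"
  have "bdd_above {diameter (ball x r) |x r. ball x r \<subseteq> K}"
    using diameter_subset[OF _ K] by (intro bdd_aboveI[of _ "diameter K"]) (auto simp del: diameter_ball)
  \<comment> \<open>Radii are not restricted in the definition: the empty ball of radius -1 puts 0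
    into the set, so the supremum is nonnegative whatever K is.\<close>
  moreover have "0 \<in> {diameter (ball x r) |x r. ball x r \<subseteq> K}"
  proof -
    have e: "ball (0::'a) (-1) = {}" by simp
    have "0 = diameter (ball (0::'a) (-1)) \<and> ball (0::'a) (-1) \<subseteq> K" unfolding e by simp
    then show ?thesis by blast
  qed
  ultimately show "0 \<le> Sup {diameter (ball x r) |x r. ball x r \<subseteq> K}" by (rule cSup_upper[rotated])
qed

text \<open>The supremum in \<open>shape_param\<close> need not be attained, so a ball whose
  diameter exceeds half of it is taken. A diameter being twice a radius accounts for the other half
  of the factor 4.\<close>

lemma inscribed_ball:
  fixes K :: "'a::euclidean_space set"
  assumes K: "open K" "bounded K" "K \<noteq> {}" and \<rho>: "shape_param K \<le> \<rho>"
  shows "\<exists>x r. r > 0 \<and> ball x r \<subseteq> K \<and> diameter K \<le> 4 * \<rho> * r"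
proof -
  define A where "A = {diameter (ball x r) |x r. ball x r \<subseteq> K}"
  have bdd: "bdd_above A"
    unfolding A_def using diameter_subset[OF _ K(2)]
    by (intro bdd_aboveI[of _ "diameter K"]) (auto simp del: diameter_ball)
  obtain z s where z: "s > 0" "ball z s \<subseteq> K" using K open_contains_ball by blast
  then have "diameter (ball z s) \<in> A" unfolding A_def by blast
  then have S: "Sup A > 0" using z cSup_upper[OF _ bdd] by fastforce
  have ne: "A \<noteq> {}" using \<open>_ \<in> A\<close> by auto
  obtain t where "t \<in> A" "Sup A / 2 < t" using less_cSup_iff[OF ne bdd, of "Sup A / 2"] S by auto
  then obtain x r where r: "ball x r \<subseteq> K" "Sup A / 2 < diameter (ball x r)" by (auto simp: A_def)
  have r0: "r > 0" using r S by (auto split: if_splits simp del: zero_less_divide_iff)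
  have SA: "Sup A \<le> 4 * r" using r r0 by auto
  have "shape_param K = diameter K / Sup A" by (simp add: shape_param_def A_def)
  then have "diameter K \<le> \<rho> * Sup A" using \<rho> S by (simp add: divide_le_eq)
  also have "\<rho> \<ge> 0" using shape_param_nonneg[OF K(2)] \<rho> by simp
  then have "\<rho> * Sup A \<le> \<rho> * (4 * r)" by (intro mult_left_mono SA)
  finally show ?thesis using r r0 by (intro exI[of _ x] exI[of _ r]) auto
qed

section \<open>Facets and the upwind projection\<close>

text \<open>\<open>face_normal\<close> is a definite description, so uniqueness has to be proved.
  The hyperplane of a facet fixes its unit normal up to sign, and the opposite sign would force all
  of K into that hyperplane.\<close>

lemma facet_normal:
  fixes K :: "'a::euclidean_space set"
  assumes K: "open_simplex K" and F: "F facet_of closure K"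
  shows "is_face_normal K F (face_normal K F)"
    "\<exists>a. (\<forall>x\<in>closure K. x \<bullet> face_normal K F \<le> a) \<and> affine hull F = {x. x \<bullet> face_normal K F = a} \<and> F = closure K \<inter> {x. x \<bullet> face_normal K F = a}"
proof -
  note Kf = open_simplex_facts[OF K]
  have Fne: "F \<noteq> {}" and Fs: "F \<subseteq> closure K" using F facet_of_imp_subset[OF F] unfolding facet_of_def by blast+
  have "aff_dim (closure K) = DIM('a)"
    using Kf by (intro aff_dim_nonempty_interior) simp
  then have dimF: "aff_dim F = DIM('a) - 1" using F by (simp add: facet_of_def)
  obtain n b where n: "n \<noteq> 0" "closure K \<subseteq> {x. n \<bullet> x \<le> b}" "F = closure K \<inter> {x. n \<bullet> x = b}"
    using facet_of_polyhedron[OF polytope_imp_polyhedron[OF Kf(5)] F] by blast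
  define \<nu> where "\<nu> = n /\<^sub>R norm n"
  have \<nu>: "norm \<nu> = 1" "\<forall>x\<in>closure K. x \<bullet> \<nu> \<le> b / norm n" "F = closure K \<inter> {x. x \<bullet> \<nu> = b / norm n}"
    using n by (auto simp: \<nu>_def inner_commute field_simps)
  then have is\<nu>: "is_face_normal K F \<nu>" unfolding is_face_normal_def by blast
  have hull: "affine hull F = {x. x \<bullet> \<nu> = a}" if "norm \<nu> = 1" "\<forall>x\<in>F. x \<bullet> \<nu> = a" for \<nu> a
  proof (rule affine_dim_equal)
    have "\<nu> \<noteq> 0" using that by auto
    then have "aff_dim {x. \<nu> \<bullet> x = a} = DIM('a) - 1" by (rule aff_dim_hyperplane)
    then show "aff_dim (affine hull F) = aff_dim {x. x \<bullet> \<nu> = a}" using dimF by (simp add: inner_commute)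
    show "affine {x. x \<bullet> \<nu> = a}" using affine_hyperplane[of \<nu> a] by (simp add: inner_commute)
    then show "affine hull F \<subseteq> {x. x \<bullet> \<nu> = a}" using that by (intro hull_minimal) auto
  qed (use Fne in auto)
  have uniq: "\<mu> = \<nu>" if \<mu>: "is_face_normal K F \<mu>" for \<mu>
  proof -
    obtain a where a: "norm \<mu> = 1" "\<forall>x\<in>closure K. x \<bullet> \<mu> \<le> a" "\<forall>x\<in>F. x \<bullet> \<mu> = a"
      using \<mu> by (auto simp: is_face_normal_def)
    define b' where "b' = b / norm n"
    have eq: "{x. x \<bullet> \<nu> = b'} = {x. x \<bullet> \<mu> = a}" using hull[OF \<nu>(1), of b'] hull[OF a(1,3)] \<nu>(3) b'_def by auto
    obtain p where p: "p \<in> F" using Fne by blast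
    \<comment> \<open>v is the part of \<mu> tangential to the hyperplane. Moving along it stays in
      the hyperplane, so \<mu> is orthogonal to v, and therefore v = 0.\<close>
    define v where "v = \<mu> - (\<mu> \<bullet> \<nu>) *\<^sub>R \<nu>"
    have vn: "v \<bullet> \<nu> = 0" using \<nu>(1) by (simp add: v_def inner_diff_left norm_eq_1)
    have "p + v \<in> {x. x \<bullet> \<nu> = b'}" using p \<nu>(3) vn b'_def by (auto simp: inner_add_left)
    then have "v \<bullet> \<mu> = 0" using eq p a by (auto simp: inner_add_left)
    then have "v \<bullet> (\<mu> - (\<mu> \<bullet> \<nu>) *\<^sub>R \<nu>) = 0" using vn by (simp add: inner_diff_right)
    then have "v \<bullet> v = 0" unfolding v_def[symmetric] .
    then have m: "\<mu> = (\<mu> \<bullet> \<nu>) *\<^sub>R \<nu>" by (simp add: v_def)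
    then have "\<bar>\<mu> \<bullet> \<nu>\<bar> = 1" using a(1) \<nu>(1) by (metis mult.right_neutral norm_scaleR)
    then consider "\<mu> \<bullet> \<nu> = 1" | "\<mu> \<bullet> \<nu> = -1" by linarith
    then show ?thesis
    proof cases
      case 1 then show ?thesis using m by simp
    next
      case 2
      then have m': "\<mu> = - \<nu>" using m by simp
      obtain z s where z: "s > 0" "ball z s \<subseteq> K" using Kf open_contains_ball by blast
      have c: "x \<bullet> \<nu> = b'" if "x \<in> ball z s" for x
      proof -
        have x: "x \<in> closure K" using that z(2) closure_subset[of K] by blast
        have "a = - b'" using p a(3) \<nu>(3) m' b'_def by auto
        moreover have "x \<bullet> \<nu> \<le> b'" "x \<bullet> \<mu> \<le> a" using x \<nu>(2) a(2) b'_def by auto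
        ultimately show ?thesis by (simp add: m')
      qed
      have "z \<in> ball z s" "z + (s / 2) *\<^sub>R \<nu> \<in> ball z s" using z \<nu>(1) by (auto simp: dist_norm)
      then have "(s / 2) * (\<nu> \<bullet> \<nu>) = 0" using c by (metis add_cancel_right_right inner_add_left inner_scaleR_left)
      then show ?thesis using z \<nu>(1) by (simp add: norm_eq_1)
    qed
  qed
  have "face_normal K F = \<nu>" unfolding face_normal_def using is\<nu> uniq by (rule the_equality)
  then show "is_face_normal K F (face_normal K F)"
    "\<exists>a. (\<forall>x\<in>closure K. x \<bullet> face_normal K F \<le> a) \<and> affine hull F = {x. x \<bullet> face_normal K F = a} \<and> F = closure K \<inter> {x. x \<bullet> face_normal K F = a}"
    using is\<nu> \<nu> hull[OF \<nu>(1), of "b / norm n"] by auto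
qed

text \<open>The ray from the centre of an inscribed ball in direction \<open>-e\<close> leaves K through an inflow
  facet, and the whole ball lies on the inner side of that facet.\<close>

lemma inflow_facet:
  fixes K :: "'a::euclidean_space set"
  assumes K: "open_simplex K" and e: "norm e = 1" and r: "r > 0" "ball x r \<subseteq> K"
  shows "\<exists>G. G facet_of closure K \<and> e \<bullet> face_normal K G < 0 \<and> r \<le> \<bar>e \<bullet> face_normal K G\<bar> * diameter K"
proof -
  note Kf = open_simplex_facts[OF K]
  have xK: "x \<in> K" using r by auto
  have b: "bounded (closure K)" using Kf(3) by (rule bounded_closure)
  have i: "x \<in> interior (closure K)" using xK Kf(6) by simp
  have "- e \<noteq> 0" using e by auto
  then obtain d where d: "d > 0" "x + d *\<^sub>R (- e) \<in> frontier (closure K)"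
    by (rule ray_to_frontier[OF b i]) blast
  define y where "y = x + d *\<^sub>R (- e)"
  have "closure K - rel_interior (closure K) = \<Union>{F. F facet_of closure K}"
    by (rule rel_boundary_of_polyhedron[OF polytope_imp_polyhedron[OF Kf(5)]])
  moreover have "rel_interior (closure K) = K"
    using Kf(4,6) by (simp add: rel_interior_nonempty_interior)
  moreover have yc: "y \<in> closure K" "y \<notin> K"
    using d(2) Kf(6) by (auto simp: frontier_def y_def)
  ultimately obtain G where G: "G facet_of closure K" "y \<in> G" by blast
  define \<nu> where "\<nu> = face_normal K G"
  obtain a where a: "\<forall>x\<in>closure K. x \<bullet> \<nu> \<le> a" "G = closure K \<inter> {x. x \<bullet> \<nu> = a}"
    using facet_normal(2)[OF K G(1)] \<nu>_def by blast
  have \<nu>: "norm \<nu> = 1" using facet_normal(1)[OF K G(1)] by (simp add: is_face_normal_def \<nu>_def)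
  have "x \<bullet> \<nu> + s \<le> a" if "0 < s" "s < r" for s
  proof -
    have "x + s *\<^sub>R \<nu> \<in> ball x r" using that \<nu> by (simp add: dist_norm)
    then have "(x + s *\<^sub>R \<nu>) \<bullet> \<nu> \<le> a" using a(1) r(2) closure_subset[of K] by blast
    then show ?thesis using \<nu> by (simp add: inner_add_left norm_eq_1)
  qed
  then have "r \<le> a - x \<bullet> \<nu>" by (intro dense_le_bounded[of 0 r]) (use r in \<open>auto simp: algebra_simps\<close>)
  moreover have "y \<bullet> \<nu> = a" using G(2) a(2) by auto
  \<comment> \<open>The hyperplane is at distance at least r from x, and the ray reaches it after
    the length d, at which the distance covered is d times the cosine between e and the
    normal.\<close>
  ultimately have rd: "r \<le> - d * (e \<bullet> \<nu>)" by (simp add: y_def inner_diff_left)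
  then have neg: "e \<bullet> \<nu> < 0" using d r by (smt (verit) mult_minus_left mult_nonneg_nonneg)
  have "d = dist x y" using d e by (simp add: y_def dist_norm)
  also have "\<dots> \<le> diameter (closure K)" using Kf(3) xK yc closure_subset by (intro diameter_bounded_bound) auto
  finally have "d \<le> diameter K" using Kf(3) by (simp add: diameter_closure)
  then have "d * \<bar>e \<bullet> \<nu>\<bar> \<le> diameter K * \<bar>e \<bullet> \<nu>\<bar>" by (intro mult_right_mono) auto
  moreover have "r \<le> d * \<bar>e \<bullet> \<nu>\<bar>" using rd neg by simp
  ultimately have "r \<le> \<bar>e \<bullet> \<nu>\<bar> * diameter K" by (simp only: mult.commute)
  then show ?thesis using G neg \<nu>_def by blast
qed

lemma upwind_point_eq:
  assumes "affine hull F = {x. x \<bullet> \<nu> = a}" "e \<bullet> \<nu> \<noteq> 0"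
  shows "upwind_point F e z = z + ((a - z \<bullet> \<nu>) / (e \<bullet> \<nu>)) *\<^sub>R e"
  unfolding upwind_point_def
proof (rule the_equality)
  show "z + ((a - z \<bullet> \<nu>) / (e \<bullet> \<nu>)) *\<^sub>R e \<in> affine hull F \<and> (\<exists>s. z + ((a - z \<bullet> \<nu>) / (e \<bullet> \<nu>)) *\<^sub>R e = z + s *\<^sub>R e)"
    using assms by (auto simp: inner_add_left)
  fix p assume "p \<in> affine hull F \<and> (\<exists>s. p = z + s *\<^sub>R e)"
  then obtain s where "p = z + s *\<^sub>R e" "(z + s *\<^sub>R e) \<bullet> \<nu> = a" using assms by auto
  then show "p = z + ((a - z \<bullet> \<nu>) / (e \<bullet> \<nu>)) *\<^sub>R e"
    using assms(2) by (auto simp: inner_add_left field_simps)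
qed

text \<open>The steepest face is at least as transversal to \<beta> as the facet found in
  \<open>inflow_facet\<close>. Hence moving along e onto its hyperplane covers at most 4 \<rho>
  times the distance to it, a factor that depends on the shape alone.\<close>

lemma steepest_face_geometry:
  fixes K :: "'a::euclidean_space set"
  assumes K: "open_simplex K" and \<rho>: "shape_param K \<le> \<rho>" and \<beta>: "\<beta> \<noteq> 0"
    and F: "steepest_inflow_face K \<beta> F" and e: "e = (1 / norm \<beta>) *\<^sub>R \<beta>"
  shows "\<exists>\<nu> a q. norm \<nu> = 1 \<and> 1 \<le> 4 * \<rho> * \<bar>e \<bullet> \<nu>\<bar> \<and> q \<in> closure K \<and> q \<bullet> \<nu> = a \<and>
    (\<forall>z. upwind_point F e z = z + ((a - z \<bullet> \<nu>) / (e \<bullet> \<nu>)) *\<^sub>R e)"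
proof -
  note Kf = open_simplex_facts[OF K]
  obtain x r where r: "r > 0" "ball x r \<subseteq> K" "diameter K \<le> 4 * \<rho> * r"
    using inscribed_ball[OF Kf(1,3,4) \<rho>] by blast
  have e1: "norm e = 1" using \<beta> by (simp add: e)
  obtain G where G: "G facet_of closure K" "e \<bullet> face_normal K G < 0" "r \<le> \<bar>e \<bullet> face_normal K G\<bar> * diameter K"
    using inflow_facet[OF K e1 r(1,2)] by blast
  have be: "\<beta> = norm \<beta> *\<^sub>R e" using \<beta> by (simp add: e)
  have b: "\<beta> \<bullet> v = norm \<beta> * (e \<bullet> v)" for v by (subst be) simp
  have "G \<in> inflow_faces K \<beta>" using G \<beta> by (auto simp: inflow_faces_def b mult_pos_neg)
  then have le: "\<bar>e \<bullet> face_normal K G\<bar> \<le> \<bar>e \<bullet> face_normal K F\<bar>"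
    and Ff: "F facet_of closure K" "e \<bullet> face_normal K F < 0"
    using F \<beta> by (auto simp: steepest_inflow_face_def b abs_mult inflow_faces_def mult_less_0_iff)
  define \<nu> where "\<nu> = face_normal K F"
  obtain a where a: "\<forall>x\<in>closure K. x \<bullet> \<nu> \<le> a" "affine hull F = {x. x \<bullet> \<nu> = a}" "F = closure K \<inter> {x. x \<bullet> \<nu> = a}"
    using facet_normal(2)[OF K Ff(1)] \<nu>_def by blast
  have \<nu>: "norm \<nu> = 1" using facet_normal(1)[OF K Ff(1)] by (simp add: is_face_normal_def \<nu>_def)
  have "F \<noteq> {}" using Ff(1) by (simp add: facet_of_def)
  then obtain q where q: "q \<in> closure K" "q \<bullet> \<nu> = a" using a(3) by blast
  have "r \<le> \<bar>e \<bullet> \<nu>\<bar> * diameter K"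
    using G(3) le diameter_ge_0[OF Kf(3)] unfolding \<nu>_def by (meson mult_right_mono order_trans)
  also have "\<dots> \<le> \<bar>e \<bullet> \<nu>\<bar> * (4 * \<rho> * r)" using r(3) by (intro mult_left_mono) auto
  finally have "1 \<le> 4 * \<rho> * \<bar>e \<bullet> \<nu>\<bar>" using r(1) by (simp add: mult_ac)
  then show ?thesis
    using \<nu> q upwind_point_eq[OF a(2), of e] Ff(2) \<nu>_def by (intro exI[of _ \<nu>] exI[of _ a] exI[of _ q]) auto
qed

section \<open>Elements inside the domain\<close>

text \<open>Slits are impossible: near a boundary point the region above the graph is open and
  misses U, and it contains points arbitrarily close to that point. So no boundary point is interior
  to the closure.\<close>

lemma lipschitz_domain_interior_closure:
  fixes U :: "'a::euclidean_space set"
  assumes "lipschitz_domain U"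
  shows "open U" "interior (closure U) = U"
proof -
  show o: "open U" using assms by (simp add: lipschitz_domain_def)
  show "interior (closure U) = U"
  proof
    show "U \<subseteq> interior (closure U)" using o by (simp add: closure_subset interior_maximal)
    show "interior (closure U) \<subseteq> U"
    proof (rule ccontr)
      assume "\<not> interior (closure U) \<subseteq> U"
      then obtain x where x: "x \<in> interior (closure U)" "x \<notin> U" by blast
      then have "x \<in> frontier U" using interior_subset by (auto simp: frontier_def interior_open[OF o])
      then obtain r e g L where r: "r > 0" and e: "norm e = 1" and g: "L-lipschitz_on {z. z \<bullet> e = 0} g"
        and U: "U \<inter> ball x r = {y\<in>ball x r. y \<bullet> e < g (y - (y \<bullet> e) *\<^sub>R e)}"
        using assms unfolding lipschitz_domain_def by blast
      have ee: "e \<bullet> e = 1" using e by (simp add: norm_eq_1)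
      define P where "P = (\<lambda>y. y - (y \<bullet> e) *\<^sub>R e)"
      have "x \<in> ball x r" using r by simp
      then have xg: "g (P x) \<le> x \<bullet> e" using U x(2) P_def by fastforce
      have cont: "continuous_on UNIV (\<lambda>y. y \<bullet> e - g (P y))"
        unfolding P_def using ee
        by (intro continuous_on_diff continuous_on_compose2[OF lipschitz_on_continuous_on[OF g]] continuous_intros)
          (auto simp: inner_diff_left)
      then have "open {y. 0 < y \<bullet> e - g (P y)}" by (intro open_Collect_less[OF continuous_on_const])
      then have oV: "open ({y. 0 < y \<bullet> e - g (P y)} \<inter> ball x r)" by blast
      obtain s where s: "s > 0" "ball x s \<subseteq> closure U" using x(1) mem_interior by blast
      define t where "t = min r s / 2"
      have t: "t > 0" "t < r" "t < s" using r s by (auto simp: t_def)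
      define y where "y = x + t *\<^sub>R e"
      have "P y = P x" using ee by (simp add: P_def y_def algebra_simps)
      then have "0 < y \<bullet> e - g (P y)" using xg t ee by (simp add: y_def inner_add_left)
      moreover have "y \<in> ball x r" "y \<in> ball x s" using t e by (auto simp: y_def dist_norm)
      ultimately have "y \<in> {y. 0 < y \<bullet> e - g (P y)} \<inter> ball x r" "y \<in> closure U" using s by auto
      then have "({y. 0 < y \<bullet> e - g (P y)} \<inter> ball x r) \<inter> U \<noteq> {}"
        using open_Int_closure_eq_empty[OF oV, of U] by blast
      then obtain y where "y \<in> U" "y \<in> ball x r" "0 < y \<bullet> e - g (P y)" by blast
      moreover have "y \<bullet> e < g (P y)"
        using \<open>y \<in> U\<close> \<open>y \<in> ball x r\<close> U unfolding P_def by blast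
      ultimately show False by simp
    qed
  qed
qed

text \<open>A partition prescribes only closures. An element is open, so it lies in the interior of
  the closure of \<Omega>, which is \<Omega> itself; what the elements leave uncovered lies in
  finitely many frontiers of convex sets.\<close>

lemma partition_facts:
  fixes \<Omega> :: "'a::euclidean_space set"
  assumes \<Omega>: "lipschitz_domain \<Omega>" and P: "simplicial_partition \<Omega> P"
  shows "finite P" "\<And>K. K \<in> P \<Longrightarrow> open_simplex K" "disjoint P" "\<And>K. K \<in> P \<Longrightarrow> K \<subseteq> \<Omega>" "negligible (\<Omega> - \<Union>P)"
proof -
  show fin: "finite P" and s: "\<And>K. K \<in> P \<Longrightarrow> open_simplex K" and "disjoint P"
    using P by (auto simp: simplicial_partition_def is_partition_def)
  have cl: "closure \<Omega> = (\<Union>K\<in>P. closure K)" using P by (auto simp: simplicial_partition_def is_partition_def)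
  show "K \<subseteq> \<Omega>" if "K \<in> P" for K
  proof -
    have "K \<subseteq> closure \<Omega>" using that cl closure_subset[of K] by blast
    then have "K \<subseteq> interior (closure \<Omega>)" using open_simplex_facts(1)[OF s[OF that]] by (rule interior_maximal)
    then show ?thesis using lipschitz_domain_interior_closure[OF \<Omega>] by simp
  qed
  have "negligible (\<Union>K\<in>P. closure K - K)"
    using fin open_simplex_facts(7)[OF s] by (intro negligible_Union) auto
  then show "negligible (\<Omega> - \<Union>P)"
    by (rule negligible_subset) (use cl closure_subset[of \<Omega>] in blast)
qed

section \<open>The local test function\<close>

text \<open>The inverse estimate yields Lipschitz bounds; here they become bounds on the derivative,
  the limit of difference quotients inside K.\<close>

lemma derivative_le_lipschitz:
  fixes f :: "'a::euclidean_space \<Rightarrow> real"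
  assumes f: "(f has_derivative f') (at z)" and K: "open K" "z \<in> K"
    and L: "\<And>x y. x \<in> K \<Longrightarrow> y \<in> K \<Longrightarrow> \<bar>f x - f y\<bar> \<le> \<Lambda> * norm (x - y)"
  shows "\<bar>f' h\<bar> \<le> \<Lambda> * norm h"
proof -
  have lin: "linear f'" by (rule has_derivative_linear[OF f])
  have "((\<lambda>t. z + t *\<^sub>R h) has_derivative (\<lambda>t. t *\<^sub>R h)) (at (0::real))"
    by (auto intro!: derivative_eq_intros)
  moreover have "(f has_derivative f') (at (z + 0 *\<^sub>R h))" using f by simp
  ultimately have "((\<lambda>t. f (z + t *\<^sub>R h)) has_derivative (\<lambda>t. f' (t *\<^sub>R h))) (at 0)"
    by (rule has_derivative_compose)
  moreover have "(\<lambda>t. f' (t *\<^sub>R h)) = (*) (f' h)" by (auto simp: linear_cmul[OF lin])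
  ultimately have "((\<lambda>t. f (z + t *\<^sub>R h)) has_real_derivative f' h) (at 0)"
    by (simp add: has_field_derivative_def)
  then have "((\<lambda>t. (f (z + t *\<^sub>R h) - f z) / t) \<longlongrightarrow> f' h) (at 0)"
    by (simp add: DERIV_def)
  then have lim: "((\<lambda>t. \<bar>(f (z + t *\<^sub>R h) - f z) / t\<bar>) \<longlongrightarrow> \<bar>f' h\<bar>) (at 0)"
    by (rule tendsto_rabs)
  have "((\<lambda>t. z + t *\<^sub>R h) \<longlongrightarrow> z + 0 *\<^sub>R h) (at 0)" by (intro tendsto_intros)
  then have "eventually (\<lambda>t. z + t *\<^sub>R h \<in> K) (at 0)"
    using K by (intro topological_tendstoD) auto
  moreover have "eventually (\<lambda>t::real. t \<noteq> 0) (at 0)" by (simp add: eventually_at_filter)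
  ultimately have "eventually (\<lambda>t. \<bar>(f (z + t *\<^sub>R h) - f z) / t\<bar> \<le> \<Lambda> * norm h) (at 0)"
  proof eventually_elim
    case (elim t)
    have "\<bar>f (z + t *\<^sub>R h) - f z\<bar> \<le> \<Lambda> * norm (t *\<^sub>R h)" using L[OF elim(1) K(2)] by simp
    then show ?case using elim(2) by (simp add: divide_le_eq mult_ac)
  qed
  then show ?thesis by (rule tendsto_upperbound[OF lim]) simp
qed

text \<open>U and W are the coarse polynomials, S contains K and the projected points, r is the
  coarse length scale, H bounds the inverse cosine between e and the normal, and \<eta> bounds
  \<delta> / r. \<open>P\<close> projects along e onto the hyperplane and is constant in that
  direction, so the derivative of T along \<beta> is exactly W - U at \<open>P z\<close>. There
  remain the move from \<open>P z\<close> to z, which costs A H \<eta>, and the variation of the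
  coefficients, where each factor \<delta> meets at most one 1 / r from a derivative.\<close>

lemma local_test_function_estimate:
  fixes U W :: "'a::euclidean_space \<Rightarrow> real" and \<beta> e \<nu> :: 'a
  assumes U: "poly_le m U" and W: "poly_le m W" and K: "open K" and KS: "K \<subseteq> S"
    and V: "V = (\<lambda>x. frechet_derivative W (at x) \<beta>)"
    and r: "r > 0" "r \<le> 1"
    and bU: "\<And>x y. x \<in> S \<Longrightarrow> y \<in> S \<Longrightarrow> \<bar>U x\<bar> \<le> A \<and> \<bar>U x - U y\<bar> \<le> A * (norm (x - y) / r)"
    and bW: "\<And>x y. x \<in> S \<Longrightarrow> y \<in> S \<Longrightarrow> \<bar>W x\<bar> \<le> A \<and> \<bar>W x - W y\<bar> \<le> A * (norm (x - y) / r)"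
    and bV: "\<And>x y. x \<in> S \<Longrightarrow> y \<in> S \<Longrightarrow> \<bar>V x\<bar> \<le> A \<and> \<bar>V x - V y\<bar> \<le> A * (norm (x - y) / r)"
    and e: "norm e = 1" and \<nu>: "norm \<nu> = 1" and H: "1 \<le> H * \<bar>e \<bullet> \<nu>\<bar>"
    and P: "P = (\<lambda>z. z + ((a - z \<bullet> \<nu>) / (e \<bullet> \<nu>)) *\<^sub>R e)"
    and \<delta>: "0 \<le> \<delta>" "\<And>z. z \<in> K \<Longrightarrow> \<bar>a - z \<bullet> \<nu>\<bar> \<le> \<delta>" "\<delta> \<le> \<eta> * r" and \<eta>: "\<eta> \<le> 1"
    and PS: "\<And>z. z \<in> K \<Longrightarrow> P z \<in> S"
    and n: "\<beta>0 > 0" "\<beta>0 \<le> n" "\<beta> = n *\<^sub>R e"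
    and T: "T = (\<lambda>z. ((W (P z) - U (P z)) * ((z - P z) \<bullet> e) + n * (V (P z) + cK * U (P z) + dK * W (P z))) / n)"
    and M: "\<bar>cK\<bar> \<le> M" "\<bar>dK\<bar> \<le> M" and L: "L \<ge> 0"
    and z: "z \<in> K" and bz: "norm (bz - \<beta>) \<le> L * \<delta>" "\<bar>cz - cK\<bar> \<le> L * \<delta>" "\<bar>dz - dK\<bar> \<le> L * \<delta>"
  shows "poly_le (Suc m) T"
    "\<bar>T z - (frechet_derivative W (at z) bz + cz * U z + dz * W z)\<bar>
       \<le> A * \<eta> * (2 * H / \<beta>0 + H + L + 2 * (M * H + L))"
    "\<bar>frechet_derivative T (at z) bz - (W z - U z)\<bar>
       \<le> A * \<eta> * (2 * H + L * ((2 * H + 2 * H * (1 + H)) / \<beta>0 + (1 + 2 * M) * (1 + H)))"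
proof -
  have en: "e \<bullet> \<nu> \<noteq> 0" using H by auto
  have H0: "H > 0" using H by (smt (verit) mult_nonpos_nonneg abs_ge_zero)
  have H1: "1 / \<bar>e \<bullet> \<nu>\<bar> \<le> H" using H en by (simp add: divide_le_eq)
  have n0: "n > 0" using n by linarith
  have ee: "e \<bullet> e = 1" using e by (simp add: norm_eq_1)
  have A0: "A \<ge> 0" using bU[of z z] z KS by fastforce
  have M0: "M \<ge> 0" using M by linarith
  have \<eta>0: "\<eta> \<ge> 0" using \<delta>(1,3) r by (smt (verit) mult_neg_pos)
  \<comment> \<open>Terms that involve no derivative carry \<delta> without the factor 1 / r; for
    these r \<le> 1 is used.\<close>
  have \<delta>r: "\<delta> / r \<le> \<eta>" "\<delta> \<le> \<eta>"
  proof -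
    show "\<delta> / r \<le> \<eta>" using \<delta>(3) r by (simp add: divide_le_eq)
    have "\<eta> * r \<le> \<eta>" using r \<eta>0 by (simp add: mult_left_le)
    then show "\<delta> \<le> \<eta>" using \<delta>(3) by linarith
  qed
  define s where "s = (\<lambda>z. (a - z \<bullet> \<nu>) / (e \<bullet> \<nu>))"
  have Ps: "P z = z + s z *\<^sub>R e" for z by (simp add: P s_def)
  have tau: "(z - P z) \<bullet> e = - s z" for z using ee by (simp add: Ps)
  have TT: "T z = - (W (P z) - U (P z)) * s z / n + V (P z) + cK * U (P z) + dK * W (P z)" for z
    using n0 by (simp add: T tau field_simps)
  have s_bound: "\<bar>s z\<bar> \<le> H * \<delta>" if "z \<in> K" for z
  proof -
    have "\<bar>s z\<bar> = (1 / \<bar>e \<bullet> \<nu>\<bar>) * \<bar>a - z \<bullet> \<nu>\<bar>" by (simp add: s_def)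
    also have "\<dots> \<le> H * \<delta>" using H1 \<delta>(2)[OF that] H0 by (intro mult_mono) auto
    finally show ?thesis .
  qed
  have s_lip: "\<bar>s x - s y\<bar> \<le> H * norm (x - y)" for x y
  proof -
    have "\<bar>s x - s y\<bar> = (1 / \<bar>e \<bullet> \<nu>\<bar>) * \<bar>(y - x) \<bullet> \<nu>\<bar>"
      by (simp add: s_def inner_diff_left flip: diff_divide_distrib)
    also have "\<dots> \<le> H * norm (x - y)"
      using H1 H0 Cauchy_Schwarz_ineq2[of "y - x" \<nu>] \<nu> by (intro mult_mono) (auto simp: norm_minus_commute)
    finally show ?thesis .
  qed
  have P_lip: "norm (P x - P y) \<le> (1 + H) * norm (x - y)" for x y
  proof -
    have "P x - P y = (x - y) + (s x - s y) *\<^sub>R e" by (simp add: Ps algebra_simps)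
    then have "norm (P x - P y) \<le> norm (x - y) + \<bar>s x - s y\<bar>" by (metis e mult.right_neutral norm_scaleR norm_triangle_ineq)
    then show ?thesis using s_lip[of x y] by (simp add: algebra_simps)
  qed
  have Pz: "norm (P z - z) \<le> H * \<delta>" if "z \<in> K" for z using s_bound[OF that] e by (simp add: Ps)
  have move: "\<bar>q (P z) - q z\<bar> \<le> A * (H * \<eta>)"
    if q: "\<And>x y. x \<in> S \<Longrightarrow> y \<in> S \<Longrightarrow> \<bar>q x\<bar> \<le> A \<and> \<bar>q x - q y\<bar> \<le> A * (norm (x - y) / r)" for q
  proof -
    have "\<bar>q (P z) - q z\<bar> \<le> A * (norm (P z - z) / r)" using q[OF PS[OF z]] z KS by blast
    also have "\<dots> \<le> A * (H * \<delta> / r)" using Pz[OF z] r A0 by (intro mult_left_mono divide_right_mono) auto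
    also have "\<dots> \<le> A * (H * \<eta>)" using mult_left_mono[OF \<delta>r(1), of H] H0 A0 by (intro mult_left_mono) auto
    finally show ?thesis .
  qed
  \<comment> \<open>Each coordinate of \<open>P\<close> is affine, so composing with it preserves
    the degree. Only the factor \<open>s\<close> raises the degree of T by one.\<close>
  have Ppoly: "poly_le k (\<lambda>z. q (P z))" if "poly_le k q" for k q
  proof (rule poly_le_compose_affine[OF that])
    fix x i :: 'a
    show "P x \<bullet> i = x \<bullet> (i - ((e \<bullet> i) / (e \<bullet> \<nu>)) *\<^sub>R \<nu>) + (a / (e \<bullet> \<nu>)) * (e \<bullet> i)"
      using en by (simp add: P inner_add_left inner_diff_right field_simps)
  qed
  have Vp: "poly_le m V" unfolding V by (rule poly_le_frechet_derivative[OF W])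
  have "poly_le (Suc m) (\<lambda>z. (z \<bullet> ((1 / (e \<bullet> \<nu>)) *\<^sub>R \<nu>) + (- a / (e \<bullet> \<nu>))) * (W (P z) - U (P z)))"
    by (intro poly_le_affine_mult poly_le_diff Ppoly W U)
  moreover have "(z \<bullet> ((1 / (e \<bullet> \<nu>)) *\<^sub>R \<nu>) + (- a / (e \<bullet> \<nu>))) = - s z" for z
    by (simp add: s_def diff_divide_distrib)
  ultimately have "poly_le (Suc m) (\<lambda>z. - s z * (W (P z) - U (P z)))" by simp
  then have "poly_le (Suc m) (\<lambda>z. (1 / n) * (- s z * (W (P z) - U (P z))) + V (P z) + cK * U (P z) + dK * W (P z))"
    by (intro poly_le.add poly_le_cmult poly_le_mono[OF Ppoly[OF U]] poly_le_mono[OF Ppoly[OF W]] poly_le_mono[OF Ppoly[OF Vp]]) auto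
  moreover have "T = (\<lambda>z. (1 / n) * (- s z * (W (P z) - U (P z))) + V (P z) + cK * U (P z) + dK * W (P z))"
    by (intro ext) (simp add: TT field_simps)
  ultimately show Tp: "poly_le (Suc m) T" by simp
  have Wd: "(W has_derivative frechet_derivative W (at x)) (at x)" for x
    using poly_le_differentiable[OF W] frechet_derivative_works by blast
  have Td: "(T has_derivative frechet_derivative T (at x)) (at x)" for x
    using poly_le_differentiable[OF Tp] frechet_derivative_works by blast
  have zS: "z \<in> S" using z KS by blast
  have uz: "\<bar>U z\<bar> \<le> A" "\<bar>W z\<bar> \<le> A" "\<bar>U (P z)\<bar> \<le> A" "\<bar>W (P z)\<bar> \<le> A"
    using bU[OF zS zS] bW[OF zS zS] bU[OF PS[OF z] zS] bW[OF PS[OF z] zS] by auto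
  have t1: "\<bar>- (W (P z) - U (P z)) * s z / n\<bar> \<le> A * \<eta> * (2 * H / \<beta>0)"
  proof -
    have "\<bar>- (W (P z) - U (P z)) * s z / n\<bar> = \<bar>W (P z) - U (P z)\<bar> * \<bar>s z\<bar> / n"
      using n0 by (simp add: abs_mult abs_divide flip: abs_minus_commute)
    also have "\<dots> \<le> (2 * A) * (H * \<eta>) / \<beta>0"
    proof (intro frac_le mult_mono)
      show "\<bar>s z\<bar> \<le> H * \<eta>" using s_bound[OF z] mult_left_mono[OF \<delta>r(2), of H] H0 by linarith
    qed (use uz n A0 H0 \<eta>0 in auto)
    finally show ?thesis by (simp add: mult_ac)
  qed
  have t2: "\<bar>V (P z) - V z\<bar> \<le> A * \<eta> * H" using move[OF bV] by (simp add: mult_ac)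
  \<comment> \<open>Freezing the direction of differentiation involves the full gradient of W, of
    size A / r, but only against a vector of length at most L \<delta>.\<close>
  have t3: "\<bar>V z - frechet_derivative W (at z) bz\<bar> \<le> A * \<eta> * L"
  proof -
    have "V z - frechet_derivative W (at z) bz = frechet_derivative W (at z) (\<beta> - bz)"
      using linear_diff[OF has_derivative_linear[OF Wd[of z]]] by (simp add: V)
    also have "\<bar>\<dots>\<bar> \<le> (A / r) * norm (\<beta> - bz)"
    proof (rule derivative_le_lipschitz[OF Wd K z])
      fix x y assume "x \<in> K" "y \<in> K"
      then have "x \<in> S" "y \<in> S" using KS by blast+
      then show "\<bar>W x - W y\<bar> \<le> A / r * norm (x - y)" using bW by (metis times_divide_eq_left times_divide_eq_right)
    qed
    also have "\<dots> \<le> (A / r) * (L * \<delta>)"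
      using bz(1) A0 r by (intro mult_left_mono) (auto simp: norm_minus_commute)
    also have "\<dots> = (A * L) * (\<delta> / r)" by simp
    also have "\<dots> \<le> (A * L) * \<eta>" using \<delta>r A0 L by (intro mult_left_mono) auto
    finally show ?thesis by (simp add: mult_ac)
  qed
  have t45: "\<bar>k * q (P z) - k' * q z\<bar> \<le> A * \<eta> * (M * H + L)"
    if q: "\<And>x y. x \<in> S \<Longrightarrow> y \<in> S \<Longrightarrow> \<bar>q x\<bar> \<le> A \<and> \<bar>q x - q y\<bar> \<le> A * (norm (x - y) / r)"
      and k: "\<bar>k\<bar> \<le> M" "\<bar>k' - k\<bar> \<le> L * \<delta>" for q k k'
  proof -
    have "k * q (P z) - k' * q z = k * (q (P z) - q z) + (k - k') * q z" by (simp add: algebra_simps)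
    also have "\<bar>\<dots>\<bar> \<le> \<bar>k\<bar> * \<bar>q (P z) - q z\<bar> + \<bar>k - k'\<bar> * \<bar>q z\<bar>" by (metis abs_mult abs_triangle_ineq)
    also have "\<dots> \<le> M * (A * (H * \<eta>)) + (L * \<eta>) * A"
    proof (intro add_mono mult_mono move[OF q])
      show "\<bar>k - k'\<bar> \<le> L * \<eta>" using k(2) mult_left_mono[OF \<delta>r(2) L] by linarith
      show "\<bar>q z\<bar> \<le> A" using q[OF zS zS] by simp
    qed (use k M0 L \<eta>0 in auto)
    finally show ?thesis by (simp add: algebra_simps)
  qed
  have "T z - (frechet_derivative W (at z) bz + cz * U z + dz * W z)
     = (- (W (P z) - U (P z)) * s z / n) + (V (P z) - V z) + (V z - frechet_derivative W (at z) bz)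
       + (cK * U (P z) - cz * U z) + (dK * W (P z) - dz * W z)"
    unfolding TT by linarith
  also have "\<bar>\<dots>\<bar> \<le> A * \<eta> * (2 * H / \<beta>0) + A * \<eta> * H + A * \<eta> * L + A * \<eta> * (M * H + L) + A * \<eta> * (M * H + L)"
    using t1 t2 t3 t45[OF bU M(1) bz(2)] t45[OF bW M(2) bz(3)] by linarith
  also have "\<dots> = A * \<eta> * (2 * H / \<beta>0 + H + L + 2 * (M * H + L))" by (simp add: algebra_simps)
  finally show "\<bar>T z - (frechet_derivative W (at z) bz + cz * U z + dz * W z)\<bar>
       \<le> A * \<eta> * (2 * H / \<beta>0 + H + L + 2 * (M * H + L))" .
  have s_line: "s (z + t *\<^sub>R e) = s z - t" for t
    using en by (simp add: s_def inner_add_left field_simps)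
  have P_line: "P (z + t *\<^sub>R e) = P z" for t
    by (simp add: Ps s_line scaleR_left_diff_distrib)
  \<comment> \<open>Along e the projected point is fixed and \<open>s\<close> decreases at unit
    speed, so T is affine there with slope (W - U) / n taken at the projected point. Evaluating at n
    turns e into \<beta>.\<close>
  have dir: "frechet_derivative T (at z) \<beta> = W (P z) - U (P z)"
  proof -
    have "((\<lambda>t. z + t *\<^sub>R e) has_derivative (\<lambda>t. t *\<^sub>R e)) (at (0::real))"
      by (auto intro!: derivative_eq_intros)
    moreover have "(T has_derivative frechet_derivative T (at z)) (at (z + 0 *\<^sub>R e))" using Td by simp
    ultimately have "((\<lambda>t. T (z + t *\<^sub>R e)) has_derivative (\<lambda>t. frechet_derivative T (at z) (t *\<^sub>R e))) (at 0)"
      by (rule has_derivative_compose)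
    moreover have "(\<lambda>t. T (z + t *\<^sub>R e)) = (\<lambda>t. T z + t * ((W (P z) - U (P z)) / n))"
      unfolding TT P_line s_line using n0 by (intro ext) (simp add: field_simps)
    ultimately have d1: "((\<lambda>t. T z + t * ((W (P z) - U (P z)) / n)) has_derivative (\<lambda>t. frechet_derivative T (at z) (t *\<^sub>R e))) (at 0)"
      by (simp only:)
    have d2: "((\<lambda>t. T z + t * ((W (P z) - U (P z)) / n)) has_derivative (\<lambda>t. t * ((W (P z) - U (P z)) / n))) (at 0)"
      using n0 by (auto intro!: derivative_eq_intros)
    have "(\<lambda>t. frechet_derivative T (at z) (t *\<^sub>R e)) = (\<lambda>t. t * ((W (P z) - U (P z)) / n))"
      by (rule has_derivative_unique[OF d1 d2])
    from fun_cong[OF this, of n] show ?thesis using n0 by (simp add: n(3))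
  qed
  \<comment> \<open>The first part comes from the product of W - U with \<open>s\<close>: the 1 / r
    from the difference of W - U is cancelled by \<bar>s\<bar> \<le> H \<delta>. The second part
    collects V, cK U and dK W, composed with \<open>P\<close>, whose Lipschitz constant is 1 +
    H.\<close>
  let ?\<Lambda> = "(2 * A * H + 2 * A * H * (1 + H)) / \<beta>0 + (A / r) * ((1 + 2 * M) * (1 + H))"
  have lip: "\<bar>T x - T y\<bar> \<le> ?\<Lambda> * norm (x - y)" if x: "x \<in> K" and y: "y \<in> K" for x y
  proof -
    let ?d = "norm (x - y)"
    have qP: "\<bar>q (P x) - q (P y)\<bar> \<le> (A / r) * ((1 + H) * ?d)"
      if q: "\<And>x y. x \<in> S \<Longrightarrow> y \<in> S \<Longrightarrow> \<bar>q x\<bar> \<le> A \<and> \<bar>q x - q y\<bar> \<le> A * (norm (x - y) / r)" for q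
    proof -
      have "\<bar>q (P x) - q (P y)\<bar> \<le> A * (norm (P x - P y) / r)" using q[OF PS[OF x] PS[OF y]] by simp
      also have "\<dots> = (A / r) * norm (P x - P y)" by simp
      also have "\<dots> \<le> (A / r) * ((1 + H) * ?d)" using P_lip[of x y] A0 r by (intro mult_left_mono) auto
      finally show ?thesis .
    qed
    let ?f = "\<lambda>z. W (P z) - U (P z)"
    have fx: "\<bar>?f x\<bar> \<le> 2 * A" using bU[OF PS[OF x] PS[OF x]] bW[OF PS[OF x] PS[OF x]] by auto
    have fd: "\<bar>?f x - ?f y\<bar> \<le> 2 * ((A / r) * ((1 + H) * ?d))" using qP[OF bU] qP[OF bW] by linarith
    have "- ?f x * s x - (- ?f y * s y) = - (?f x * (s x - s y) + (?f x - ?f y) * s y)" by (simp add: algebra_simps)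
    then have "\<bar>- ?f x * s x - (- ?f y * s y)\<bar> = \<bar>?f x * (s x - s y) + (?f x - ?f y) * s y\<bar>"
      by (simp only: abs_minus_cancel)
    also have "\<dots> \<le> \<bar>?f x\<bar> * \<bar>s x - s y\<bar> + \<bar>?f x - ?f y\<bar> * \<bar>s y\<bar>"
      unfolding abs_mult[symmetric] by (rule abs_triangle_ineq)
    also have "\<dots> \<le> (2 * A) * (H * ?d) + (2 * ((A / r) * ((1 + H) * ?d))) * (H * \<delta>)"
      using fx fd s_lip[of x y] s_bound[OF y] A0 H0 r by (intro add_mono mult_mono) auto
    also have "(2 * ((A / r) * ((1 + H) * ?d))) * (H * \<delta>) = (2 * A * H * (1 + H) * ?d) * (\<delta> / r)" by (simp add: mult_ac)
    also have "\<dots> \<le> (2 * A * H * (1 + H) * ?d) * 1"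
      using \<delta>r \<eta> A0 H0 by (intro mult_left_mono) auto
    finally have "\<bar>- ?f x * s x - (- ?f y * s y)\<bar> \<le> (2 * A * H + 2 * A * H * (1 + H)) * ?d"
      by (simp add: algebra_simps)
    then have "\<bar>- ?f x * s x - (- ?f y * s y)\<bar> / n \<le> (2 * A * H + 2 * A * H * (1 + H)) * ?d / \<beta>0"
      using n A0 H0 by (intro frac_le) auto
    moreover have "\<bar>- ?f x * s x / n - - ?f y * s y / n\<bar> = \<bar>- ?f x * s x - (- ?f y * s y)\<bar> / n"
      using n0 by (simp flip: diff_divide_distrib)
    ultimately have p1: "\<bar>- ?f x * s x / n - - ?f y * s y / n\<bar> \<le> (2 * A * H + 2 * A * H * (1 + H)) / \<beta>0 * ?d"
      by simp
    have kq: "\<bar>k * q (P x) - k * q (P y)\<bar> \<le> M * ((A / r) * ((1 + H) * ?d))"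
      if q: "\<And>x y. x \<in> S \<Longrightarrow> y \<in> S \<Longrightarrow> \<bar>q x\<bar> \<le> A \<and> \<bar>q x - q y\<bar> \<le> A * (norm (x - y) / r)" and k: "\<bar>k\<bar> \<le> M" for q k
    proof -
      have "\<bar>k * q (P x) - k * q (P y)\<bar> = \<bar>k\<bar> * \<bar>q (P x) - q (P y)\<bar>"
        by (simp flip: right_diff_distrib add: abs_mult)
      also have "\<dots> \<le> M * ((A / r) * ((1 + H) * ?d))" using qP[OF q] k M0 by (intro mult_mono) auto
      finally show ?thesis .
    qed
    have "\<bar>T x - T y\<bar> \<le> (2 * A * H + 2 * A * H * (1 + H)) / \<beta>0 * ?d + (A / r) * ((1 + H) * ?d)
        + M * ((A / r) * ((1 + H) * ?d)) + M * ((A / r) * ((1 + H) * ?d))"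
    proof -
      have abs4: "\<bar>a1 + b1 + c1 + d1 - (a2 + b2 + c2 + d2)\<bar> \<le> a3 + b3 + c3 + d3"
        if "\<bar>a1 - a2\<bar> \<le> a3" "\<bar>b1 - b2\<bar> \<le> b3" "\<bar>c1 - c2\<bar> \<le> c3" "\<bar>d1 - d2\<bar> \<le> d3"
        for a1 a2 a3 b1 b2 b3 c1 c2 c3 d1 d2 d3 :: real
        using that by linarith
      show ?thesis
        unfolding TT by (rule abs4[OF p1 qP kq[OF _ M(1)] kq[OF _ M(2)]]) (simp_all only: bV bU bW)
    qed
    also have "\<dots> = ?\<Lambda> * ?d" by (simp add: algebra_simps)
    finally show ?thesis .
  qed
  have "frechet_derivative T (at z) bz = frechet_derivative T (at z) \<beta> + frechet_derivative T (at z) (bz - \<beta>)"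
    using linear_diff[OF has_derivative_linear[OF Td[of z]]] by simp
  then have "frechet_derivative T (at z) bz - (W z - U z)
     = (W (P z) - W z) - (U (P z) - U z) + frechet_derivative T (at z) (bz - \<beta>)" by (simp add: dir)
  moreover have "\<bar>frechet_derivative T (at z) (bz - \<beta>)\<bar> \<le> A * \<eta> * (L * ((2 * H + 2 * H * (1 + H)) / \<beta>0 + (1 + 2 * M) * (1 + H)))"
  proof -
    have \<Lambda>0: "?\<Lambda> \<ge> 0" using A0 H0 n r M0 by (intro add_nonneg_nonneg divide_nonneg_pos mult_nonneg_nonneg) auto
    have "\<bar>frechet_derivative T (at z) (bz - \<beta>)\<bar> \<le> ?\<Lambda> * norm (bz - \<beta>)"
      by (rule derivative_le_lipschitz[OF Td K z lip])
    also have "\<dots> \<le> ?\<Lambda> * (L * \<delta>)" using bz(1) \<Lambda>0 by (intro mult_left_mono) auto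
    also have "\<dots> = A * L * ((2 * H + 2 * H * (1 + H)) / \<beta>0) * \<delta> + A * L * ((1 + 2 * M) * (1 + H)) * (\<delta> / r)"
      by (simp add: algebra_simps add_divide_distrib)
    also have "\<dots> \<le> A * L * ((2 * H + 2 * H * (1 + H)) / \<beta>0) * \<eta> + A * L * ((1 + 2 * M) * (1 + H)) * \<eta>"
      using \<delta>r A0 H0 n M0 L by (intro add_mono mult_left_mono) auto
    finally show ?thesis by (simp add: algebra_simps)
  qed
  ultimately have "\<bar>frechet_derivative T (at z) bz - (W z - U z)\<bar>
     \<le> A * (H * \<eta>) + A * (H * \<eta>) + A * \<eta> * (L * ((2 * H + 2 * H * (1 + H)) / \<beta>0 + (1 + 2 * M) * (1 + H)))"
    using move[OF bW] move[OF bU] by linarith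
  also have "\<dots> = A * \<eta> * (2 * H + L * ((2 * H + 2 * H * (1 + H)) / \<beta>0 + (1 + 2 * M) * (1 + H)))"
    by (simp add: algebra_simps)
  finally show "\<bar>frechet_derivative T (at z) bz - (W z - U z)\<bar>
       \<le> A * \<eta> * (2 * H + L * ((2 * H + 2 * H * (1 + H)) / \<beta>0 + (1 + 2 * M) * (1 + H)))" .
qed

section \<open>Stability of the transport equation\<close>

lemma integral_if_subset:
  fixes f :: "'a::euclidean_space \<Rightarrow> real"
  assumes "S \<subseteq> U" "S \<in> sets lebesgue" "U \<in> sets lebesgue" and f: "integrable (lebesgue_on S) f"
  shows "integrable (lebesgue_on U) (\<lambda>x. if x \<in> S then f x else 0)"
    "(LINT x|lebesgue_on U. (if x \<in> S then f x else 0)) = (LINT x|lebesgue_on S. f x)"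
proof -
  have "(\<lambda>x. indicator U x *\<^sub>R (if x \<in> S then f x else 0)) = (\<lambda>x. indicator S x *\<^sub>R f x)"
    using assms(1) by (auto simp: indicator_def fun_eq_iff)
  then show "integrable (lebesgue_on U) (\<lambda>x. if x \<in> S then f x else 0)"
    "(LINT x|lebesgue_on U. (if x \<in> S then f x else 0)) = (LINT x|lebesgue_on S. f x)"
    using assms by (simp_all add: integrable_restrict_space integral_restrict_space)
qed

lemma partition_sum_integral:
  fixes f :: "'a::euclidean_space set \<Rightarrow> 'a \<Rightarrow> real"
  assumes "finite P" "\<And>K. K \<in> P \<Longrightarrow> K \<subseteq> U" "\<And>K. K \<in> P \<Longrightarrow> K \<in> sets lebesgue" "U \<in> sets lebesgue"
    and f: "\<And>K. K \<in> P \<Longrightarrow> integrable (lebesgue_on K) (f K)"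
  shows "integrable (lebesgue_on U) (\<lambda>x. \<Sum>K\<in>P. if x \<in> K then f K x else 0)"
    "(LINT x|lebesgue_on U. (\<Sum>K\<in>P. if x \<in> K then f K x else 0)) = (\<Sum>K\<in>P. LINT x|lebesgue_on K. f K x)"
proof -
  note i = integral_if_subset[OF assms(2,3,4) f]
  show "integrable (lebesgue_on U) (\<lambda>x. \<Sum>K\<in>P. if x \<in> K then f K x else 0)"
    by (intro Bochner_Integration.integrable_sum i(1))
  show "(LINT x|lebesgue_on U. (\<Sum>K\<in>P. if x \<in> K then f K x else 0)) = (\<Sum>K\<in>P. LINT x|lebesgue_on K. f K x)"
    by (subst Bochner_Integration.integral_sum) (auto simp: i(2) intro: i(1))
qed

lemma sum_if_disjoint:
  assumes "finite P" "disjoint P" "K \<in> P" "x \<in> K"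
  shows "(\<Sum>K\<in>P. if x \<in> K then f K else (0::real)) = f K"
proof -
  have "(if x \<in> K' then f K' else 0) = 0" if "K' \<in> P - {K}" for K'
    using assms that by (auto simp: disjoint_def)
  then have "(\<Sum>K\<in>P. if x \<in> K then f K else 0) = (\<Sum>K\<in>{K}. if x \<in> K then f K else 0)"
    using assms by (intro sum.mono_neutral_right) auto
  then show ?thesis using assms by simp
qed

lemma AE_partition:
  fixes U :: "'a::euclidean_space set"
  assumes "finite P" "\<And>K. K \<in> P \<Longrightarrow> K \<subseteq> U" "\<And>K. K \<in> P \<Longrightarrow> K \<in> sets lebesgue" "U \<in> sets lebesgue"
    and n: "negligible (U - \<Union>P)" and ae: "\<And>K. K \<in> P \<Longrightarrow> AE x in lebesgue_on K. R x"
  shows "AE x in lebesgue_on U. R x"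
proof -
  have "AE x in lebesgue. \<forall>K\<in>P. x \<in> K \<longrightarrow> R x"
    using ae assms(3) by (subst AE_finite_all[OF assms(1)]) (simp add: AE_restrict_space_iff)
  moreover have "AE x in lebesgue. x \<notin> U - \<Union>P"
    using n by (intro AE_not_in) (simp add: negligible_iff_null_sets)
  ultimately have "AE x in lebesgue. x \<in> U \<longrightarrow> R x" by eventually_elim auto
  then show ?thesis using assms(4) by (simp add: AE_restrict_space_iff)
qed

lemma measurable_piecewise:
  fixes f :: "'a::euclidean_space \<Rightarrow> real"
  assumes "finite P" "\<And>K. K \<in> P \<Longrightarrow> K \<subseteq> U" "\<And>K. K \<in> P \<Longrightarrow> K \<in> sets lebesgue" "U \<in> sets lebesgue"
    and n: "negligible (U - \<Union>P)" and d: "disjoint P"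
    and f: "\<And>K. K \<in> P \<Longrightarrow> g K \<in> Linf K" "\<And>K x. K \<in> P \<Longrightarrow> x \<in> K \<Longrightarrow> f x = g K x"
    and l: "\<And>K. K \<in> P \<Longrightarrow> K \<in> lmeasurable"
  shows "f \<in> borel_measurable (lebesgue_on U)"
proof -
  let ?g = "\<lambda>x. \<Sum>K\<in>P. if x \<in> K then g K x else 0"
  have "integrable (lebesgue_on U) ?g"
    using assms by (intro partition_sum_integral Linf_integrable) auto
  then have m: "?g \<in> borel_measurable (lebesgue_on U)" by (rule borel_measurable_integrable)
  have N: "U - \<Union>P \<in> null_sets (lebesgue_on U)"
    using n assms(4) by (auto simp: negligible_iff_null_sets null_sets_restrict_space)
  have "f x = ?g x" if "x \<in> space (lebesgue_on (U - (U - \<Union>P)))" for x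
  proof -
    have "x \<in> \<Union>P" using that by (simp add: space_restrict_space)
    then obtain K where K: "K \<in> P" "x \<in> K" by blast
    show ?thesis using sum_if_disjoint[OF assms(1) d K, of "\<lambda>K. g K x"] f(2)[OF K] by simp
  qed
  then have "f \<in> borel_measurable (lebesgue_on (U - (U - \<Union>P))) \<longleftrightarrow> ?g \<in> borel_measurable (lebesgue_on (U - (U - \<Union>P)))"
    by (rule measurable_cong)
  then show ?thesis using m borel_measurable_diff_null[OF N assms(4)] by blast
qed

lemma integral_partition:
  fixes f :: "'a::euclidean_space \<Rightarrow> real"
  assumes "finite P" "\<And>K. K \<in> P \<Longrightarrow> K \<subseteq> U" "\<And>K. K \<in> P \<Longrightarrow> K \<in> sets lebesgue" "U \<in> sets lebesgue"
    and n: "negligible (U - \<Union>P)" and d: "disjoint P" and f: "integrable (lebesgue_on U) f"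
  shows "(LINT x|lebesgue_on U. f x) = (\<Sum>K\<in>P. LINT x|lebesgue_on K. f x)"
proof -
  have i: "integrable (lebesgue_on K) f" if "K \<in> P" for K
    using integrable_lebesgue_on_subset[OF f assms(2,3)[OF that] assms(4)] .
  note s = partition_sum_integral[OF assms(1-4) i]
  have "AE x in lebesgue_on U. f x = (\<Sum>K\<in>P. if x \<in> K then f x else 0)"
    by (rule AE_lebesgue_onI[OF n assms(4)]) (auto simp: sum_if_disjoint[OF assms(1) d, where f="\<lambda>K. f _"])
  then have "(LINT x|lebesgue_on U. f x) = (LINT x|lebesgue_on U. (\<Sum>K\<in>P. if x \<in> K then f x else 0))"
    using f s(1) by (intro Bochner_Integration.integral_cong_AE) auto
  then show ?thesis by (simp add: s(2))
qed

lemma L2_norm_sq: "(L2_norm U u)\<^sup>2 = (LINT x|lebesgue_on U. (u x)\<^sup>2)"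
  by (simp add: L2_norm_def)

section \<open>The transport operator and its inverse\<close>

text \<open>The two functions are equal, not merely almost everywhere: u and v satisfy the same
  identities, so both sides choose by the same predicate.\<close>

lemma adv_AE_cong:
  fixes b :: "'a::euclidean_space \<Rightarrow> 'a"
  assumes b: "\<And>i. i \<in> Basis \<Longrightarrow> (\<lambda>x. b x \<bullet> i) \<in> Linf U" "weak_div U b \<in> Linf U"
    and uv: "u \<in> L2 U" "v \<in> L2 U" "AE x in lebesgue_on U. u x = v x"
  shows "adv U b u = adv U b v"
proof -
  have "(LINT x|lebesgue_on U. u x * (frechet_derivative \<phi> (at x) (b x) + \<phi> x * weak_div U b x))
    = (LINT x|lebesgue_on U. v x * (frechet_derivative \<phi> (at x) (b x) + \<phi> x * weak_div U b x))"
    if \<phi>: "\<phi> \<in> test_functions U" for \<phi>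
  proof -
    have "frechet_derivative \<phi> (at x) (b x) = (\<Sum>i\<in>Basis. (b x \<bullet> i) * frechet_derivative \<phi> (at x) i)" for x
      using test_function_has_derivative[OF \<phi>] by (intro frechet_derivative_basis) (auto simp: differentiable_def)
    then have "(\<lambda>x. frechet_derivative \<phi> (at x) (b x) + \<phi> x * weak_div U b x) \<in> Linf U"
      by (auto intro!: Linf_add Linf_sum Linf_mult b Linf_test_function[OF \<phi>])
    then have m: "(\<lambda>x. frechet_derivative \<phi> (at x) (b x) + \<phi> x * weak_div U b x) \<in> borel_measurable (lebesgue_on U)"
      by (rule Linf_measurable)
    have uvm: "u \<in> borel_measurable (lebesgue_on U)" "v \<in> borel_measurable (lebesgue_on U)"
      using uv by (auto simp: L2_def)
    show ?thesis
      using uv(3) by (intro Bochner_Integration.integral_cong_AE borel_measurable_times m uvm) (auto elim!: eventually_mono)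
  qed
  then have "is_adv U b u = is_adv U b v" by (auto simp: is_adv_def fun_eq_iff)
  then show ?thesis by (simp add: adv_def)
qed

lemma L2_norm_AE_cong:
  assumes "u \<in> L2 U" "v \<in> L2 U" "AE x in lebesgue_on U. u x = v x"
  shows "L2_norm U u = L2_norm U v"
  unfolding L2_norm_def using assms
  by (intro arg_cong[where f=sqrt] Bochner_Integration.integral_cong_AE) (auto simp: L2_def elim!: eventually_mono)

lemma L2_norm_eq_0:
  assumes "u \<in> L2 U" "L2_norm U u = 0"
  shows "AE x in lebesgue_on U. u x = 0"
proof -
  have "(LINT x|lebesgue_on U. (u x)\<^sup>2) = 0" using assms(2) by (simp add: L2_norm_def)
  moreover have "integrable (lebesgue_on U) (\<lambda>x. (u x)\<^sup>2)" using assms(1) by (simp add: L2_def)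
  ultimately have "AE x in lebesgue_on U. (u x)\<^sup>2 = 0"
    by (subst (asm) integral_nonneg_eq_0_iff_AE) auto
  then show ?thesis by simp
qed

text \<open>The chosen derivative of 0 is only almost everywhere 0. The zero function is the
  comparison solution for a vanishing right-hand side.\<close>

lemma zero_H_adv_0:
  fixes b :: "'a::euclidean_space \<Rightarrow> 'a"
  assumes U: "open U" "bounded U"
  shows "(\<lambda>x. 0) \<in> H_adv_0 U b" "AE x in lebesgue_on U. adv U b (\<lambda>x. 0) x = 0" "H_norm U b (\<lambda>x. 0) = 0"
proof -
  have Um: "U \<in> lmeasurable" using U by (auto simp: lmeasurable_open)
  have z: "(\<lambda>x. 0) \<in> L2 U" by (rule Linf_imp_L2[OF Um Linf_const])
  have H: "(\<lambda>x. 0) \<in> H_adv U b" using z by (auto simp: H_adv_def is_adv_def intro!: bexI[OF _ z])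
  have a: "adv U b (\<lambda>x. 0) \<in> L2 U" by (rule H_adv_adv(1)[OF H])
  show ae: "AE x in lebesgue_on U. adv U b (\<lambda>x. 0) x = 0"
    using H_adv_adv(2)[OF H] by (intro fundamental_lemma[OF U(1) L2_integrable[OF Um a]]) (auto simp: is_adv_def)
  have "L2_norm U (adv U b (\<lambda>x. 0)) = L2_norm U (\<lambda>x. 0)" by (rule L2_norm_AE_cong[OF a z ae])
  then show n: "H_norm U b (\<lambda>x. 0) = 0" by (simp add: H_norm_def L2_norm_def)
  show "(\<lambda>x. 0) \<in> H_adv_0 U b"
    using H n by (auto simp: H_adv_0_def intro!: bexI[OF _ H])
qed

text \<open>\<open>transport_inv\<close> picks some preimage, and injectivity makes it agree with w
  almost everywhere. The norm of the inverse is a supremum over right-hand sides of nonzero norm, so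
  a vanishing one is treated apart.\<close>

lemma transport_stability:
  fixes b :: "'a::euclidean_space \<Rightarrow> 'a"
  assumes U: "open U" "bounded U" and b: "b \<in> W1inf_div U" and c: "c \<in> Linf U"
    and inv: "transport_boundedly_invertible U b c" and NB: "transport_inv_norm U b c \<le> ereal NB"
    and w: "w \<in> H_adv_0 U b"
  shows "H_norm U b w \<le> \<bar>NB\<bar> * L2_norm U (transport_op U b c w)"
proof -
  have Um: "U \<in> lmeasurable" using U by (auto simp: lmeasurable_open)
  have bL: "\<And>i. i \<in> Basis \<Longrightarrow> (\<lambda>x. b x \<bullet> i) \<in> Linf U" "weak_div U b \<in> Linf U"
    using W1inf_div_facts[OF b] b by (auto simp: W1inf_div_def W1inf_def)
  let ?f = "transport_op U b c w"
  have wH: "w \<in> H_adv U b" and wL: "w \<in> L2 U" using w by (auto simp: H_adv_0_def H_adv_def)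
  have f: "?f \<in> L2 U"
    unfolding transport_op_def by (intro L2_add H_adv_adv(1)[OF wH] L2_Linf_mult[OF wL c])
  have H_cong: "H_norm U b v = H_norm U b w" if "v \<in> H_adv_0 U b" "AE x in lebesgue_on U. v x = w x" for v
  proof -
    have v: "v \<in> L2 U" using that(1) by (auto simp: H_adv_0_def H_adv_def)
    have "adv U b v = adv U b w" by (rule adv_AE_cong) (use bL v wL that(2) in auto)
    then show ?thesis by (simp add: H_norm_def L2_norm_AE_cong[OF v wL that(2)])
  qed
  have uniq: "\<And>v. v \<in> H_adv_0 U b \<Longrightarrow> AE x in lebesgue_on U. transport_op U b c v x = ?f x \<Longrightarrow> AE x in lebesgue_on U. v x = w x"
    using inv w unfolding transport_boundedly_invertible_def by blast
  show ?thesis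
  proof (cases "L2_norm U ?f = 0")
    case True
    have "AE x in lebesgue_on U. transport_op U b c (\<lambda>x. 0) x = ?f x"
      using L2_norm_eq_0[OF f True] zero_H_adv_0(2)[OF U] by eventually_elim (simp add: transport_op_def)
    then have "AE x in lebesgue_on U. 0 = w x" by (rule uniq[OF zero_H_adv_0(1)[OF U]])
    from H_cong[OF zero_H_adv_0(1)[OF U] this] show ?thesis using zero_H_adv_0(3)[OF U] True by simp
  next
    case False
    let ?v = "transport_inv U b c ?f"
    have "\<exists>v. v \<in> H_adv_0 U b \<and> (AE x in lebesgue_on U. transport_op U b c v x = ?f x)" using w by auto
    from someI_ex[OF this] have v: "?v \<in> H_adv_0 U b" "AE x in lebesgue_on U. transport_op U b c ?v x = ?f x"
      unfolding transport_inv_def by blast+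
    have "ereal (H_norm U b ?v / L2_norm U ?f) \<le> transport_inv_norm U b c"
      unfolding transport_inv_norm_def using f False by (intro SUP_upper) auto
    then have "H_norm U b ?v / L2_norm U ?f \<le> NB" using NB by (meson ereal_less_eq(3) order_trans)
    moreover have "L2_norm U ?f > 0" using False by (simp add: L2_norm_def less_le)
    ultimately have "H_norm U b ?v \<le> NB * L2_norm U ?f" by (simp add: divide_le_eq)
    also have "\<dots> \<le> \<bar>NB\<bar> * L2_norm U ?f" using \<open>L2_norm U ?f > 0\<close> by (intro mult_right_mono) auto
    finally show ?thesis using H_cong[OF v(1) uniq[OF v]] by simp
  qed
qed

text \<open>Let X be the squared norm of (w - u, g) and N = |Nc| + |Nb|. The image of w under the
  transport operator has squared norm at most 2 (1 + N^2) X, so that of w in H is at most NB^2 times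
  this; writing u = w - (w - u) adds twice the same bound and another 2 X.\<close>

definition stability_constant :: "real \<Rightarrow> real \<Rightarrow> real \<Rightarrow> real" where
  "stability_constant Nb Nc NB = 2 + 6 * NB\<^sup>2 * (1 + (\<bar>Nc\<bar> + \<bar>Nb\<bar>)\<^sup>2)"

lemma stability_constant_pos: "stability_constant Nb Nc NB > 0"
  by (simp add: stability_constant_def add_pos_nonneg)

lemma U_norm_stability:
  fixes b :: "'a::euclidean_space \<Rightarrow> 'a"
  assumes U: "open U" "bounded U" and b: "b \<in> W1inf_div U" and c: "c \<in> W1inf U"
    and inv: "transport_boundedly_invertible U b c"
    and Nb: "W1inf_div_norm U b \<le> ereal Nb" and Nc: "W1inf_norm U c \<le> ereal Nc"
    and NB: "transport_inv_norm U b c \<le> ereal NB"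
    and w: "w \<in> H_adv_0 U b" and u: "u \<in> L2 U"
  defines "X2 \<equiv> \<lambda>x. adv U b w x + (c x - weak_div U b x) * u x + weak_div U b x * w x"
  shows "(U_norm U b u w)\<^sup>2 \<le> stability_constant Nb Nc NB * (LINT x|lebesgue_on U. (w x - u x)\<^sup>2 + (X2 x)\<^sup>2)"
proof -
  have Um: "U \<in> lmeasurable" using U by (auto simp: lmeasurable_open)
  have cL: "c \<in> Linf U" and dL: "weak_div U b \<in> Linf U" using b c by (auto simp: W1inf_div_def W1inf_def)
  have wH: "w \<in> H_adv U b" and wL: "w \<in> L2 U" using w by (auto simp: H_adv_0_def H_adv_def)
  have aL: "adv U b w \<in> L2 U" by (rule H_adv_adv(1)[OF wH])
  let ?f = "transport_op U b c w"
  have f: "?f \<in> L2 U"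
    unfolding transport_op_def by (intro L2_add aL L2_Linf_mult[OF wL cL])
  have X1L: "(\<lambda>x. w x - u x) \<in> L2 U" by (rule L2_diff[OF wL u])
  have X2L: "X2 \<in> L2 U" unfolding X2_def by (intro L2_add L2_Linf_mult Linf_diff aL u wL cL dL)
  define N where "N = \<bar>Nc\<bar> + \<bar>Nb\<bar>"
  have "Linf_norm U c \<le> ereal Nc" using Nc unfolding W1inf_norm_def by (meson max.cobounded1 order_trans)
  from AE_abs_le_of_Linf_norm[OF this] have c_ae: "AE x in lebesgue_on U. \<bar>c x\<bar> \<le> Nc" .
  have "Linf_norm U (weak_div U b) \<le> ereal Nb"
    using Nb unfolding W1inf_div_norm_def W1inf_norm_def by (meson max.cobounded1 max.cobounded2 order_trans)
  from AE_abs_le_of_Linf_norm[OF this] have d_ae: "AE x in lebesgue_on U. \<bar>weak_div U b x\<bar> \<le> Nb" .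
  have i1: "integrable (lebesgue_on U) (\<lambda>x. (w x - u x)\<^sup>2)" "integrable (lebesgue_on U) (\<lambda>x. (X2 x)\<^sup>2)"
    "integrable (lebesgue_on U) (\<lambda>x. (?f x)\<^sup>2)" "integrable (lebesgue_on U) (\<lambda>x. (u x)\<^sup>2)" "integrable (lebesgue_on U) (\<lambda>x. (w x)\<^sup>2)"
    using X1L X2L f u wL by (simp_all add: L2_def)
  let ?X = "LINT x|lebesgue_on U. (w x - u x)\<^sup>2 + (X2 x)\<^sup>2"
  have Xe: "?X = (LINT x|lebesgue_on U. (w x - u x)\<^sup>2) + (LINT x|lebesgue_on U. (X2 x)\<^sup>2)"
    using i1 by simp
  have X0: "(LINT x|lebesgue_on U. (w x - u x)\<^sup>2) \<le> ?X" unfolding Xe by simp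
  have sq: "(s + t)\<^sup>2 \<le> 2 * s\<^sup>2 + 2 * t\<^sup>2" for s t :: real
    using zero_le_power2[of "s - t"] by (auto simp: power2_eq_square algebra_simps)
  have "(L2_norm U ?f)\<^sup>2 \<le> (LINT x|lebesgue_on U. 2 * (1 + N\<^sup>2) * ((w x - u x)\<^sup>2 + (X2 x)\<^sup>2))"
    unfolding L2_norm_sq
  proof (rule integral_mono_AE)
    show "AE x in lebesgue_on U. (?f x)\<^sup>2 \<le> 2 * (1 + N\<^sup>2) * ((w x - u x)\<^sup>2 + (X2 x)\<^sup>2)"
      using c_ae d_ae
    proof eventually_elim
      case (elim x)
      have "?f x = X2 x + (c x - weak_div U b x) * (w x - u x)"
        by (simp add: transport_op_def X2_def algebra_simps)
      then have "(?f x)\<^sup>2 \<le> 2 * (X2 x)\<^sup>2 + 2 * ((c x - weak_div U b x)\<^sup>2 * (w x - u x)\<^sup>2)"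
        using sq[of "X2 x" "(c x - weak_div U b x) * (w x - u x)"] by (simp add: power_mult_distrib)
      moreover have "(c x - weak_div U b x)\<^sup>2 \<le> N\<^sup>2"
        using elim by (intro power2_le_iff_abs_le[THEN iffD2]) (auto simp: N_def)
      then have "(c x - weak_div U b x)\<^sup>2 * (w x - u x)\<^sup>2 \<le> N\<^sup>2 * (w x - u x)\<^sup>2" by (rule mult_right_mono) auto
      ultimately show ?case
        using zero_le_power2[of "w x - u x"] mult_nonneg_nonneg[OF zero_le_power2[of N] zero_le_power2[of "X2 x"]]
        unfolding distrib_left distrib_right by linarith
    qed
  qed (use i1 in auto)
  then have f2: "(L2_norm U ?f)\<^sup>2 \<le> 2 * (1 + N\<^sup>2) * ?X" by simp
  have "H_norm U b w \<le> \<bar>NB\<bar> * L2_norm U ?f" by (rule transport_stability[OF U b cL inv NB w])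
  then have "(H_norm U b w)\<^sup>2 \<le> (\<bar>NB\<bar> * L2_norm U ?f)\<^sup>2" by (rule power_mono) (simp add: H_norm_def)
  also have "\<dots> = NB\<^sup>2 * (L2_norm U ?f)\<^sup>2" by (simp add: power_mult_distrib)
  also have "\<dots> \<le> NB\<^sup>2 * (2 * (1 + N\<^sup>2) * ?X)" by (intro mult_left_mono f2) auto
  finally have H2: "(H_norm U b w)\<^sup>2 \<le> NB\<^sup>2 * (2 * (1 + N\<^sup>2) * ?X)" .
  have wl: "(L2_norm U w)\<^sup>2 \<le> (H_norm U b w)\<^sup>2" by (simp add: H_norm_def)
  have "(L2_norm U u)\<^sup>2 \<le> (LINT x|lebesgue_on U. 2 * (w x)\<^sup>2 + 2 * (w x - u x)\<^sup>2)"
    unfolding L2_norm_sq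
  proof (rule integral_mono_AE)
    show "AE x in lebesgue_on U. (u x)\<^sup>2 \<le> 2 * (w x)\<^sup>2 + 2 * (w x - u x)\<^sup>2"
    proof (rule AE_I2)
      fix x show "(u x)\<^sup>2 \<le> 2 * (w x)\<^sup>2 + 2 * (w x - u x)\<^sup>2"
        using sq[of "w x" "u x - w x"] by (simp add: power2_commute)
    qed
  qed (use i1 in auto)
  also have "\<dots> = 2 * (L2_norm U w)\<^sup>2 + 2 * (LINT x|lebesgue_on U. (w x - u x)\<^sup>2)"
    unfolding L2_norm_sq using i1 by simp
  also have "\<dots> \<le> 2 * (H_norm U b w)\<^sup>2 + 2 * ?X" using wl X0 by linarith
  finally have u2: "(L2_norm U u)\<^sup>2 \<le> 2 * (H_norm U b w)\<^sup>2 + 2 * ?X" .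
  have "(U_norm U b u w)\<^sup>2 = (L2_norm U u)\<^sup>2 + (H_norm U b w)\<^sup>2" by (simp add: U_norm_def)
  also have "\<dots> \<le> 3 * (NB\<^sup>2 * (2 * (1 + N\<^sup>2) * ?X)) + 2 * ?X" using u2 H2 by linarith
  also have "\<dots> = stability_constant Nb Nc NB * ?X" by (simp add: stability_constant_def N_def algebra_simps)
  finally show ?thesis .
qed

section \<open>Local averages of the coefficients\<close>

text \<open>One L serves b, c and div b on all convex subsets. As |b| is at least \<beta>1 almost
  everywhere and differs from its average by at most L diam K, the last bound makes the averages
  nonzero once diam K is small.\<close>

lemma data_constants:
  fixes b :: "'a::euclidean_space \<Rightarrow> 'a"
  assumes U: "open U" and b: "b \<in> W1inf_div U" and c: "c \<in> W1inf U" and inv: "inv_abs_norm U b < \<infinity>"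
  shows "\<exists>L\<ge>0. \<exists>M. \<exists>\<beta>1>0. \<forall>K. open K \<longrightarrow> convex K \<longrightarrow> bounded K \<longrightarrow> K \<noteq> {} \<longrightarrow> K \<subseteq> U \<longrightarrow> diameter K \<le> 1 \<longrightarrow>
    (\<exists>N. negligible N \<and> (\<forall>x\<in>K - N. \<forall>y\<in>K - N. norm (b x - b y) \<le> L * norm (x - y)) \<and>
      (\<forall>x\<in>K - N. norm (b x - average K b) \<le> L * diameter K \<and>
        \<bar>c x - weak_div U b x - average K (\<lambda>x. c x - weak_div U b x)\<bar> \<le> L * diameter K \<and>
        \<bar>weak_div U b x - average K (weak_div U b)\<bar> \<le> L * diameter K)) \<and>
    \<bar>average K (\<lambda>x. c x - weak_div U b x)\<bar> \<le> M \<and> \<bar>average K (weak_div U b)\<bar> \<le> M \<and>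
    \<beta>1 \<le> norm (average K b) + L * diameter K"
proof -
  have Us: "U \<in> sets lebesgue" using U by simp
  have d: "weak_div U b \<in> W1inf U" and bi: "\<And>i. i \<in> Basis \<Longrightarrow> (\<lambda>x. b x \<bullet> i) \<in> W1inf U"
    using b by (auto simp: W1inf_div_def)
  let ?lip = "\<lambda>f L. L \<ge> 0 \<and> (\<forall>K. open K \<longrightarrow> convex K \<longrightarrow> bounded K \<longrightarrow> K \<subseteq> U \<longrightarrow>
    (\<exists>N. negligible N \<and> (\<forall>x\<in>K - N. \<forall>y\<in>K - N. \<bar>f x - f y\<bar> \<le> L * norm (x - y))))"
  obtain Lc where Lc: "?lip c Lc" using W1inf_lipschitz[OF c Us] by blast
  obtain Ld where Ld: "?lip (weak_div U b) Ld" using W1inf_lipschitz[OF d Us] by blast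
  have "\<forall>i\<in>Basis. \<exists>L. ?lip (\<lambda>x. b x \<bullet> i) L" using W1inf_lipschitz[OF bi Us] by blast
  then obtain Lb where Lb: "\<And>i. i \<in> Basis \<Longrightarrow> ?lip (\<lambda>x. b x \<bullet> i) (Lb i)" by metis
  define L where "L = Lc + Ld + (\<Sum>i\<in>Basis. Lb i)"
  have sb0: "0 \<le> (\<Sum>i\<in>Basis. Lb i)" using Lb by (intro sum_nonneg) blast
  have L0: "L \<ge> 0" "Lc + Ld \<le> L" "Ld \<le> L" "(\<Sum>i\<in>Basis. Lb i) \<le> L"
    using Lc Ld sb0 by (auto simp: L_def)
  obtain Bc where Bc: "AE x in lebesgue_on U. \<bar>c x\<bar> \<le> Bc" using c by (auto simp: W1inf_def Linf_iff)
  obtain Bd where Bd: "AE x in lebesgue_on U. \<bar>weak_div U b x\<bar> \<le> Bd" using d by (auto simp: W1inf_def Linf_iff)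
  have inv_ae: "AE x in lebesgue_on U. inverse (ereal (norm (b x))) \<le> inv_abs_norm U b"
    unfolding inv_abs_norm_def by (rule esssup_AE)
  obtain Ni where Ni: "Ni > 0" "inv_abs_norm U b \<le> ereal Ni"
  proof -
    have "\<exists>k. inv_abs_norm U b \<le> ereal k" using inv by (cases "inv_abs_norm U b") auto
    then obtain k where "inv_abs_norm U b \<le> ereal k" by blast
    \<comment> \<open>The maximum with 1 makes the bound positive, so that it can be
      inverted.\<close>
    moreover have "ereal k \<le> ereal (max 1 k)" by simp
    ultimately show ?thesis using that[of "max 1 k"] by (metis less_max_iff_disj order_trans zero_less_one)
  qed
  have b_ae: "AE x in lebesgue_on U. 1 / Ni \<le> norm (b x)"
    using inv_ae
  proof eventually_elim
    case (elim x)
    then have "inverse (ereal (norm (b x))) \<le> ereal Ni" using Ni(2) by (rule order_trans)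
    then have "norm (b x) \<noteq> 0" "inverse (norm (b x)) \<le> Ni" by (auto split: if_splits)
    then show ?case using Ni(1) by (simp add: field_simps)
  qed
  define M where "M = Bc + Bd + L"
  show ?thesis
  proof (rule exI[of _ L], rule conjI[OF L0(1)], rule exI[of _ "\<bar>M\<bar> + \<bar>Bd\<bar> + L"], rule exI[of _ "1 / Ni"], intro conjI allI impI)
    show "0 < 1 / Ni" using Ni by simp
    fix K :: "'a set" assume K: "open K" "convex K" "bounded K" "K \<noteq> {}" "K \<subseteq> U" "diameter K \<le> 1"
    have Ks: "K \<in> sets lebesgue" and Km: "K \<in> lmeasurable" using K by (auto simp: lmeasurable_open)
    have sub: "f \<in> Linf K" if "f \<in> W1inf U" for f
      using that Linf_subset[OF _ K(5) Ks Us] by (auto simp: W1inf_def)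
    obtain Nc where Nc: "negligible Nc" "\<forall>x\<in>K - Nc. \<forall>y\<in>K - Nc. \<bar>c x - c y\<bar> \<le> Lc * norm (x - y)"
      using Lc K by blast
    obtain Nd where Nd: "negligible Nd" "\<forall>x\<in>K - Nd. \<forall>y\<in>K - Nd. \<bar>weak_div U b x - weak_div U b y\<bar> \<le> Ld * norm (x - y)"
      using Ld K by blast
    have "\<forall>i\<in>Basis. \<exists>N. negligible N \<and> (\<forall>x\<in>K - N. \<forall>y\<in>K - N. \<bar>b x \<bullet> i - b y \<bullet> i\<bar> \<le> Lb i * norm (x - y))"
      using Lb K by blast
    then obtain Nb where Nb: "\<And>i. i \<in> Basis \<Longrightarrow> negligible (Nb i)"
      "\<And>i x y. i \<in> Basis \<Longrightarrow> x \<in> K - Nb i \<Longrightarrow> y \<in> K - Nb i \<Longrightarrow> \<bar>b x \<bullet> i - b y \<bullet> i\<bar> \<le> Lb i * norm (x - y)"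
      by metis
    define N where "N = Nc \<union> Nd \<union> (\<Union>i\<in>Basis. Nb i)"
    have Nneg: "negligible N" unfolding N_def using Nc Nd Nb by (intro negligible_Un negligible_Union) auto
    have Dl: "\<bar>weak_div U b x - weak_div U b y\<bar> \<le> Ld * norm (x - y)"
      and Cl: "\<bar>(c x - weak_div U b x) - (c y - weak_div U b y)\<bar> \<le> (Lc + Ld) * norm (x - y)"
      and Bl: "\<And>i. i \<in> Basis \<Longrightarrow> \<bar>b x \<bullet> i - b y \<bullet> i\<bar> \<le> Lb i * norm (x - y)"
      if "x \<in> K - N" "y \<in> K - N" for x y
    proof -
      show D: "\<bar>weak_div U b x - weak_div U b y\<bar> \<le> Ld * norm (x - y)" using Nd(2) that by (auto simp: N_def)
      have "\<bar>c x - c y\<bar> \<le> Lc * norm (x - y)" using Nc(2) that by (auto simp: N_def)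
      then show "\<bar>(c x - weak_div U b x) - (c y - weak_div U b y)\<bar> \<le> (Lc + Ld) * norm (x - y)"
        using D unfolding distrib_right by linarith
      show "\<bar>b x \<bullet> i - b y \<bullet> i\<bar> \<le> Lb i * norm (x - y)" if "i \<in> Basis" for i
        using Nb(2)[OF that] \<open>x \<in> K - N\<close> \<open>y \<in> K - N\<close> that by (auto simp: N_def)
    qed
    have dK: "diameter K \<ge> 0" by (rule diameter_ge_0[OF K(3)])
    have avD: "\<bar>weak_div U b x - average K (weak_div U b)\<bar> \<le> L * diameter K" if "x \<in> K - N" for x
    proof -
      have "\<bar>weak_div U b x - average K (weak_div U b)\<bar> \<le> Ld * diameter K"
        using Ld by (intro average_close[OF K(1,3,4) sub[OF d] _ Nneg Dl that]) auto
      also have "\<dots> \<le> L * diameter K" by (rule mult_right_mono[OF L0(3) dK])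
      finally show ?thesis .
    qed
    have avC: "\<bar>c x - weak_div U b x - average K (\<lambda>x. c x - weak_div U b x)\<bar> \<le> L * diameter K" if "x \<in> K - N" for x
    proof -
      have "\<bar>c x - weak_div U b x - average K (\<lambda>x. c x - weak_div U b x)\<bar> \<le> (Lc + Ld) * diameter K"
        using Ld Lc by (intro average_close[OF K(1,3,4) Linf_diff[OF sub[OF c] sub[OF d]] _ Nneg Cl that]) auto
      also have "\<dots> \<le> L * diameter K" by (rule mult_right_mono[OF L0(2) dK])
      finally show ?thesis .
    qed
    have bint: "integrable (lebesgue_on K) b"
    proof -
      have "b = (\<lambda>x. \<Sum>i\<in>Basis. (b x \<bullet> i) *\<^sub>R i)" by (simp add: euclidean_representation)
      moreover have "integrable (lebesgue_on K) (\<lambda>x. \<Sum>i\<in>Basis. (b x \<bullet> i) *\<^sub>R i)"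
        using Linf_integrable[OF Km sub[OF bi]]
        by (intro Bochner_Integration.integrable_sum integrable_scaleR_left) auto
      ultimately show ?thesis by simp
    qed
    have avi: "average K b \<bullet> i = average K (\<lambda>x. b x \<bullet> i)" for i
      using bint by (simp add: average_def)
    have avB: "norm (b x - average K b) \<le> L * diameter K" if x: "x \<in> K - N" for x
    proof -
      have "norm (b x - average K b) \<le> (\<Sum>i\<in>Basis. \<bar>(b x - average K b) \<bullet> i\<bar>)" by (rule norm_le_l1)
      also have "\<dots> \<le> (\<Sum>i\<in>Basis. Lb i * diameter K)"
      proof (rule sum_mono)
        fix i :: 'a assume i: "i \<in> Basis"
        have "\<bar>b x \<bullet> i - average K (\<lambda>x. b x \<bullet> i)\<bar> \<le> Lb i * diameter K"
          using Lb[OF i] Bl[OF _ _ i] by (intro average_close[OF K(1,3,4) sub[OF bi[OF i]] _ Nneg _ x]) auto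
        then show "\<bar>(b x - average K b) \<bullet> i\<bar> \<le> Lb i * diameter K" by (simp add: inner_diff_left avi)
      qed
      also have "\<dots> = (\<Sum>i\<in>Basis. Lb i) * diameter K" by (simp add: sum_distrib_right)
      also have "\<dots> \<le> L * diameter K" by (rule mult_right_mono[OF L0(4) dK])
      finally show ?thesis .
    qed
    have blip: "norm (b x - b y) \<le> L * norm (x - y)" if "x \<in> K - N" "y \<in> K - N" for x y
    proof -
      have "norm (b x - b y) \<le> (\<Sum>i\<in>Basis. \<bar>(b x - b y) \<bullet> i\<bar>)" by (rule norm_le_l1)
      also have "\<dots> \<le> (\<Sum>i\<in>Basis. Lb i * norm (x - y))"
        using Bl[OF that] by (intro sum_mono) (simp add: inner_diff_left)
      also have "\<dots> = (\<Sum>i\<in>Basis. Lb i) * norm (x - y)" by (simp add: sum_distrib_right)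
      also have "\<dots> \<le> L * norm (x - y)" by (rule mult_right_mono[OF L0(4)]) simp
      finally show ?thesis .
    qed
    show "\<exists>N. negligible N \<and> (\<forall>x\<in>K - N. \<forall>y\<in>K - N. norm (b x - b y) \<le> L * norm (x - y)) \<and>
      (\<forall>x\<in>K - N. norm (b x - average K b) \<le> L * diameter K \<and>
        \<bar>c x - weak_div U b x - average K (\<lambda>x. c x - weak_div U b x)\<bar> \<le> L * diameter K \<and>
        \<bar>weak_div U b x - average K (weak_div U b)\<bar> \<le> L * diameter K)"
      by (intro exI[of _ N] conjI ballI Nneg blip avB avC avD; assumption)
    \<comment> \<open>K has positive measure, so it has a point outside all exceptional sets.
      Comparing the averages with the values at that point gives the three remaining bounds.\<close>
    have "AE x in lebesgue. (x \<in> U \<longrightarrow> \<bar>c x\<bar> \<le> Bc) \<and> (x \<in> U \<longrightarrow> \<bar>weak_div U b x\<bar> \<le> Bd) \<and> (x \<in> U \<longrightarrow> 1 / Ni \<le> norm (b x))"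
      using Bc Bd b_ae Us by (simp add: AE_restrict_space_iff)
    then have "AE x in lebesgue. x \<in> K \<longrightarrow> \<bar>c x\<bar> \<le> Bc \<and> \<bar>weak_div U b x\<bar> \<le> Bd \<and> 1 / Ni \<le> norm (b x)"
      by eventually_elim (use K(5) in blast)
    moreover have "AE x in lebesgue. x \<notin> N" using Nneg by (intro AE_not_in) (simp add: negligible_iff_null_sets)
    ultimately have "AE x in lebesgue. x \<in> K \<longrightarrow> x \<notin> N \<and> \<bar>c x\<bar> \<le> Bc \<and> \<bar>weak_div U b x\<bar> \<le> Bd \<and> 1 / Ni \<le> norm (b x)"
      by eventually_elim auto
    then have "negligible {x. \<not> (x \<in> K \<longrightarrow> x \<notin> N \<and> \<bar>c x\<bar> \<le> Bc \<and> \<bar>weak_div U b x\<bar> \<le> Bd \<and> 1 / Ni \<le> norm (b x))}"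
      by (simp add: negligible_iff_null_sets completion.AE_iff_null_sets)
    moreover have "\<not> negligible K" using open_not_negligible K by blast
    ultimately obtain x where x: "x \<in> K - N" "\<bar>c x\<bar> \<le> Bc" "\<bar>weak_div U b x\<bar> \<le> Bd" "1 / Ni \<le> norm (b x)"
      using negligible_subset by blast
    have LK: "L * diameter K \<le> L" using K(6) L0(1) by (simp add: mult_left_le)
    show "\<bar>average K (\<lambda>x. c x - weak_div U b x)\<bar> \<le> \<bar>M\<bar> + \<bar>Bd\<bar> + L"
      using avC[OF x(1)] x(2,3) LK unfolding M_def by linarith
    show "\<bar>average K (weak_div U b)\<bar> \<le> \<bar>M\<bar> + \<bar>Bd\<bar> + L"
      using avD[OF x(1)] x(3) LK by linarith
    show "1 / Ni \<le> norm (average K b) + L * diameter K"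
      using avB[OF x(1)] x(4) norm_triangle_ineq2[of "b x" "average K b"] by linarith
  qed
qed

section \<open>The error of the test function on one element\<close>

text \<open>Two polynomials that agree on a nonempty open set agree everywhere, so the choice in
  \<open>poly_ext\<close> is forced.\<close>

lemma poly_ext_eq:
  assumes "open K" "K \<noteq> {}" "poly_le m p" "\<And>x. x \<in> K \<Longrightarrow> u x = p x"
  shows "poly_ext m K u = p"
proof -
  have "\<exists>q. q \<in> polys m \<and> (\<forall>x\<in>K. u x = q x)" using assms by (auto simp: polys_iff_poly_le)
  from someI_ex[OF this] have q: "poly_le m (poly_ext m K u)" "\<forall>x\<in>K. u x = poly_ext m K u x"
    unfolding poly_ext_def polys_iff_poly_le by blast+
  obtain a where a: "a \<in> K" using assms(2) by blast
  have "poly_ext m K u x - p x = 0" for x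
    by (rule poly_le_zero_on_open[OF poly_le_diff[OF q(1) assms(3)] assms(1) a]) (use q(2) assms(4) in simp)
  then show ?thesis by (auto simp: fun_eq_iff)
qed

lemma integral_subset_le:
  fixes f g :: "'a::euclidean_space \<Rightarrow> real"
  assumes "S \<subseteq> U" "S \<in> sets lebesgue" "U \<in> sets lebesgue" and f: "integrable (lebesgue_on S) f" and g: "integrable (lebesgue_on U) g"
    and le: "\<And>x. x \<in> S \<Longrightarrow> f x \<le> g x" and nn: "\<And>x. x \<in> U \<Longrightarrow> 0 \<le> g x"
  shows "(LINT x|lebesgue_on S. f x) \<le> (LINT x|lebesgue_on U. g x)"
proof -
  have "(LINT x|lebesgue_on S. f x) = (LINT x|lebesgue_on U. (if x \<in> S then f x else 0))"
    by (rule integral_if_subset(2)[OF assms(1-4), symmetric])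
  also have "\<dots> \<le> (LINT x|lebesgue_on U. g x)"
    using le nn by (intro integral_mono integral_if_subset(1)[OF assms(1-4)] g) auto
  finally show ?thesis .
qed

lemma sum3_sq_le: "(a + b + c)\<^sup>2 \<le> 3 * (a\<^sup>2 + b\<^sup>2 + (c::real)\<^sup>2)"
  using zero_le_power2[of "a - b"] zero_le_power2[of "b - c"] zero_le_power2[of "a - c"]
  by (simp add: power2_eq_square algebra_simps)

text \<open>Replacing the average of b over a subelement by b itself costs a term of lower order, which
  the inverse estimate absorbs.\<close>

lemma directional_derivative_L2:
  fixes b :: "'a::euclidean_space \<Rightarrow> 'a"
  assumes W: "poly_le m W" and V: "V = (\<lambda>x. frechet_derivative W (at x) \<beta>)" and r: "r > 0"
    and lip: "\<And>x y. x \<in> ball a r \<Longrightarrow> y \<in> ball a r \<Longrightarrow> \<bar>W x - W y\<bar> \<le> \<Lambda> / r * norm (x - y)" and \<Lambda>: "\<Lambda> \<ge> 0"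
    and g: "g \<in> L2 (ball a r)" "AE x in lebesgue_on (ball a r). g x = frechet_derivative W (at x) (b x)"
    and b: "AE x in lebesgue_on (ball a r). norm (b x - \<beta>) \<le> B * r"
  shows "(LINT x|lebesgue_on (ball a r). (V x)\<^sup>2) / r ^ DIM('a)
    \<le> 2 * ((LINT x|lebesgue_on (ball a r). (g x)\<^sup>2) / r ^ DIM('a)) + 2 * unit_ball_vol DIM('a) * (\<Lambda> * B)\<^sup>2"
proof -
  have Vp: "poly_le m V" unfolding V by (rule poly_le_frechet_derivative[OF W])
  have Wd: "(W has_derivative frechet_derivative W (at x)) (at x)" for x
    using poly_le_differentiable[OF W] frechet_derivative_works by blast
  have ci: "integrable (lebesgue_on (ball a r)) (\<lambda>x. c)" for c :: real
    by (rule Linf_integrable[OF _ Linf_const]) simp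
  have gi: "integrable (lebesgue_on (ball a r)) (\<lambda>x. (g x)\<^sup>2)" using g(1) by (simp add: L2_def)
  have Vi: "integrable (lebesgue_on (ball a r)) (\<lambda>x. (V x)\<^sup>2)"
    using poly_le_integrable[OF poly_le_prod[OF Vp Vp], of "ball a r"] by (simp add: power2_eq_square)
  have "(LINT x|lebesgue_on (ball a r). (V x)\<^sup>2) \<le> (LINT x|lebesgue_on (ball a r). 2 * (g x)\<^sup>2 + 2 * (\<Lambda> * B)\<^sup>2)"
  proof (rule integral_mono_AE)
    have "AE x in lebesgue_on (ball a r). x \<in> ball a r" by (rule AE_I2) simp
    then show "AE x in lebesgue_on (ball a r). (V x)\<^sup>2 \<le> 2 * (g x)\<^sup>2 + 2 * (\<Lambda> * B)\<^sup>2"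
      using g(2) b
    proof eventually_elim
      case (elim x)
      have "V x = g x - frechet_derivative W (at x) (b x - \<beta>)"
        using linear_diff[OF has_derivative_linear[OF Wd[of x]]] elim(2) by (simp add: V)
      moreover have "\<bar>frechet_derivative W (at x) (b x - \<beta>)\<bar> \<le> \<Lambda> / r * norm (b x - \<beta>)"
        by (rule derivative_le_lipschitz[OF Wd open_ball elim(1) lip])
      then have "\<bar>frechet_derivative W (at x) (b x - \<beta>)\<bar> \<le> \<Lambda> / r * (B * r)"
        using elim(3) \<Lambda> r by (meson order_trans mult_left_mono divide_nonneg_pos)
      then have "\<bar>frechet_derivative W (at x) (b x - \<beta>)\<bar> \<le> \<Lambda> * B" using r by simp
      then have "(frechet_derivative W (at x) (b x - \<beta>))\<^sup>2 \<le> (\<Lambda> * B)\<^sup>2" by (rule power2_le_iff_abs_le[THEN iffD2, rotated]) (use \<open>_ \<le> \<Lambda> * B\<close> in linarith)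
      moreover have "(s - t)\<^sup>2 \<le> 2 * s\<^sup>2 + 2 * t\<^sup>2" for s t :: real
        using zero_le_power2[of "s + t"] by (auto simp: power2_eq_square algebra_simps)
      ultimately show ?case by (smt (verit))
    qed
  qed (use ci gi Vi in auto)
  also have "\<dots> = 2 * (LINT x|lebesgue_on (ball a r). (g x)\<^sup>2) + 2 * (\<Lambda> * B)\<^sup>2 * (unit_ball_vol DIM('a) * r ^ DIM('a))"
    using ci gi r by (simp add: measure_restrict_space content_ball)
  finally show ?thesis using r by (simp add: field_simps)
qed

text \<open>The constants are fixed before the elements. \<kappa> bounds both the diameter of K' in
  terms of the radius of its inscribed ball and the shape of K. The right-hand side is a mean
  density over K', constant on K, so that integrating over the subelements of K' does not count
  them. The function v is prescribed on K only, since the test function is glued from different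
  elements.\<close>

lemma element_error:
  fixes b :: "'a::euclidean_space \<Rightarrow> 'a"
  assumes U: "open \<Omega>" and b: "b \<in> W1inf_div \<Omega>" and c: "c \<in> W1inf \<Omega>" and inv: "inv_abs_norm \<Omega> b < \<infinity>"
    and \<kappa>: "\<kappa> > 0"
  shows "\<exists>Cf\<ge>0. \<exists>\<sigma>1>0. \<sigma>1 \<le> 1 \<and> (\<forall>K' K x0 r \<sigma> pu pw u w F.
    open_simplex K' \<longrightarrow> K' \<subseteq> \<Omega> \<longrightarrow> r > 0 \<longrightarrow> ball x0 r \<subseteq> K' \<longrightarrow> diameter K' \<le> \<kappa> * r \<longrightarrow> diameter K' \<le> \<sigma> \<longrightarrow>
    open_simplex K \<longrightarrow> K \<subseteq> K' \<longrightarrow> 4 * shape_param K \<le> \<kappa> \<longrightarrow> diameter K \<le> \<sigma> * diameter K' \<longrightarrow> 0 < \<sigma> \<longrightarrow> \<sigma> \<le> \<sigma>1 \<longrightarrow>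
    average K b \<noteq> 0 \<and>
    (poly_le m pu \<longrightarrow> poly_le m pw \<longrightarrow> (\<forall>x\<in>K'. u x = pu x \<and> w x = pw x) \<longrightarrow> w \<in> H_adv \<Omega> b \<longrightarrow>
     steepest_inflow_face K (average K b) F \<longrightarrow>
     poly_le (Suc m) (breve_t_elem \<Omega> b c m K F u w) \<and>
     (\<forall>v. (\<forall>x\<in>K. v x = breve_t_elem \<Omega> b c m K F u w x) \<longrightarrow>
       (AE x in lebesgue_on K. (w x - u x - adv K b v x)\<^sup>2
          + (adv \<Omega> b w x + (c x - weak_div \<Omega> b x) * u x + weak_div \<Omega> b x * w x - v x)\<^sup>2
        \<le> Cf * \<sigma>\<^sup>2 * ((LINT x|lebesgue_on K'. (u x)\<^sup>2 + (w x)\<^sup>2 + (adv \<Omega> b w x)\<^sup>2) / r ^ DIM('a))))))"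
proof -
  obtain L M \<beta>1 where L: "L \<ge> 0" and \<beta>1: "\<beta>1 > 0" and data: "\<And>K. open K \<Longrightarrow> convex K \<Longrightarrow> bounded K \<Longrightarrow> K \<noteq> {} \<Longrightarrow> K \<subseteq> \<Omega> \<Longrightarrow> diameter K \<le> 1 \<Longrightarrow>
    (\<exists>N. negligible N \<and> (\<forall>x\<in>K - N. \<forall>y\<in>K - N. norm (b x - b y) \<le> L * norm (x - y)) \<and>
      (\<forall>x\<in>K - N. norm (b x - average K b) \<le> L * diameter K \<and>
        \<bar>c x - weak_div \<Omega> b x - average K (\<lambda>x. c x - weak_div \<Omega> b x)\<bar> \<le> L * diameter K \<and>
        \<bar>weak_div \<Omega> b x - average K (weak_div \<Omega> b)\<bar> \<le> L * diameter K)) \<and>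
    \<bar>average K (\<lambda>x. c x - weak_div \<Omega> b x)\<bar> \<le> M \<and> \<bar>average K (weak_div \<Omega> b)\<bar> \<le> M \<and>
    \<beta>1 \<le> norm (average K b) + L * diameter K"
    using data_constants[OF U b c inv] by (elim exE conjE) blast
  \<comment> \<open>Points of K' lie within \<kappa> r of the centre, and their upwind points within
    another \<kappa> diam K \<le> \<kappa>^2 r; the summand 1 keeps the inscribed ball
    inside.\<close>
  define R where "R = \<kappa> * (1 + \<kappa>) + 1"
  have R: "\<kappa> \<le> R" "\<kappa> + \<kappa> * \<kappa> \<le> R" "1 \<le> R" using \<kappa> by (auto simp: R_def algebra_simps)
  obtain CI where CI: "CI \<ge> 0" "\<And>(q::'a \<Rightarrow> real) a r x y. poly_le m q \<Longrightarrow> r > 0 \<Longrightarrow> x\<in>cball a (R * r) \<Longrightarrow> y\<in>cball a (R * r) \<Longrightarrow>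
     \<bar>q x\<bar> \<le> CI * sqrt ((LINT x|lebesgue_on (ball a r). (q x)\<^sup>2) / r ^ DIM('a)) \<and>
     \<bar>q x - q y\<bar> \<le> CI * (norm (x - y) / r) * sqrt ((LINT x|lebesgue_on (ball a r). (q x)\<^sup>2) / r ^ DIM('a))"
    using inverse_estimate[where 'a='a, of m R] by (elim exE conjE) blast
  define \<beta>0 where "\<beta>0 = \<beta>1 / 2"
  have \<beta>0: "\<beta>0 > 0" using \<beta>1 by (simp add: \<beta>0_def)
  \<comment> \<open>The bound 1 makes the diameters at most 1; 1 / \<kappa> makes \<kappa> \<sigma>,
    the bound for diam K / r, at most 1; and the last one makes L diam K at most \<beta>0, which
    leaves \<beta>0 of \<beta>1 = 2 \<beta>0 for the averaged velocity.\<close>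
  define \<sigma>1 where "\<sigma>1 = min 1 (min (1 / \<kappa>) (\<beta>0 / (L + 1)))"
  have \<sigma>1: "\<sigma>1 > 0" "\<sigma>1 \<le> 1" "\<sigma>1 \<le> 1 / \<kappa>" "\<sigma>1 \<le> \<beta>0 / (L + 1)" using \<kappa> \<beta>0 L by (auto simp: \<sigma>1_def)
  define C1 where "C1 = 2 * \<kappa> / \<beta>0 + \<kappa> + L + 2 * (M * \<kappa> + L)"
  define C2 where "C2 = 2 * \<kappa> + L * ((2 * \<kappa> + 2 * \<kappa> * (1 + \<kappa>)) / \<beta>0 + (1 + 2 * M) * (1 + \<kappa>))"
  define CV where "CV = 2 * unit_ball_vol DIM('a) * (CI * (2 * L * \<kappa>))\<^sup>2"
  have CV: "CV \<ge> 0" by (simp add: CV_def)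
  \<comment> \<open>The two local errors are A \<kappa> \<sigma> times C1 and C2. The last factor
    bounds A^2 by the coarse density: the 3 comes from squaring a sum of three terms, and 4 + CV
    counts u and w once each and V with weight 2 + CV.\<close>
  define Cf where "Cf = \<kappa>\<^sup>2 * (C1\<^sup>2 + C2\<^sup>2) * (3 * CI\<^sup>2 * (4 + CV))"
  have Cf: "Cf \<ge> 0" using CV by (simp add: Cf_def)
  have main: "average K b \<noteq> 0 \<and>
    (poly_le m pu \<longrightarrow> poly_le m pw \<longrightarrow> (\<forall>x\<in>K'. u x = pu x \<and> w x = pw x) \<longrightarrow> w \<in> H_adv \<Omega> b \<longrightarrow>
     steepest_inflow_face K (average K b) F \<longrightarrow>
     poly_le (Suc m) (breve_t_elem \<Omega> b c m K F u w) \<and>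
     (\<forall>v. (\<forall>x\<in>K. v x = breve_t_elem \<Omega> b c m K F u w x) \<longrightarrow>
       (AE x in lebesgue_on K. (w x - u x - adv K b v x)\<^sup>2
          + (adv \<Omega> b w x + (c x - weak_div \<Omega> b x) * u x + weak_div \<Omega> b x * w x - v x)\<^sup>2
        \<le> Cf * \<sigma>\<^sup>2 * ((LINT x|lebesgue_on K'. (u x)\<^sup>2 + (w x)\<^sup>2 + (adv \<Omega> b w x)\<^sup>2) / r ^ DIM('a)))))"
    if K': "open_simplex K'" "K' \<subseteq> \<Omega>" and r: "r > 0" "ball x0 r \<subseteq> K'" "diameter K' \<le> \<kappa> * r" and dK': "diameter K' \<le> \<sigma>"
      and K: "open_simplex K" "K \<subseteq> K'" and sh: "4 * shape_param K \<le> \<kappa>" and dK: "diameter K \<le> \<sigma> * diameter K'"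
      and \<sigma>: "0 < \<sigma>" "\<sigma> \<le> \<sigma>1" for K' K x0 r \<sigma> pu pw u w F
  proof -
    note Kf = open_simplex_facts[OF K(1)] and K'f = open_simplex_facts[OF K'(1)]
    have d'0: "diameter K' \<ge> 0" and d0: "diameter K \<ge> 0" using diameter_ge_0 Kf(3) K'f(3) by auto
    have \<sigma>l: "\<sigma> \<le> 1" using \<sigma> \<sigma>1 by simp
    have dd: "diameter K \<le> diameter K'" using dK \<sigma>l d'0 by (smt (verit) mult_left_le_one_le \<sigma>(1))
    have d1: "diameter K' \<le> 1" "diameter K \<le> 1" using dK' \<sigma>l dd by auto
    have d\<sigma>: "diameter K \<le> \<sigma>" using dd dK' by simp
    have K\<Omega>: "K \<subseteq> \<Omega>" using K K' by blast
    have \<Omega>s: "\<Omega> \<in> sets lebesgue" and K's: "K' \<in> sets lebesgue" and Ks: "K \<in> sets lebesgue" using U K'f Kf by auto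
    define \<beta> where "\<beta> = average K b"
    define cK where "cK = average K (\<lambda>x. c x - weak_div \<Omega> b x)"
    define d_K where "d_K = average K (weak_div \<Omega> b)"
    obtain N where N: "negligible N" "\<forall>x\<in>K - N. norm (b x - \<beta>) \<le> L * diameter K \<and>
        \<bar>c x - weak_div \<Omega> b x - cK\<bar> \<le> L * diameter K \<and> \<bar>weak_div \<Omega> b x - d_K\<bar> \<le> L * diameter K"
      and av: "\<bar>cK\<bar> \<le> M" "\<bar>d_K\<bar> \<le> M" "\<beta>1 \<le> norm \<beta> + L * diameter K"
      using data[OF Kf(1-4) K\<Omega> d1(2)] unfolding \<beta>_def cK_def d_K_def by blast
    obtain N' where N': "negligible N'" "\<forall>x\<in>K' - N'. \<forall>y\<in>K' - N'. norm (b x - b y) \<le> L * norm (x - y)"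
      using data[OF K'f(1-4) K'(2) d1(1)] by blast
    have "L * diameter K \<le> L * (\<beta>0 / (L + 1))" using d\<sigma> \<sigma> \<sigma>1 L by (intro mult_left_mono) auto
    also have "\<dots> \<le> \<beta>0" using L \<beta>0 by (simp add: field_simps)
    finally have n\<beta>: "\<beta>0 \<le> norm \<beta>" using av(3) by (simp add: \<beta>0_def)
    then have \<beta>n: "\<beta> \<noteq> 0" using \<beta>0 by auto
    {
      assume pu: "poly_le m pu" and pw: "poly_le m pw" and uw: "\<forall>x\<in>K'. u x = pu x \<and> w x = pw x"
        and w: "w \<in> H_adv \<Omega> b" and F: "steepest_inflow_face K (average K b) F"
      define e where "e = (1 / norm \<beta>) *\<^sub>R \<beta>"
      have e1: "norm e = 1" using \<beta>n by (simp add: e_def)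
      have \<beta>e: "\<beta> = norm \<beta> *\<^sub>R e" using \<beta>n by (simp add: e_def)
      have "shape_param K \<le> \<kappa> / 4" using sh by simp
      from steepest_face_geometry[OF K(1) this \<beta>n F[folded \<beta>_def] e_def]
      obtain \<nu> a q where \<nu>: "norm \<nu> = 1" and H: "1 \<le> \<kappa> * \<bar>e \<bullet> \<nu>\<bar>" and q: "q \<in> closure K" "q \<bullet> \<nu> = a"
        and up: "\<And>z. upwind_point F e z = z + ((a - z \<bullet> \<nu>) / (e \<bullet> \<nu>)) *\<^sub>R e" by auto
      define P where "P = (\<lambda>z. z + ((a - z \<bullet> \<nu>) / (e \<bullet> \<nu>)) *\<^sub>R e)"
      define V where "V = (\<lambda>x. frechet_derivative pw (at x) \<beta>)"
      define T where "T = (\<lambda>z. ((pw (P z) - pu (P z)) * ((z - P z) \<bullet> e) + norm \<beta> * (V (P z) + cK * pu (P z) + d_K * pw (P z))) / norm \<beta>)"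
      have Tt: "breve_t_elem \<Omega> b c m K F u w = T"
      proof -
        have "poly_ext m K u = pu" "poly_ext m K w = pw"
          using uw K(2) by (auto intro!: poly_ext_eq[OF Kf(1,4)] pu pw)
        moreover have "upwind_point F e = P" using up by (auto simp: P_def)
        ultimately show ?thesis
          by (intro ext) (simp only: breve_t_elem_def Let_def T_def V_def
            \<beta>_def[symmetric] cK_def[symmetric] d_K_def[symmetric] e_def[symmetric])
      qed
      let ?S = "cball x0 (R * r)"
      have x0: "x0 \<in> K'" using r by auto
      have K'S: "dist x0 x \<le> \<kappa> * r" if "x \<in> K'" for x
        using diameter_bounded_bound[OF K'f(3) x0 that] r(3) by simp
      have \<kappa>R: "\<kappa> * r \<le> R * r" using R r by (intro mult_right_mono) auto
      have KS: "K \<subseteq> ?S" using K'S K(2) \<kappa>R by fastforce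
      have r1: "r \<le> 1"
      proof -
        have "diameter (ball x0 r) \<le> diameter K'" by (rule diameter_subset[OF r(2) K'f(3)])
        then show ?thesis using r(1) d1 by simp
      qed
      have \<delta>2: "\<bar>a - z \<bullet> \<nu>\<bar> \<le> diameter K" if "z \<in> K" for z
      proof -
        have "\<bar>a - z \<bullet> \<nu>\<bar> = \<bar>(q - z) \<bullet> \<nu>\<bar>" using q by (simp add: inner_diff_left)
        also have "\<dots> \<le> norm (q - z)" using Cauchy_Schwarz_ineq2[of "q - z" \<nu>] \<nu> by simp
        also have "\<dots> \<le> diameter (closure K)"
          using diameter_bounded_bound[OF bounded_closure[OF Kf(3)] q(1), of z] that closure_subset[of K] by (auto simp: dist_norm)
        finally show ?thesis using diameter_closure[OF Kf(3)] by simp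
      qed
      have \<delta>3: "diameter K \<le> (\<kappa> * \<sigma>) * r"
      proof -
        have "diameter K \<le> \<sigma> * (\<kappa> * r)" using dK r(3) \<sigma> by (meson less_imp_le mult_left_mono order_trans)
        then show ?thesis by (simp add: mult_ac)
      qed
      have \<eta>: "\<kappa> * \<sigma> \<le> 1"
        using mult_left_mono[of \<sigma> "1 / \<kappa>" \<kappa>] \<sigma> \<sigma>1(3) \<kappa> by simp
      have en: "e \<bullet> \<nu> \<noteq> 0" using H by auto
      have PS: "P z \<in> ?S" if z: "z \<in> K" for z
      proof -
        have "\<bar>(a - z \<bullet> \<nu>) / (e \<bullet> \<nu>)\<bar> = \<bar>a - z \<bullet> \<nu>\<bar> * (1 / \<bar>e \<bullet> \<nu>\<bar>)" by simp
        also have "\<dots> \<le> diameter K * \<kappa>" using \<delta>2[OF z] H en d0 by (intro mult_mono) (auto simp: divide_le_eq)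
        also have "\<dots> \<le> (\<kappa> * r) * \<kappa>" using dd r(3) \<kappa> by (intro mult_right_mono) auto
        finally have "dist z (P z) \<le> \<kappa> * \<kappa> * r" using e1 by (simp add: P_def dist_norm mult_ac)
        moreover have "dist x0 z \<le> \<kappa> * r" using K'S K(2) z by blast
        ultimately have "dist x0 (P z) \<le> (\<kappa> + \<kappa> * \<kappa>) * r"
          using dist_triangle[of x0 "P z" z] by (simp add: algebra_simps)
        also have "\<dots> \<le> R * r" using R r by (intro mult_right_mono) auto
        finally show ?thesis by simp
      qed
      let ?n = "\<lambda>q. (LINT x|lebesgue_on (ball x0 r). (q x)\<^sup>2) / r ^ DIM('a)"
      \<comment> \<open>One amplitude for all three polynomials. V contributes its own norm, because
        bounding it by w would bring in a factor 1 / r.\<close>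
      define A where "A = CI * (sqrt (?n pu) + sqrt (?n pw) + sqrt (?n V))"
      have n0: "?n q \<ge> 0" for q :: "'a \<Rightarrow> real" using r by simp
      have Vp: "poly_le m V" unfolding V_def by (rule poly_le_frechet_derivative[OF pw])
      have bnd: "\<bar>q x\<bar> \<le> A \<and> \<bar>q x - q y\<bar> \<le> A * (norm (x - y) / r)"
        if q: "poly_le m q" and A: "CI * sqrt (?n q) \<le> A" and xy: "x \<in> ?S" "y \<in> ?S" for q x y
      proof -
        have "\<bar>q x\<bar> \<le> CI * sqrt (?n q)" "\<bar>q x - q y\<bar> \<le> CI * (norm (x - y) / r) * sqrt (?n q)"
          using CI(2)[OF q r(1) xy] by auto
        moreover have "CI * sqrt (?n q) * (norm (x - y) / r) \<le> A * (norm (x - y) / r)"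
          using A r by (intro mult_right_mono) auto
        ultimately show ?thesis using A by (simp add: mult_ac)
      qed
      have CIn: "CI * sqrt (?n q) \<ge> 0" for q :: "'a \<Rightarrow> real" using CI(1) n0 by (intro mult_nonneg_nonneg real_sqrt_ge_zero)
      have An: "CI * sqrt (?n pu) \<le> A" "CI * sqrt (?n pw) \<le> A" "CI * sqrt (?n V) \<le> A"
        using CIn[of pu] CIn[of pw] CIn[of V] by (auto simp: A_def distrib_left)
      define G where "G = (LINT x|lebesgue_on K'. (u x)\<^sup>2 + (w x)\<^sup>2 + (adv \<Omega> b w x)\<^sup>2) / r ^ DIM('a)"
      have aL: "adv \<Omega> b w \<in> L2 K'" by (rule L2_subset[OF H_adv_adv(1)[OF w] K'(2) K's \<Omega>s])
      have pi: "integrable (lebesgue_on S) (\<lambda>x. (q x)\<^sup>2)" if "poly_le m q" "bounded S" "S \<in> sets lebesgue" for S and q :: "'a \<Rightarrow> real"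
        using poly_le_integrable[OF poly_le_prod[OF that(1,1)] that(2,3)] by (simp add: power2_eq_square)
      have ui: "integrable (lebesgue_on K') (\<lambda>x. (u x)\<^sup>2)"
        by (rule iffD2[OF Bochner_Integration.integrable_cong[OF refl] pi[OF pu K'f(3) K's]]) (use uw in simp)
      have wi: "integrable (lebesgue_on K') (\<lambda>x. (w x)\<^sup>2)"
        by (rule iffD2[OF Bochner_Integration.integrable_cong[OF refl] pi[OF pw K'f(3) K's]]) (use uw in simp)
      have Gi: "integrable (lebesgue_on K') (\<lambda>x. (u x)\<^sup>2 + (w x)\<^sup>2 + (adv \<Omega> b w x)\<^sup>2)"
        using aL by (intro Bochner_Integration.integrable_add ui wi) (simp add: L2_def)
      have nG: "?n q \<le> G" if "integrable (lebesgue_on (ball x0 r)) (\<lambda>x. (q x)\<^sup>2)"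
        "\<And>x. x \<in> ball x0 r \<Longrightarrow> (q x)\<^sup>2 \<le> (u x)\<^sup>2 + (w x)\<^sup>2 + (adv \<Omega> b w x)\<^sup>2" for q
        unfolding G_def using that r
        by (intro divide_right_mono integral_subset_le[OF r(2) _ K's _ Gi]) auto
      have nu: "?n pu \<le> G" and nw: "?n pw \<le> G"
        using uw r(2) by (auto intro!: nG pi pu pw simp: subset_eq)
      have aB: "adv \<Omega> b w \<in> L2 (ball x0 r)" by (rule L2_subset[OF aL r(2) _ K's]) simp
      have na: "?n (adv \<Omega> b w) \<le> G" using aB by (intro nG) (auto simp: L2_def)
      have adv_ae: "AE x in lebesgue_on S. adv \<Omega> b w x = frechet_derivative pw (at x) (b x)"
        if "open S" "S \<subseteq> K'" for S
        using uw that K'(2) bounded_subset[OF K'f(3)]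
        by (intro adv_on_subset[OF U b w _ _ _ pw]) auto
      have nV: "?n V \<le> 2 * ?n (adv \<Omega> b w) + 2 * unit_ball_vol DIM('a) * (CI * sqrt (?n pw) * (2 * L * \<kappa>))\<^sup>2"
      proof (rule directional_derivative_L2[OF pw V_def r(1) _ CIn aB adv_ae[OF open_ball r(2)]])
        fix x y assume "x \<in> ball x0 r" "y \<in> ball x0 r"
        moreover have "ball x0 r \<subseteq> ?S" using R(3) r(1) by (intro order_trans[OF ball_subset_cball subset_cball]) simp
        ultimately have "x \<in> ?S" "y \<in> ?S" by blast+
        from CI(2)[OF pw r(1) this] show "\<bar>pw x - pw y\<bar> \<le> CI * sqrt (?n pw) / r * norm (x - y)" by (simp add: mult_ac)
      next
        \<comment> \<open>\<beta> is an average over the small K while x ranges over the coarse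
          ball. A point y of K outside both null sets links them, and each of the two steps costs at
          most L diam K'.\<close>
        have "\<not> negligible K" using open_not_negligible Kf by blast
        then obtain y where y: "y \<in> K" "y \<notin> N \<union> N'"
          using negligible_Un[OF N(1) N'(1)] negligible_subset by blast
        show "AE x in lebesgue_on (ball x0 r). norm (b x - \<beta>) \<le> 2 * L * \<kappa> * r"
        proof (rule AE_lebesgue_onI[OF N'(1)])
          fix x assume x: "x \<in> ball x0 r - N'"
          then have xK: "x \<in> K'" using r(2) by blast
          have "norm (b x - b y) \<le> L * norm (x - y)" using N'(2) xK x y K(2) by blast
          also have "\<dots> \<le> L * diameter K'"
            using diameter_bounded_bound[OF K'f(3) xK, of y] y(1) K(2) L by (intro mult_left_mono) (auto simp: dist_norm)
          finally have 1: "norm (b x - b y) \<le> L * diameter K'" .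
          have "norm (b y - \<beta>) \<le> L * diameter K" using N(2) y by blast
          also have "\<dots> \<le> L * diameter K'" using dd L by (intro mult_left_mono)
          finally have 2: "norm (b y - \<beta>) \<le> L * diameter K'" .
          have "norm (b x - \<beta>) \<le> norm (b x - b y) + norm (b y - \<beta>)"
            using norm_triangle_ineq[of "b x - b y" "b y - \<beta>"] by simp
          also have "\<dots> \<le> 2 * (L * diameter K')" using 1 2 by simp
          also have "\<dots> \<le> 2 * (L * (\<kappa> * r))" using r(3) L by (intro mult_left_mono) auto
          finally show "norm (b x - \<beta>) \<le> 2 * L * \<kappa> * r" by (simp add: mult_ac)
        qed simp
      qed
      have "(CI * sqrt (?n pw) * (2 * L * \<kappa>))\<^sup>2 = (CI * (2 * L * \<kappa>))\<^sup>2 * ?n pw"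
        using n0[of pw] by (simp add: power_mult_distrib)
      then have "?n V \<le> 2 * ?n (adv \<Omega> b w) + CV * ?n pw" using nV by (simp add: CV_def mult_ac)
      also have "\<dots> \<le> 2 * G + CV * G" using na nw CV by (intro add_mono mult_left_mono) auto
      finally have nVG: "?n V \<le> 2 * G + CV * G" .
      have A2: "A\<^sup>2 \<le> 3 * CI\<^sup>2 * (4 + CV) * G"
      proof -
        have "A\<^sup>2 \<le> CI\<^sup>2 * (3 * (?n pu + ?n pw + ?n V))"
          unfolding A_def power_mult_distrib
          using sum3_sq_le[of "sqrt (?n pu)" "sqrt (?n pw)" "sqrt (?n V)"] n0[of pu] n0[of pw] n0[of V]
          by (intro mult_left_mono) auto
        also have "\<dots> \<le> CI\<^sup>2 * (3 * ((4 + CV) * G))"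
          using nu nw nVG by (intro mult_left_mono) (auto simp: algebra_simps)
        finally show ?thesis by (simp only: mult_ac)
      qed
      note est0 = local_test_function_estimate[OF pu pw Kf(1) KS V_def r(1) r1 bnd[OF pu An(1)] bnd[OF pw An(2)] bnd[OF Vp An(3)]
        e1 \<nu> H P_def d0 \<delta>2 \<delta>3 \<eta> PS \<beta>0 n\<beta> \<beta>e T_def av(1,2) L]
      have est: "poly_le (Suc m) T"
        "\<bar>T z - (frechet_derivative pw (at z) bz + cz * pu z + dz * pw z)\<bar> \<le> A * (\<kappa> * \<sigma>) * C1"
        "\<bar>frechet_derivative T (at z) bz - (pw z - pu z)\<bar> \<le> A * (\<kappa> * \<sigma>) * C2"
        if that: "z \<in> K" "norm (bz - \<beta>) \<le> L * diameter K" "\<bar>cz - cK\<bar> \<le> L * diameter K" "\<bar>dz - d_K\<bar> \<le> L * diameter K"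
        for z bz cz dz
        unfolding C1_def C2_def
        by ((rule est0; (assumption | rule that)?)+)
      \<comment> \<open>In \<open>est\<close> the degree bound shares its premises with the
        pointwise bounds, so it needs some point at which these hold.\<close>
      obtain z0 where z0: "z0 \<in> K - N"
      proof -
        have "\<not> negligible K" using open_not_negligible Kf by blast
        then show ?thesis using that N(1) negligible_subset by blast
      qed
      have Nz: "norm (b z - \<beta>) \<le> L * diameter K" "\<bar>c z - weak_div \<Omega> b z - cK\<bar> \<le> L * diameter K" "\<bar>weak_div \<Omega> b z - d_K\<bar> \<le> L * diameter K"
        if "z \<in> K - N" for z using N(2) that by blast+
      have Tp: "poly_le (Suc m) T" by (rule est(1)[OF _ Nz[OF z0]]) (use z0 in auto)
      have "AE x in lebesgue_on K. (w x - u x - adv K b v x)\<^sup>2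
          + (adv \<Omega> b w x + (c x - weak_div \<Omega> b x) * u x + weak_div \<Omega> b x * w x - v x)\<^sup>2
        \<le> Cf * \<sigma>\<^sup>2 * G" if v: "\<forall>x\<in>K. v x = T x" for v
      proof -
        have "(\<lambda>x. b x \<bullet> i) \<in> W1inf K" if "i \<in> Basis" for i
          by (rule W1inf_subset[OF W1inf_div_facts(1)[OF b that] K\<Omega> Ks \<Omega>s])
        then have "AE x in lebesgue_on K. adv K b v x = frechet_derivative T (at x) (b x)"
          using v by (intro adv_poly(2)[OF Kf(1,3) _ Tp]) auto
        moreover have "AE x in lebesgue_on K. x \<in> K - N"
          by (rule AE_lebesgue_onI[OF N(1) Ks])
        ultimately show ?thesis using adv_ae[OF Kf(1) K(2)]
        proof eventually_elim
          case (elim z)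
          then have z: "z \<in> K" "u z = pu z" "w z = pw z" "v z = T z" using uw v K(2) by auto
          have e1: "\<bar>w z - u z - adv K b v z\<bar> \<le> A * (\<kappa> * \<sigma>) * C2"
            using est(3)[OF z(1) Nz[OF elim(2)]] unfolding z elim(1) by (simp only: abs_minus_commute)
          have e2: "\<bar>adv \<Omega> b w z + (c z - weak_div \<Omega> b z) * u z + weak_div \<Omega> b z * w z - v z\<bar> \<le> A * (\<kappa> * \<sigma>) * C1"
            using est(2)[OF z(1) Nz[OF elim(2)]] unfolding z elim(3) by (simp only: abs_minus_commute)
          have "(w z - u z - adv K b v z)\<^sup>2
            + (adv \<Omega> b w z + (c z - weak_div \<Omega> b z) * u z + weak_div \<Omega> b z * w z - v z)\<^sup>2
            \<le> (A * (\<kappa> * \<sigma>) * C2)\<^sup>2 + (A * (\<kappa> * \<sigma>) * C1)\<^sup>2"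
            by (intro add_mono power2_le_iff_abs_le[THEN iffD2] e1 e2 order_trans[OF abs_ge_zero e1] order_trans[OF abs_ge_zero e2])
          also have "\<dots> = (\<kappa>\<^sup>2 * (C1\<^sup>2 + C2\<^sup>2) * \<sigma>\<^sup>2) * A\<^sup>2"
            by (simp add: power_mult_distrib algebra_simps)
          also have "\<dots> \<le> (\<kappa>\<^sup>2 * (C1\<^sup>2 + C2\<^sup>2) * \<sigma>\<^sup>2) * (3 * CI\<^sup>2 * (4 + CV) * G)"
            by (intro mult_left_mono A2) auto
          also have "\<dots> = Cf * \<sigma>\<^sup>2 * G" by (simp add: Cf_def mult_ac)
          finally show ?case .
        qed
      qed
      then have "poly_le (Suc m) (breve_t_elem \<Omega> b c m K F u w) \<and>
         (\<forall>v. (\<forall>x\<in>K. v x = breve_t_elem \<Omega> b c m K F u w x) \<longrightarrow>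
         (AE x in lebesgue_on K. (w x - u x - adv K b v x)\<^sup>2
          + (adv \<Omega> b w x + (c x - weak_div \<Omega> b x) * u x + weak_div \<Omega> b x * w x - v x)\<^sup>2
          \<le> Cf * \<sigma>\<^sup>2 * ((LINT x|lebesgue_on K'. (u x)\<^sup>2 + (w x)\<^sup>2 + (adv \<Omega> b w x)\<^sup>2) / r ^ DIM('a))))"
        using Tp unfolding Tt G_def by blast
    }
    moreover have "average K b \<noteq> 0" using \<beta>n by (simp add: \<beta>_def)
    ultimately show ?thesis by blast
  qed
  show ?thesis
    by (rule exI[of _ Cf], rule conjI[OF Cf], rule exI[of _ \<sigma>1], rule conjI[OF \<sigma>1(1)], rule conjI[OF \<sigma>1(2)],
      intro allI impI, rule main, assumption+)
qed

section \<open>The global estimate\<close>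

lemma pw_polys_Linf:
  fixes \<Omega> :: "'a::euclidean_space set"
  assumes \<Omega>: "lipschitz_domain \<Omega>" and P: "simplicial_partition \<Omega> P" and u: "u \<in> pw_polys m P"
  shows "u \<in> Linf \<Omega>"
proof -
  note Pf = partition_facts[OF \<Omega> P] and Kf = open_simplex_facts[OF partition_facts(2)[OF \<Omega> P]]
  have \<Omega>s: "\<Omega> \<in> sets lebesgue" using lipschitz_domain_interior_closure(1)[OF \<Omega>] by simp
  have Ps: "K \<in> sets lebesgue" "K \<in> lmeasurable" if "K \<in> P" for K using Kf(1,3)[OF that] by (auto simp: lmeasurable_open)
  have "\<forall>K\<in>P. \<exists>p. poly_le m p \<and> (\<forall>x\<in>K. u x = p x)" using u unfolding pw_polys_def polys_iff_poly_le[symmetric] by blast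
  then obtain g where g: "\<And>K. K \<in> P \<Longrightarrow> poly_le m (g K)" "\<And>K x. K \<in> P \<Longrightarrow> x \<in> K \<Longrightarrow> u x = g K x" by metis
  have gL: "g K \<in> Linf K" if "K \<in> P" for K by (rule Linf_poly[OF g(1)[OF that] Kf(3)[OF that]])
  have m: "u \<in> borel_measurable (lebesgue_on \<Omega>)"
    by (rule measurable_piecewise[OF Pf(1,4) Ps(1) \<Omega>s Pf(5,3) gL g(2) Ps(2)])
  have "\<forall>K\<in>P. \<exists>B. AE x in lebesgue_on K. \<bar>g K x\<bar> \<le> B" using gL by (auto simp: Linf_iff)
  then obtain B where B: "\<And>K. K \<in> P \<Longrightarrow> AE x in lebesgue_on K. \<bar>g K x\<bar> \<le> B K" by metis
  have "AE x in lebesgue_on \<Omega>. \<bar>u x\<bar> \<le> (\<Sum>K\<in>P. \<bar>B K\<bar>)"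
  proof (rule AE_partition[OF Pf(1,4) Ps(1) \<Omega>s Pf(5)])
    fix K assume K: "K \<in> P"
    have "AE x in lebesgue_on K. x \<in> K" by (rule AE_I2) simp
    then show "AE x in lebesgue_on K. \<bar>u x\<bar> \<le> (\<Sum>K\<in>P. \<bar>B K\<bar>)"
      using B[OF K]
    proof eventually_elim
      case (elim x)
      have "\<bar>B K\<bar> \<le> (\<Sum>K\<in>P. \<bar>B K\<bar>)" using Pf(1) K by (intro member_le_sum) auto
      then show ?case using elim g(2)[OF K elim(1)] by linarith
    qed
  qed
  then show ?thesis using m by (auto simp: Linf_iff)
qed

lemma breve_t_on_element:
  assumes "finite Q" "disjoint Q" "K \<in> Q" "z \<in> K"
  shows "breve_t \<Omega> b c m Q F u w z = breve_t_elem \<Omega> b c m K (F K) u w z"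
  unfolding breve_t_def by (rule sum_if_disjoint[OF assms])

text \<open>The element errors are bounded by densities that are constant on each coarse element.
  Integrating such a density costs the volume of K', at most a multiple of r^n, which cancels the
  r^n in its denominator; the number of fine elements inside K' does not enter B.\<close>

lemma global_estimate:
  fixes b :: "'a::euclidean_space \<Rightarrow> 'a"
  assumes \<Omega>: "lipschitz_domain \<Omega>" "bounded \<Omega>" and b: "b \<in> W1inf_div \<Omega>" and c: "c \<in> W1inf \<Omega>" and inv: "inv_abs_norm \<Omega> b < \<infinity>"
    and \<kappa>: "\<kappa> > 0"
  shows "\<exists>B\<ge>0. \<exists>\<sigma>1>0. \<sigma>1 \<le> 1 \<and> (\<forall>\<sigma> P Q. 0 < \<sigma> \<longrightarrow> \<sigma> \<le> \<sigma>1 \<longrightarrow>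
    simplicial_partition \<Omega> P \<longrightarrow> simplicial_partition \<Omega> Q \<longrightarrow> is_refinement Q P \<longrightarrow>
    (\<forall>K\<in>P. 4 * shape_param K \<le> \<kappa>) \<longrightarrow> (\<forall>K\<in>Q. 4 * shape_param K \<le> \<kappa>) \<longrightarrow> (\<forall>K'\<in>P. diameter K' \<le> \<sigma>) \<longrightarrow>
    (\<forall>K\<in>Q. \<forall>K'\<in>P. K \<subseteq> K' \<longrightarrow> diameter K \<le> \<sigma> * diameter K') \<longrightarrow>
    (\<forall>K\<in>Q. average K b \<noteq> 0) \<and>
    (\<forall>u\<in>pw_polys m P. \<forall>w\<in>H_adv \<Omega> b \<inter> pw_polys m P. \<forall>F. (\<forall>K\<in>Q. steepest_inflow_face K (average K b) (F K)) \<longrightarrow>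
      breve_t \<Omega> b c m Q F u w \<in> pw_polys (m + 1) Q \<and>
      (LINT x|lebesgue_on \<Omega>. (w x - u x)\<^sup>2 + (adv \<Omega> b w x + (c x - weak_div \<Omega> b x) * u x + weak_div \<Omega> b x * w x)\<^sup>2)
        + (V_norm \<Omega> b Q (breve_t \<Omega> b c m Q F u w))\<^sup>2 - B * \<sigma>\<^sup>2 * (U_norm \<Omega> b u w)\<^sup>2
       \<le> 2 * b_h \<Omega> b c Q u w (breve_t \<Omega> b c m Q F u w)))"
proof -
  have \<Omega>o: "open \<Omega>" by (rule lipschitz_domain_interior_closure(1)[OF \<Omega>(1)])
  have \<Omega>m: "\<Omega> \<in> lmeasurable" and \<Omega>s: "\<Omega> \<in> sets lebesgue" using \<Omega>o \<Omega>(2) by (auto simp: lmeasurable_open)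
  have cL: "c \<in> Linf \<Omega>" and dL: "weak_div \<Omega> b \<in> Linf \<Omega>" using b c by (auto simp: W1inf_div_def W1inf_def)
  obtain Cf \<sigma>1 where Cf: "Cf \<ge> 0" and \<sigma>1: "\<sigma>1 > 0" "\<sigma>1 \<le> 1" and el: "\<forall>K' K x0 r \<sigma> pu pw u w F.
    open_simplex K' \<longrightarrow> K' \<subseteq> \<Omega> \<longrightarrow> r > 0 \<longrightarrow> ball x0 r \<subseteq> K' \<longrightarrow> diameter K' \<le> \<kappa> * r \<longrightarrow> diameter K' \<le> \<sigma> \<longrightarrow>
    open_simplex K \<longrightarrow> K \<subseteq> K' \<longrightarrow> 4 * shape_param K \<le> \<kappa> \<longrightarrow> diameter K \<le> \<sigma> * diameter K' \<longrightarrow> 0 < \<sigma> \<longrightarrow> \<sigma> \<le> \<sigma>1 \<longrightarrow>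
    average K b \<noteq> 0 \<and>
    (poly_le m pu \<longrightarrow> poly_le m pw \<longrightarrow> (\<forall>x\<in>K'. u x = pu x \<and> w x = pw x) \<longrightarrow> w \<in> H_adv \<Omega> b \<longrightarrow>
     steepest_inflow_face K (average K b) F \<longrightarrow>
     poly_le (Suc m) (breve_t_elem \<Omega> b c m K F u w) \<and>
     (\<forall>v. (\<forall>x\<in>K. v x = breve_t_elem \<Omega> b c m K F u w x) \<longrightarrow>
       (AE x in lebesgue_on K. (w x - u x - adv K b v x)\<^sup>2
          + (adv \<Omega> b w x + (c x - weak_div \<Omega> b x) * u x + weak_div \<Omega> b x * w x - v x)\<^sup>2
        \<le> Cf * \<sigma>\<^sup>2 * ((LINT x|lebesgue_on K'. (u x)\<^sup>2 + (w x)\<^sup>2 + (adv \<Omega> b w x)\<^sup>2) / r ^ DIM('a)))))"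
    using element_error[OF \<Omega>o b c inv \<kappa>, of m] by (elim exE conjE) blast
  define B where "B = Cf * (unit_ball_vol DIM('a) * \<kappa> ^ DIM('a))"
  have B: "B \<ge> 0" using Cf \<kappa> by (simp add: B_def)
  show ?thesis
  proof (rule exI[of _ B], rule conjI[OF B], rule exI[of _ \<sigma>1], rule conjI[OF \<sigma>1(1)], rule conjI[OF \<sigma>1(2)],
      intro allI impI, rule conjI)
    fix \<sigma> P Q
    assume \<sigma>: "0 < \<sigma>" "\<sigma> \<le> \<sigma>1" and P: "simplicial_partition \<Omega> P" and Q: "simplicial_partition \<Omega> Q"
      and ref: "is_refinement Q P" and shP: "\<forall>K\<in>P. 4 * shape_param K \<le> \<kappa>" and shQ: "\<forall>K\<in>Q. 4 * shape_param K \<le> \<kappa>"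
      and dP: "\<forall>K'\<in>P. diameter K' \<le> \<sigma>" and dQ: "\<forall>K\<in>Q. \<forall>K'\<in>P. K \<subseteq> K' \<longrightarrow> diameter K \<le> \<sigma> * diameter K'"
    note Pf = partition_facts[OF \<Omega>(1) P] and Qf = partition_facts[OF \<Omega>(1) Q]
    note PKf = open_simplex_facts[OF Pf(2)] and QKf = open_simplex_facts[OF Qf(2)]
    have Ps: "K \<in> sets lebesgue" "K \<in> lmeasurable" if "K \<in> P" for K using PKf(1,3)[OF that] by (auto simp: lmeasurable_open)
    have Qs: "K \<in> sets lebesgue" "K \<in> lmeasurable" if "K \<in> Q" for K using QKf(1,3)[OF that] by (auto simp: lmeasurable_open)
    have "\<forall>K\<in>P. \<exists>x r. r > 0 \<and> ball x r \<subseteq> K \<and> diameter K \<le> \<kappa> * r"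
    proof
      fix K assume K: "K \<in> P"
      have "shape_param K \<le> \<kappa> / 4" using shP K by auto
      from inscribed_ball[OF PKf(1,3,4)[OF K] this] show "\<exists>x r. r > 0 \<and> ball x r \<subseteq> K \<and> diameter K \<le> \<kappa> * r" by simp
    qed
    then obtain x0 r where r: "\<And>K. K \<in> P \<Longrightarrow> r K > 0" "\<And>K. K \<in> P \<Longrightarrow> ball (x0 K) (r K) \<subseteq> K"
      "\<And>K. K \<in> P \<Longrightarrow> diameter K \<le> \<kappa> * r K" by metis
    have "\<forall>K\<in>Q. \<exists>K'\<in>P. K \<subseteq> K'" using ref by (simp add: is_refinement_def)
    then obtain par where par: "\<And>K. K \<in> Q \<Longrightarrow> par K \<in> P" "\<And>K. K \<in> Q \<Longrightarrow> K \<subseteq> par K" by metis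
    have elK: "average K b \<noteq> 0 \<and> (\<forall>pu pw u w F. poly_le m pu \<longrightarrow> poly_le m pw \<longrightarrow> (\<forall>x\<in>par K. u x = pu x \<and> w x = pw x) \<longrightarrow> w \<in> H_adv \<Omega> b \<longrightarrow>
       steepest_inflow_face K (average K b) F \<longrightarrow>
       poly_le (Suc m) (breve_t_elem \<Omega> b c m K F u w) \<and>
       (\<forall>v. (\<forall>x\<in>K. v x = breve_t_elem \<Omega> b c m K F u w x) \<longrightarrow>
       (AE x in lebesgue_on K. (w x - u x - adv K b v x)\<^sup>2
          + (adv \<Omega> b w x + (c x - weak_div \<Omega> b x) * u x + weak_div \<Omega> b x * w x - v x)\<^sup>2
        \<le> Cf * \<sigma>\<^sup>2 * ((LINT x|lebesgue_on (par K). (u x)\<^sup>2 + (w x)\<^sup>2 + (adv \<Omega> b w x)\<^sup>2) / r (par K) ^ DIM('a)))))"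
      if K: "K \<in> Q" for K
    proof -
      note pK = par(1)[OF K]
      have d: "diameter (par K) \<le> \<sigma>" "4 * shape_param K \<le> \<kappa>" "diameter K \<le> \<sigma> * diameter (par K)"
        using dP pK shQ K dQ par(2)[OF K] by auto
      note E = el[rule_format, OF Pf(2,4)[OF pK] r[OF pK] d(1) Qf(2)[OF K] par(2)[OF K] d(2,3) \<sigma>]
      show ?thesis
        by (rule conjI, rule E[THEN conjunct1], intro allI, rule E[THEN conjunct2])
    qed
    show "\<forall>K\<in>Q. average K b \<noteq> 0" using elK by blast
    show "\<forall>u\<in>pw_polys m P. \<forall>w\<in>H_adv \<Omega> b \<inter> pw_polys m P. \<forall>F. (\<forall>K\<in>Q. steepest_inflow_face K (average K b) (F K)) \<longrightarrow>
      breve_t \<Omega> b c m Q F u w \<in> pw_polys (m + 1) Q \<and>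
      (LINT x|lebesgue_on \<Omega>. (w x - u x)\<^sup>2 + (adv \<Omega> b w x + (c x - weak_div \<Omega> b x) * u x + weak_div \<Omega> b x * w x)\<^sup>2)
        + (V_norm \<Omega> b Q (breve_t \<Omega> b c m Q F u w))\<^sup>2 - B * \<sigma>\<^sup>2 * (U_norm \<Omega> b u w)\<^sup>2
       \<le> 2 * b_h \<Omega> b c Q u w (breve_t \<Omega> b c m Q F u w)"
    proof (intro ballI allI impI)
      fix u w F assume u: "u \<in> pw_polys m P" and wI: "w \<in> H_adv \<Omega> b \<inter> pw_polys m P"
        and F: "\<forall>K\<in>Q. steepest_inflow_face K (average K b) (F K)"
      have w: "w \<in> H_adv \<Omega> b" "w \<in> pw_polys m P" using wI by auto
      define v where "v = breve_t \<Omega> b c m Q F u w"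
      define X2 where "X2 = (\<lambda>x. adv \<Omega> b w x + (c x - weak_div \<Omega> b x) * u x + weak_div \<Omega> b x * w x)"
      define E where "E = (\<lambda>x. (u x)\<^sup>2 + (w x)\<^sup>2 + (adv \<Omega> b w x)\<^sup>2)"
      define G where "G = (\<lambda>K'. (LINT x|lebesgue_on K'. E x) / r K' ^ DIM('a))"
      have "\<forall>K\<in>P. \<exists>p. poly_le m p \<and> (\<forall>x\<in>K. u x = p x)" using u unfolding pw_polys_def polys_iff_poly_le[symmetric] by blast
      then obtain pu where pu: "\<And>K. K \<in> P \<Longrightarrow> poly_le m (pu K)" "\<And>K x. K \<in> P \<Longrightarrow> x \<in> K \<Longrightarrow> u x = pu K x" by metis
      have "\<forall>K\<in>P. \<exists>p. poly_le m p \<and> (\<forall>x\<in>K. w x = p x)" using w unfolding pw_polys_def polys_iff_poly_le[symmetric] by blast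
      then obtain pw where pw: "\<And>K. K \<in> P \<Longrightarrow> poly_le m (pw K)" "\<And>K x. K \<in> P \<Longrightarrow> x \<in> K \<Longrightarrow> w x = pw K x" by metis
      have vK: "v x = breve_t_elem \<Omega> b c m K (F K) u w x" if "K \<in> Q" "x \<in> K" for K x
        unfolding v_def by (rule breve_t_on_element[OF Qf(1,3) that])
      have err: "poly_le (Suc m) (breve_t_elem \<Omega> b c m K (F K) u w)"
        "AE x in lebesgue_on K. (w x - u x - adv K b v x)\<^sup>2 + (X2 x - v x)\<^sup>2 \<le> Cf * \<sigma>\<^sup>2 * G (par K)" if K: "K \<in> Q" for K
      proof -
        have uw: "\<forall>x\<in>par K. u x = pu (par K) x \<and> w x = pw (par K) x" using pu pw par(1)[OF K] by blast
        have Fs: "steepest_inflow_face K (average K b) (F K)" using F K by blast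
        note e = elK[OF K, THEN conjunct2, THEN spec, THEN spec, THEN spec, THEN spec, THEN spec, THEN mp, OF pu(1)[OF par(1)[OF K]],
          THEN mp, OF pw(1)[OF par(1)[OF K]], THEN mp, OF uw, THEN mp, OF w(1), THEN mp, OF Fs]
        show "poly_le (Suc m) (breve_t_elem \<Omega> b c m K (F K) u w)" using e by (rule conjunct1)
        have "\<forall>x\<in>K. v x = breve_t_elem \<Omega> b c m K (F K) u w x" using vK[OF K] by blast
        from e[THEN conjunct2, THEN spec[of _ v], THEN mp, OF this]
        show "AE x in lebesgue_on K. (w x - u x - adv K b v x)\<^sup>2 + (X2 x - v x)\<^sup>2 \<le> Cf * \<sigma>\<^sup>2 * G (par K)"
          unfolding X2_def G_def E_def .
      qed
      have vpw: "v \<in> pw_polys (m + 1) Q"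
        unfolding pw_polys_def
      proof (intro CollectI ballI)
        fix K assume K: "K \<in> Q"
        show "\<exists>p\<in>polys (m + 1). \<forall>x\<in>K. v x = p x"
          using err(1)[OF K] vK[OF K]
          by (intro bexI[of _ "breve_t_elem \<Omega> b c m K (F K) u w"]) (auto simp: polys_iff_poly_le)
      qed
      have uL: "u \<in> L2 \<Omega>" and wL: "w \<in> L2 \<Omega>" and vL: "v \<in> L2 \<Omega>"
        using pw_polys_Linf[OF \<Omega>(1) P u] pw_polys_Linf[OF \<Omega>(1) P w(2)] pw_polys_Linf[OF \<Omega>(1) Q vpw] Linf_imp_L2[OF \<Omega>m] by auto
      have aL: "adv \<Omega> b w \<in> L2 \<Omega>" by (rule H_adv_adv(1)[OF w(1)])
      have X1L: "(\<lambda>x. w x - u x) \<in> L2 \<Omega>" by (rule L2_diff[OF wL uL])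
      have X2L: "X2 \<in> L2 \<Omega>" unfolding X2_def by (intro L2_add L2_Linf_mult Linf_diff aL uL wL cL dL)
      have advK: "adv K b v \<in> L2 K" if K: "K \<in> Q" for K
      proof (rule adv_poly(1)[OF QKf(1,3)[OF K] _ err(1)[OF K] vK[OF K]])
        show "(\<lambda>x. b x \<bullet> i) \<in> W1inf K" if "i \<in> Basis" for i
          by (rule W1inf_subset[OF W1inf_div_facts(1)[OF b that] Qf(4)[OF K] Qs(1)[OF K] \<Omega>s])
      qed
      \<comment> \<open>\<open>adv K b v\<close> is chosen separately for each K. Gluing the choices
        turns the elementwise sums in \<open>b_h\<close> and \<open>V_norm\<close> into integrals
        over \<Omega>.\<close>
      define Y1 where "Y1 = (\<lambda>x. \<Sum>K\<in>Q. if x \<in> K then adv K b v x else 0)"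
      have Y1K: "Y1 x = adv K b v x" if "K \<in> Q" "x \<in> K" for K x
        unfolding Y1_def by (rule sum_if_disjoint[OF Qf(1,3) that])
      have Y1sq: "(Y1 x)\<^sup>2 = (\<Sum>K\<in>Q. if x \<in> K then (adv K b v x)\<^sup>2 else 0)" for x
      proof (cases "\<exists>K\<in>Q. x \<in> K")
        case True
        then obtain K where K: "K \<in> Q" "x \<in> K" by blast
        show ?thesis unfolding Y1K[OF K] by (rule sum_if_disjoint[OF Qf(1,3) K, symmetric])
      next
        case False
        then have "\<And>K. K \<in> Q \<Longrightarrow> x \<notin> K" by blast
        then show ?thesis unfolding Y1_def by simp
      qed
      have Y1L: "Y1 \<in> L2 \<Omega>"
      proof -
        have "integrable (lebesgue_on \<Omega>) Y1"
          unfolding Y1_def by (rule partition_sum_integral(1)[OF Qf(1,4) Qs(1) \<Omega>s L2_integrable[OF Qs(2) advK]])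
        moreover have "integrable (lebesgue_on \<Omega>) (\<lambda>x. (Y1 x)\<^sup>2)"
          unfolding Y1sq by (rule partition_sum_integral(1)[OF Qf(1,4) Qs(1) \<Omega>s]) (use advK in \<open>auto simp: L2_def\<close>)
        ultimately show ?thesis by (simp add: L2_def)
      qed
      have split: "(LINT x|lebesgue_on \<Omega>. f x) = (\<Sum>K\<in>Q. LINT x|lebesgue_on K. f x)"
        if "integrable (lebesgue_on \<Omega>) f" for f :: "'a \<Rightarrow> real"
        by (rule integral_partition[OF Qf(1,4) Qs(1) \<Omega>s Qf(5,3) that])
      have i2: "integrable (lebesgue_on \<Omega>) (\<lambda>x. (f x)\<^sup>2)" if "f \<in> L2 \<Omega>" for f using that by (simp add: L2_def)
      have bh: "b_h \<Omega> b c Q u w v = (LINT x|lebesgue_on \<Omega>. (w x - u x) * Y1 x + X2 x * v x)"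
      proof -
        have "integrable (lebesgue_on \<Omega>) (\<lambda>x. (w x - u x) * Y1 x + X2 x * v x)"
          by (intro Bochner_Integration.integrable_add L2_mult_integrable X1L X2L Y1L vL)
        from split[OF this] show ?thesis
          unfolding b_h_def
          by (simp only:) (intro sum.cong refl Bochner_Integration.integral_cong, auto simp: Y1K X2_def algebra_simps)
      qed
      have Vn: "(V_norm \<Omega> b Q v)\<^sup>2 = (LINT x|lebesgue_on \<Omega>. (v x)\<^sup>2) + (LINT x|lebesgue_on \<Omega>. (Y1 x)\<^sup>2)"
      proof -
        have "(LINT x|lebesgue_on \<Omega>. (Y1 x)\<^sup>2) = (\<Sum>K\<in>Q. LINT x|lebesgue_on K. (adv K b v x)\<^sup>2)"
          unfolding split[OF i2[OF Y1L]]
          by (intro sum.cong refl Bochner_Integration.integral_cong) (auto simp: Y1K)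
        then show ?thesis
          unfolding V_norm_def L2_norm_sq by (subst real_sqrt_pow2) (auto intro!: add_nonneg_nonneg sum_nonneg)
      qed
      have Un: "(U_norm \<Omega> b u w)\<^sup>2 = (LINT x|lebesgue_on \<Omega>. E x)"
        unfolding U_norm_def H_norm_def E_def using i2[OF uL] i2[OF wL] i2[OF aL]
        by (simp add: L2_norm_sq)
      have Ei: "integrable (lebesgue_on \<Omega>) E"
        unfolding E_def using i2[OF uL] i2[OF wL] i2[OF aL] by (intro Bochner_Integration.integrable_add)
      have E0: "(LINT x|lebesgue_on K'. E x) \<ge> 0" for K' by (simp add: E_def)
      \<comment> \<open>The error is estimated on fine elements, its bound is indexed by coarse
        ones. Gluing the bound along P leaves a single comparison almost everywhere on
        \<Omega>.\<close>
      define h where "h = (\<lambda>x. \<Sum>K'\<in>P. if x \<in> K' then Cf * \<sigma>\<^sup>2 * G K' else 0)"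
      have ci: "integrable (lebesgue_on K') (\<lambda>x. k)" if "K' \<in> P" for K' and k :: real
        by (rule Linf_integrable[OF Ps(2)[OF that] Linf_const])
      have hi: "integrable (lebesgue_on \<Omega>) h"
        unfolding h_def by (rule partition_sum_integral(1)[OF Pf(1,4) Ps(1) \<Omega>s ci])
      have hint: "(LINT x|lebesgue_on \<Omega>. h x) \<le> B * \<sigma>\<^sup>2 * (LINT x|lebesgue_on \<Omega>. E x)"
      proof -
        have "(LINT x|lebesgue_on \<Omega>. h x) = (\<Sum>K'\<in>P. LINT x|lebesgue_on K'. Cf * \<sigma>\<^sup>2 * G K')"
          unfolding h_def by (rule partition_sum_integral(2)[OF Pf(1,4) Ps(1) \<Omega>s ci])
        also have "\<dots> \<le> (\<Sum>K'\<in>P. B * \<sigma>\<^sup>2 * (LINT x|lebesgue_on K'. E x))"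
        proof (rule sum_mono)
          fix K' assume K': "K' \<in> P"
          have sub: "K' \<subseteq> cball (x0 K') (\<kappa> * r K')"
          proof
            fix x assume x: "x \<in> K'"
            have "x0 K' \<in> K'" using r[OF K'] by auto
            from diameter_bounded_bound[OF PKf(3)[OF K'] this x] show "x \<in> cball (x0 K') (\<kappa> * r K')"
              using r(3)[OF K'] by simp
          qed
          have "measure lebesgue K' \<le> measure lebesgue (cball (x0 K') (\<kappa> * r K'))"
            using sub Ps[OF K'] by (intro measure_mono_fmeasurable) auto
          also have "\<dots> = unit_ball_vol DIM('a) * (\<kappa> * r K') ^ DIM('a)"
            using \<kappa> r(1)[OF K'] by (simp add: content_cball)
          finally have vol: "measure lebesgue K' \<le> unit_ball_vol DIM('a) * \<kappa> ^ DIM('a) * r K' ^ DIM('a)"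
            by (simp add: power_mult_distrib mult.assoc)
          have G0: "G K' \<ge> 0" using r(1)[OF K'] E0 by (simp add: G_def)
          have "(LINT x|lebesgue_on K'. Cf * \<sigma>\<^sup>2 * G K') = (Cf * \<sigma>\<^sup>2 * G K') * measure lebesgue K'"
            using Ps(1)[OF K'] by (simp add: measure_restrict_space)
          also have "\<dots> \<le> (Cf * \<sigma>\<^sup>2 * G K') * (unit_ball_vol DIM('a) * \<kappa> ^ DIM('a) * r K' ^ DIM('a))"
            using vol Cf G0 by (intro mult_left_mono) auto
          also have "\<dots> = B * \<sigma>\<^sup>2 * (LINT x|lebesgue_on K'. E x)"
            using r(1)[OF K'] by (simp add: B_def G_def)
          finally show "(LINT x|lebesgue_on K'. Cf * \<sigma>\<^sup>2 * G K') \<le> B * \<sigma>\<^sup>2 * (LINT x|lebesgue_on K'. E x)" .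
        qed
        also have "\<dots> = B * \<sigma>\<^sup>2 * (LINT x|lebesgue_on \<Omega>. E x)"
        proof -
          have "(LINT x|lebesgue_on \<Omega>. E x) = (\<Sum>K'\<in>P. LINT x|lebesgue_on K'. E x)"
            by (rule integral_partition[OF Pf(1,4) Ps(1) \<Omega>s Pf(5,3) Ei])
          then show ?thesis by (simp only: sum_distrib_left)
        qed
        finally show ?thesis .
      qed
      have di: "integrable (lebesgue_on \<Omega>) (\<lambda>x. (w x - u x - Y1 x)\<^sup>2 + (X2 x - v x)\<^sup>2)"
        using i2[OF L2_diff[OF X1L Y1L]] i2[OF L2_diff[OF X2L vL]] by (rule Bochner_Integration.integrable_add)
      have "(LINT x|lebesgue_on \<Omega>. (w x - u x - Y1 x)\<^sup>2 + (X2 x - v x)\<^sup>2) \<le> (LINT x|lebesgue_on \<Omega>. h x)"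
      proof (rule integral_mono_AE[OF di hi], rule AE_partition[OF Qf(1,4) Qs(1) \<Omega>s Qf(5)])
        fix K assume K: "K \<in> Q"
        have "AE x in lebesgue_on K. x \<in> K" by (rule AE_I2) simp
        then show "AE x in lebesgue_on K. (w x - u x - Y1 x)\<^sup>2 + (X2 x - v x)\<^sup>2 \<le> h x"
          using err(2)[OF K]
        proof eventually_elim
          case (elim x)
          have "x \<in> par K" using par(2)[OF K] elim(1) by blast
          then have "h x = Cf * \<sigma>\<^sup>2 * G (par K)" unfolding h_def by (rule sum_if_disjoint[OF Pf(1,3) par(1)[OF K]])
          then show ?case using elim(2) Y1K[OF K elim(1)] by simp
        qed
      qed
      then have D: "(LINT x|lebesgue_on \<Omega>. (w x - u x - Y1 x)\<^sup>2 + (X2 x - v x)\<^sup>2) \<le> B * \<sigma>\<^sup>2 * (U_norm \<Omega> b u w)\<^sup>2"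
        using hint by (simp add: Un)
      have pi: "integrable (lebesgue_on \<Omega>) (\<lambda>x. (w x - u x) * Y1 x + X2 x * v x)"
        by (intro Bochner_Integration.integrable_add L2_mult_integrable X1L X2L Y1L vL)
      have Xi: "integrable (lebesgue_on \<Omega>) (\<lambda>x. (w x - u x)\<^sup>2 + (X2 x)\<^sup>2)"
        using i2[OF X1L] i2[OF X2L] by (rule Bochner_Integration.integrable_add)
      have "(LINT x|lebesgue_on \<Omega>. (w x - u x - Y1 x)\<^sup>2 + (X2 x - v x)\<^sup>2)
        = (LINT x|lebesgue_on \<Omega>. ((w x - u x)\<^sup>2 + (X2 x)\<^sup>2) + ((v x)\<^sup>2 + (Y1 x)\<^sup>2) - 2 * ((w x - u x) * Y1 x + X2 x * v x))"
        by (intro Bochner_Integration.integral_cong refl) (simp add: power2_eq_square algebra_simps)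
      also have "\<dots> = (LINT x|lebesgue_on \<Omega>. (w x - u x)\<^sup>2 + (X2 x)\<^sup>2)
          + ((LINT x|lebesgue_on \<Omega>. (v x)\<^sup>2) + (LINT x|lebesgue_on \<Omega>. (Y1 x)\<^sup>2))
          - 2 * (LINT x|lebesgue_on \<Omega>. (w x - u x) * Y1 x + X2 x * v x)"
        using Xi pi i2[OF vL] i2[OF Y1L]
        by (simp only: Bochner_Integration.integral_diff Bochner_Integration.integral_add Bochner_Integration.integrable_add
            integrable_mult_right integral_mult_right_zero)
      finally have "(LINT x|lebesgue_on \<Omega>. (w x - u x)\<^sup>2 + (X2 x)\<^sup>2) + (V_norm \<Omega> b Q v)\<^sup>2 - B * \<sigma>\<^sup>2 * (U_norm \<Omega> b u w)\<^sup>2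
          \<le> 2 * b_h \<Omega> b c Q u w v"
        using D by (simp add: bh Vn)
      then show "breve_t \<Omega> b c m Q F u w \<in> pw_polys (m + 1) Q \<and>
      (LINT x|lebesgue_on \<Omega>. (w x - u x)\<^sup>2 + (adv \<Omega> b w x + (c x - weak_div \<Omega> b x) * u x + weak_div \<Omega> b x * w x)\<^sup>2)
        + (V_norm \<Omega> b Q (breve_t \<Omega> b c m Q F u w))\<^sup>2 - B * \<sigma>\<^sup>2 * (U_norm \<Omega> b u w)\<^sup>2
       \<le> 2 * b_h \<Omega> b c Q u w (breve_t \<Omega> b c m Q F u w)"
        using vpw unfolding v_def X2_def by blast
    qed
  qed
qed

section \<open>Finiteness of the norms, mesh bounds and conclusion\<close>

lemma Linf_norm_finite: "f \<in> Linf U \<Longrightarrow> \<exists>B. Linf_norm U f \<le> ereal B"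
  unfolding Linf_def by (cases "Linf_norm U f") auto

lemma SUP_Basis_finite:
  assumes "\<And>i. i \<in> Basis \<Longrightarrow> \<exists>B. f i \<le> ereal B"
  shows "\<exists>B. (SUP i\<in>(Basis::'a::euclidean_space set). f i) \<le> ereal B"
proof -
  obtain B where B: "\<And>i. i \<in> Basis \<Longrightarrow> f i \<le> ereal (B i)" using assms by metis
  have "(SUP i\<in>Basis. f i) \<le> ereal (\<Sum>i\<in>Basis. \<bar>B i\<bar>)"
  proof (rule SUP_least)
    fix i :: 'a assume i: "i \<in> Basis"
    have "B i \<le> (\<Sum>i\<in>Basis. \<bar>B i\<bar>)" using member_le_sum[of i Basis "\<lambda>i. \<bar>B i\<bar>"] i by auto
    then show "f i \<le> ereal (\<Sum>i\<in>Basis. \<bar>B i\<bar>)" using B[OF i] by (meson ereal_less_eq(3) order_trans)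
  qed
  then show ?thesis by blast
qed

lemma max_finite: "\<exists>B. x \<le> ereal B \<Longrightarrow> \<exists>B. y \<le> ereal B \<Longrightarrow> \<exists>B. max x y \<le> ereal B"
  by (metis max_def)

lemma W1inf_norm_finite: "f \<in> W1inf U \<Longrightarrow> \<exists>B. W1inf_norm U f \<le> ereal B"
  unfolding W1inf_norm_def
  by (intro max_finite SUP_Basis_finite Linf_norm_finite W1inf_weak_partial(1)) (auto simp: W1inf_def)

lemma W1inf_div_norm_finite: "b \<in> W1inf_div U \<Longrightarrow> \<exists>B. W1inf_div_norm U b \<le> ereal B"
  unfolding W1inf_div_norm_def
  by (intro max_finite SUP_Basis_finite W1inf_norm_finite) (auto simp: W1inf_div_def)

lemma mesh_sigma_bounds:
  assumes T: "(P, Q) \<in> T" and \<sigma>: "mesh_sigma T \<le> ereal \<sigma>" and K': "K' \<in> P"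
  shows "diameter K' \<le> \<sigma>" "K \<in> Q \<Longrightarrow> K \<subseteq> K' \<Longrightarrow> diameter K / diameter K' \<le> \<sigma>"
proof -
  let ?f = "\<lambda>Q K'. max (SUP K\<in>{K\<in>Q. K \<subseteq> K'}. ereal (diameter K / diameter K')) (ereal (diameter K'))"
  have "?f Q K' \<le> (SUP K'\<in>P. ?f Q K')" by (rule SUP_upper[OF K'])
  also have "\<dots> \<le> mesh_sigma T" unfolding mesh_sigma_def by (rule SUP_upper2[OF T]) simp
  finally have le: "?f Q K' \<le> ereal \<sigma>" using \<sigma> by (rule order_trans)
  then show "diameter K' \<le> \<sigma>" by simp
  assume K: "K \<in> Q" "K \<subseteq> K'"
  have "ereal (diameter K / diameter K') \<le> (SUP K\<in>{K\<in>Q. K \<subseteq> K'}. ereal (diameter K / diameter K'))"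
    using K by (intro SUP_upper) simp
  also have "\<dots> \<le> ereal \<sigma>" using le by simp
  finally show "diameter K / diameter K' \<le> \<sigma>" by simp
qed

lemma shape_bounds:
  assumes T: "(P, Q) \<in> T"
  shows "K \<in> P \<Longrightarrow> ereal (shape_param K) \<le> coarse_shape T" "K \<in> Q \<Longrightarrow> ereal (shape_param K) \<le> fine_shape T"
proof -
  assume K: "K \<in> P"
  have "ereal (shape_param K) \<le> (SUP K\<in>P. ereal (shape_param K))" by (rule SUP_upper[OF K])
  also have "\<dots> \<le> coarse_shape T" unfolding coarse_shape_def by (rule SUP_upper2[OF T]) simp
  finally show "ereal (shape_param K) \<le> coarse_shape T" .
next
  assume K: "K \<in> Q"
  have "ereal (shape_param K) \<le> (SUP K\<in>Q. ereal (shape_param K))" by (rule SUP_upper[OF K])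
  also have "\<dots> \<le> fine_shape T" unfolding fine_shape_def by (rule SUP_upper2[OF T]) simp
  finally show "ereal (shape_param K) \<le> fine_shape T" .
qed

text \<open>The shape of K' shows that \<open>coarse_shape T\<close> is nonnegative; being bounded
  above as well, it is a real number, so the product in the hypothesis is an ordinary one.\<close>

lemma fine_shape_bound:
  assumes T: "(P, Q) \<in> T" and K': "K' \<in> P" "bounded K'" and c: "coarse_shape T \<le> ereal \<rho>"
    and f: "fine_shape T \<le> ereal C * coarse_shape T" and K: "K \<in> Q"
  shows "shape_param K \<le> \<bar>C\<bar> * \<bar>\<rho>\<bar>"
proof -
  have "ereal 0 \<le> coarse_shape T"
    using shape_bounds(1)[OF T K'(1)] shape_param_nonneg[OF K'(2)] by (meson ereal_less_eq(3) order_trans)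
  then obtain t where t: "coarse_shape T = ereal t" "0 \<le> t" "t \<le> \<rho>"
    using c by (cases "coarse_shape T") auto
  have "ereal (shape_param K) \<le> ereal (C * t)"
    using order_trans[OF shape_bounds(2)[OF T K] f] by (simp add: t(1))
  then have "shape_param K \<le> C * t" by simp
  also have "\<dots> \<le> \<bar>C\<bar> * t" using t by (intro mult_right_mono) auto
  also have "\<dots> \<le> \<bar>C\<bar> * \<bar>\<rho>\<bar>" using t by (intro mult_left_mono) auto
  finally show ?thesis .
qed

text \<open>The bound on U replaces U by the square root of X, and the product of that root with V
  is at most X / 4 + V^2 by completing a square.\<close>

lemma pairing_lower_bound:
  fixes \<kappa> X U V t :: real
  assumes "\<kappa> > 0" "X \<ge> 0" "U \<ge> 0" "V \<ge> 0" and U: "U\<^sup>2 \<le> \<kappa> * X" and t: "X / 4 + V\<^sup>2 \<le> 2 * t"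
  shows "1 / (2 * sqrt \<kappa>) * U * V \<le> t"
proof -
  have "U \<le> sqrt (\<kappa> * X)" using U by (rule real_le_rsqrt)
  then have "U / sqrt \<kappa> \<le> sqrt X" using assms(1) by (simp add: real_sqrt_mult pos_divide_le_eq mult.commute)
  then have "U / sqrt \<kappa> * V \<le> sqrt X * V" using assms(4) by (rule mult_right_mono)
  also have "\<dots> \<le> X / 4 + V\<^sup>2"
  proof -
    have "(sqrt X)\<^sup>2 = X" using assms(2) by simp
    then show ?thesis using zero_le_power2[of "sqrt X / 2 - V"] by (simp add: power2_diff power_divide)
  qed
  finally show ?thesis using t by simp
qed

theorem theorem4p8:
  shows "\<exists>\<gamma> :: nat \<Rightarrow> real \<Rightarrow> real \<Rightarrow> real \<Rightarrow> real \<Rightarrow> real \<Rightarrow> real \<Rightarrow> real.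
    (\<forall>M R R' Nb Ni Nc NB. \<gamma> M R R' Nb Ni Nc NB > 0) \<and>
    (\<forall>(\<Omega> :: 'a::euclidean_space set) m b c \<rho>s Cs.
       bounded \<Omega> \<longrightarrow> lipschitz_polyhedron \<Omega> \<longrightarrow>
       b \<in> W1inf_div \<Omega> \<longrightarrow> c \<in> W1inf \<Omega> \<longrightarrow> inv_abs_norm \<Omega> b < \<infinity> \<longrightarrow>
       transport_boundedly_invertible \<Omega> b c \<longrightarrow>
       (\<exists>\<sigma>0>0. \<forall>T :: ('a set set \<times> 'a set set) set.
          (\<forall>(P, Q)\<in>T. simplicial_partition \<Omega> P \<and> simplicial_partition \<Omega> Q \<and> is_refinement Q P) \<longrightarrow>
          coarse_shape T \<le> ereal \<rho>s \<longrightarrow>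
          fine_shape T \<le> ereal Cs * coarse_shape T \<longrightarrow>
          0 < mesh_sigma T \<longrightarrow> mesh_sigma T \<le> ereal \<sigma>0 \<longrightarrow>
          (\<forall>(P, Q)\<in>T.
             (\<forall>K\<in>Q. average K b \<noteq> 0) \<and>
             (\<forall>u\<in>pw_polys m P. \<forall>w\<in>H_adv_0 \<Omega> b \<inter> pw_polys m P. \<forall>F.
                (\<forall>K\<in>Q. steepest_inflow_face K (average K b) (F K)) \<longrightarrow>
                breve_t \<Omega> b c m Q F u w \<in> pw_polys (m + 1) Q \<and>
                (\<forall>M R R' Nb Ni Nc NB.
                   m \<le> M \<longrightarrow> coarse_shape T \<le> ereal R \<longrightarrow> fine_shape T \<le> ereal R' \<longrightarrow>
                   W1inf_div_norm \<Omega> b \<le> ereal Nb \<longrightarrow> inv_abs_norm \<Omega> b \<le> ereal Ni \<longrightarrow>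
                   W1inf_norm \<Omega> c \<le> ereal Nc \<longrightarrow> transport_inv_norm \<Omega> b c \<le> ereal NB \<longrightarrow>
                   b_h \<Omega> b c Q u w (breve_t \<Omega> b c m Q F u w)
                     \<ge> \<gamma> M R R' Nb Ni Nc NB * U_norm \<Omega> b u w
                         * V_norm \<Omega> b Q (breve_t \<Omega> b c m Q F u w))))))"
proof (rule exI[of _ "\<lambda>M R R' Nb Ni Nc NB. 1 / (2 * sqrt (stability_constant Nb Nc NB))"], intro conjI allI impI)
  show "0 < 1 / (2 * sqrt (stability_constant Nb Nc NB))" for Nb Nc NB
    using stability_constant_pos[of Nb Nc NB] by simp
next
  fix \<Omega> :: "'a set" and m b c and \<rho>s Cs :: real
  assume \<Omega>b: "bounded \<Omega>" and "lipschitz_polyhedron \<Omega>" and b: "b \<in> W1inf_div \<Omega>" and c: "c \<in> W1inf \<Omega>"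
    and inv: "inv_abs_norm \<Omega> b < \<infinity>" and tinv: "transport_boundedly_invertible \<Omega> b c"
  then have \<Omega>: "lipschitz_domain \<Omega>" by (simp add: lipschitz_polyhedron_def)
  have \<Omega>o: "open \<Omega>" by (rule lipschitz_domain_interior_closure(1)[OF \<Omega>])
  \<comment> \<open>These bounds are fixed from the data, as \<sigma>0 may depend on them; \<gamma>
    has to work for any bounds supplied later.\<close>
  obtain Nb0 where Nb0: "W1inf_div_norm \<Omega> b \<le> ereal Nb0" using W1inf_div_norm_finite[OF b] by blast
  obtain Nc0 where Nc0: "W1inf_norm \<Omega> c \<le> ereal Nc0" using W1inf_norm_finite[OF c] by blast
  have "transport_inv_norm \<Omega> b c < \<infinity>" using tinv by (simp add: transport_boundedly_invertible_def)
  then obtain NB0 where NB0: "transport_inv_norm \<Omega> b c \<le> ereal NB0"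
    by (cases "transport_inv_norm \<Omega> b c") auto
  define k0 where "k0 = stability_constant Nb0 Nc0 NB0"
  have k0: "k0 > 0" by (simp add: k0_def stability_constant_pos)
  define q where "q = \<bar>Cs\<bar> * \<bar>\<rho>s\<bar>"
  have q: "q \<ge> 0" by (simp add: q_def)
  \<comment> \<open>Four times a common bound for the coarse shapes and the fine ones, of which the
    latter are at most q; the 1 makes \<kappa> positive.\<close>
  define \<kappa> where "\<kappa> = 4 * (\<bar>\<rho>s\<bar> + q + 1)"
  have \<kappa>: "\<kappa> > 0" using q by (simp add: \<kappa>_def)
  obtain B \<sigma>1 where B: "B \<ge> 0" and \<sigma>1: "\<sigma>1 > 0" "\<sigma>1 \<le> 1" and glob: "\<forall>\<sigma> P Q. 0 < \<sigma> \<longrightarrow> \<sigma> \<le> \<sigma>1 \<longrightarrow>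
    simplicial_partition \<Omega> P \<longrightarrow> simplicial_partition \<Omega> Q \<longrightarrow> is_refinement Q P \<longrightarrow>
    (\<forall>K\<in>P. 4 * shape_param K \<le> \<kappa>) \<longrightarrow> (\<forall>K\<in>Q. 4 * shape_param K \<le> \<kappa>) \<longrightarrow> (\<forall>K'\<in>P. diameter K' \<le> \<sigma>) \<longrightarrow>
    (\<forall>K\<in>Q. \<forall>K'\<in>P. K \<subseteq> K' \<longrightarrow> diameter K \<le> \<sigma> * diameter K') \<longrightarrow>
    (\<forall>K\<in>Q. average K b \<noteq> 0) \<and>
    (\<forall>u\<in>pw_polys m P. \<forall>w\<in>H_adv \<Omega> b \<inter> pw_polys m P. \<forall>F. (\<forall>K\<in>Q. steepest_inflow_face K (average K b) (F K)) \<longrightarrow>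
      breve_t \<Omega> b c m Q F u w \<in> pw_polys (m + 1) Q \<and>
      (LINT x|lebesgue_on \<Omega>. (w x - u x)\<^sup>2 + (adv \<Omega> b w x + (c x - weak_div \<Omega> b x) * u x + weak_div \<Omega> b x * w x)\<^sup>2)
        + (V_norm \<Omega> b Q (breve_t \<Omega> b c m Q F u w))\<^sup>2 - B * \<sigma>\<^sup>2 * (U_norm \<Omega> b u w)\<^sup>2
       \<le> 2 * b_h \<Omega> b c Q u w (breve_t \<Omega> b c m Q F u w))"
    using global_estimate[OF \<Omega> \<Omega>b b c inv \<kappa>, of m] by (elim exE conjE) blast
  \<comment> \<open>As \<sigma>0 \<le> 1, its square is at most \<sigma>0, so B \<sigma>0^2 k0 stays
    below 3 / 4. A quarter of the squared norm of (w - u, g) thus survives after the error is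
    absorbed.\<close>
  define \<sigma>0 where "\<sigma>0 = min \<sigma>1 (1 / (2 * (B * k0 + 1)))"
  have Bk: "B * k0 \<ge> 0" using B k0 by simp
  have \<sigma>0: "\<sigma>0 > 0" "\<sigma>0 \<le> \<sigma>1" "\<sigma>0 \<le> 1 / (2 * (B * k0 + 1))" using \<sigma>1 Bk by (auto simp: \<sigma>0_def)
  have small: "B * \<sigma>0\<^sup>2 * k0 \<le> 3 / 4"
  proof -
    have "\<sigma>0\<^sup>2 \<le> \<sigma>0" using \<sigma>0 \<sigma>1 by (simp add: power2_eq_square mult_left_le)
    then have "(B * k0) * \<sigma>0\<^sup>2 \<le> (B * k0) * (1 / (2 * (B * k0 + 1)))" using Bk \<sigma>0(3) by (intro mult_left_mono) auto
    also have "\<dots> \<le> 3 / 4" using Bk by (simp add: divide_le_eq)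
    finally show ?thesis by (simp add: mult_ac)
  qed
  have main: "(\<forall>K\<in>Q. average K b \<noteq> 0) \<and>
             (\<forall>u\<in>pw_polys m P. \<forall>w\<in>H_adv_0 \<Omega> b \<inter> pw_polys m P. \<forall>F.
                (\<forall>K\<in>Q. steepest_inflow_face K (average K b) (F K)) \<longrightarrow>
                breve_t \<Omega> b c m Q F u w \<in> pw_polys (m + 1) Q \<and>
                (\<forall>(M::nat) R R' Nb Ni Nc NB.
                   m \<le> M \<longrightarrow> coarse_shape T \<le> ereal R \<longrightarrow> fine_shape T \<le> ereal R' \<longrightarrow>
                   W1inf_div_norm \<Omega> b \<le> ereal Nb \<longrightarrow> inv_abs_norm \<Omega> b \<le> ereal Ni \<longrightarrow>
                   W1inf_norm \<Omega> c \<le> ereal Nc \<longrightarrow> transport_inv_norm \<Omega> b c \<le> ereal NB \<longrightarrow>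
                   1 / (2 * sqrt (stability_constant Nb Nc NB)) * U_norm \<Omega> b u w
                         * V_norm \<Omega> b Q (breve_t \<Omega> b c m Q F u w) \<le> b_h \<Omega> b c Q u w (breve_t \<Omega> b c m Q F u w)))"
    if Tp: "\<forall>(P, Q)\<in>T. simplicial_partition \<Omega> P \<and> simplicial_partition \<Omega> Q \<and> is_refinement Q P"
      and cs: "coarse_shape T \<le> ereal \<rho>s" and fs: "fine_shape T \<le> ereal Cs * coarse_shape T"
      and ms: "mesh_sigma T \<le> ereal \<sigma>0" and PQ: "(P, Q) \<in> T" for T P Q
  proof -
    have P: "simplicial_partition \<Omega> P" and Q: "simplicial_partition \<Omega> Q" and ref: "is_refinement Q P"
      using Tp PQ by auto
    note Pf = partition_facts[OF \<Omega> P] and Qf = partition_facts[OF \<Omega> Q]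
    have PKf: "bounded K" "open K" "K \<noteq> {}" if "K \<in> P" for K using open_simplex_facts[OF Pf(2)[OF that]] by auto
    have s1: "\<forall>K\<in>P. 4 * shape_param K \<le> \<kappa>"
    proof
      fix K assume K: "K \<in> P"
      have "ereal (shape_param K) \<le> ereal \<rho>s" using shape_bounds(1)[OF PQ K] cs by (rule order_trans)
      then have "shape_param K \<le> \<bar>\<rho>s\<bar> + q + 1" using q abs_ge_self[of \<rho>s] unfolding ereal_less_eq by linarith
      then show "4 * shape_param K \<le> \<kappa>" unfolding \<kappa>_def by (rule mult_left_mono) simp
    qed
    have s2: "\<forall>K\<in>Q. 4 * shape_param K \<le> \<kappa>"
    proof
      fix K assume K: "K \<in> Q"
      obtain K' where K': "K' \<in> P" using ref K by (auto simp: is_refinement_def)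
      have "shape_param K \<le> q" unfolding q_def by (rule fine_shape_bound[OF PQ K' PKf(1)[OF K'] cs fs K])
      then have "shape_param K \<le> \<bar>\<rho>s\<bar> + q + 1" using abs_ge_zero[of \<rho>s] by linarith
      then show "4 * shape_param K \<le> \<kappa>" unfolding \<kappa>_def by (rule mult_left_mono) simp
    qed
    have s3: "\<forall>K'\<in>P. diameter K' \<le> \<sigma>0" using mesh_sigma_bounds(1)[OF PQ ms] by blast
    have s4: "\<forall>K\<in>Q. \<forall>K'\<in>P. K \<subseteq> K' \<longrightarrow> diameter K \<le> \<sigma>0 * diameter K'"
    proof (intro ballI impI)
      fix K K' assume K: "K \<in> Q" "K' \<in> P" "K \<subseteq> K'"
      \<comment> \<open>The mesh parameter bounds a quotient of diameters; a ball inside K' makes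
        the denominator positive, so that it can be cleared.\<close>
      obtain x r where r: "r > 0" "ball x r \<subseteq> K'" using PKf(2,3)[OF K(2)] open_contains_ball by blast
      have "2 * r \<le> diameter K'" using diameter_subset[OF r(2) PKf(1)[OF K(2)]] r(1) by simp
      then have "diameter K' > 0" using r by linarith
      then show "diameter K \<le> \<sigma>0 * diameter K'"
        using mesh_sigma_bounds(2)[OF PQ ms K(2,1,3)] by (simp add: pos_divide_le_eq)
    qed
    note G = glob[THEN spec, THEN spec, THEN spec, THEN mp, OF \<sigma>0(1), THEN mp, OF \<sigma>0(2), THEN mp, OF P, THEN mp, OF Q,
        THEN mp, OF ref, THEN mp, OF s1, THEN mp, OF s2, THEN mp, OF s3, THEN mp, OF s4]
    show ?thesis
    proof (rule conjI, goal_cases)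
      case 1
      show ?case by (rule G[THEN conjunct1])
    next
      case 2
      show ?case
      proof (intro ballI allI impI, rule conjI, goal_cases)
        case (1 u w F)
        then show ?case using G[THEN conjunct2] by (auto simp: H_adv_0_def)
      next
        case (2 u w F)
        have uP: "u \<in> pw_polys m P" and w0: "w \<in> H_adv_0 \<Omega> b" and wP: "w \<in> pw_polys m P"
          and F: "\<forall>K\<in>Q. steepest_inflow_face K (average K b) (F K)" using 2 by auto
        have wH: "w \<in> H_adv \<Omega> b \<inter> pw_polys m P" using w0 wP by (auto simp: H_adv_0_def)
        let ?t = "breve_t \<Omega> b c m Q F u w"
        let ?X = "LINT x|lebesgue_on \<Omega>. (w x - u x)\<^sup>2 + (adv \<Omega> b w x + (c x - weak_div \<Omega> b x) * u x + weak_div \<Omega> b x * w x)\<^sup>2"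
        have g: "?X + (V_norm \<Omega> b Q ?t)\<^sup>2 - B * \<sigma>0\<^sup>2 * (U_norm \<Omega> b u w)\<^sup>2 \<le> 2 * b_h \<Omega> b c Q u w ?t"
          by (rule G[THEN conjunct2, THEN bspec, OF uP, THEN bspec, OF wH, THEN spec, THEN mp, OF F, THEN conjunct2])
        have uL: "u \<in> L2 \<Omega>"
          using Linf_imp_L2[OF _ pw_polys_Linf[OF \<Omega> P uP]] \<Omega>o \<Omega>b by (simp add: lmeasurable_open)
        have X0: "?X \<ge> 0" by simp
        \<comment> \<open>Used twice: with the fixed bounds to absorb the error, and with arbitrary
          bounds to obtain \<gamma>.\<close>
        note stab = U_norm_stability[OF \<Omega>o \<Omega>b b c tinv _ _ _ w0 uL]
        have "B * \<sigma>0\<^sup>2 * (U_norm \<Omega> b u w)\<^sup>2 \<le> B * \<sigma>0\<^sup>2 * (k0 * ?X)"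
          using stab[OF Nb0 Nc0 NB0] B by (intro mult_left_mono) (auto simp: k0_def)
        also have "\<dots> = (B * \<sigma>0\<^sup>2 * k0) * ?X" by (simp only: mult.assoc)
        also have "\<dots> \<le> 3 / 4 * ?X" using small X0 by (rule mult_right_mono)
        finally have t: "?X / 4 + (V_norm \<Omega> b Q ?t)\<^sup>2 \<le> 2 * b_h \<Omega> b c Q u w ?t" using g by linarith
        have nn: "0 \<le> U_norm \<Omega> b u w" "0 \<le> V_norm \<Omega> b Q ?t"
          by (auto simp: U_norm_def V_norm_def intro!: add_nonneg_nonneg sum_nonneg)
        show ?case
        proof (intro allI impI)
          fix Nb Nc NB assume "W1inf_div_norm \<Omega> b \<le> ereal Nb" "W1inf_norm \<Omega> c \<le> ereal Nc" "transport_inv_norm \<Omega> b c \<le> ereal NB"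
          from pairing_lower_bound[OF stability_constant_pos X0 nn stab[OF this] t]
          show "1 / (2 * sqrt (stability_constant Nb Nc NB)) * U_norm \<Omega> b u w * V_norm \<Omega> b Q ?t \<le> b_h \<Omega> b c Q u w ?t" .
        qed
      qed
    qed
  qed
  show "\<exists>\<sigma>0>0. \<forall>T :: ('a set set \<times> 'a set set) set.
          (\<forall>(P, Q)\<in>T. simplicial_partition \<Omega> P \<and> simplicial_partition \<Omega> Q \<and> is_refinement Q P) \<longrightarrow>
          coarse_shape T \<le> ereal \<rho>s \<longrightarrow>
          fine_shape T \<le> ereal Cs * coarse_shape T \<longrightarrow>
          0 < mesh_sigma T \<longrightarrow> mesh_sigma T \<le> ereal \<sigma>0 \<longrightarrow>
          (\<forall>(P, Q)\<in>T.
             (\<forall>K\<in>Q. average K b \<noteq> 0) \<and>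
             (\<forall>u\<in>pw_polys m P. \<forall>w\<in>H_adv_0 \<Omega> b \<inter> pw_polys m P. \<forall>F.
                (\<forall>K\<in>Q. steepest_inflow_face K (average K b) (F K)) \<longrightarrow>
                breve_t \<Omega> b c m Q F u w \<in> pw_polys (m + 1) Q \<and>
                (\<forall>M R R' Nb Ni Nc NB.
                   m \<le> M \<longrightarrow> coarse_shape T \<le> ereal R \<longrightarrow> fine_shape T \<le> ereal R' \<longrightarrow>
                   W1inf_div_norm \<Omega> b \<le> ereal Nb \<longrightarrow> inv_abs_norm \<Omega> b \<le> ereal Ni \<longrightarrow>
                   W1inf_norm \<Omega> c \<le> ereal Nc \<longrightarrow> transport_inv_norm \<Omega> b c \<le> ereal NB \<longrightarrow>
                   1 / (2 * sqrt (stability_constant Nb Nc NB)) * U_norm \<Omega> b u w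
                         * V_norm \<Omega> b Q (breve_t \<Omega> b c m Q F u w)
                     \<le> b_h \<Omega> b c Q u w (breve_t \<Omega> b c m Q F u w))))"
    by (rule exI[of _ \<sigma>0], rule conjI[OF \<sigma>0(1)], intro allI impI ballI case_prodI2) (rule main, (assumption | simp)+)
qed

end
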